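(* Let $f,g$ be pre-subgroups of $V$ with $\langle f,g\rangle=n^{-1/2}$. Then $A_{f,f}$ and $B_{g,g}$ are unital $*$-subalgebras of $\mathcal L(\mathcal H)$, and there exists a unique multiplicative unitary $W\in\mathcal L(\mathcal H\otimes\mathcal H)$ of multiplicity 1 for which $g$ is a fixed vector, $f$ is a cofixed vector, $\{(\omega\otimes\mathrm{id})(W):\omega\in\mathcal L(\mathcal H)^*\}=A_{f,f}$ and $\{(\mathrm{id}\otimes\omega)(W):\omega\in\mathcal L(\mathcal H)^*\}=B_{g,g}$.
   Context: Let $\mathcal H$ be a Hilbert space of finite dimension $n\ge1$ (inner products linear in the second variable) and $V\in\mathcal L(\mathcal H\otimes\mathcal H)$ a multiplicative unitary, i.e. a unitary with $V_{12}V_{13}V_{23}=V_{23}V_{12}$ (leg notation). $\xi$ is fixed (for a multiplicative unitary $V$) if $V(\xi\otimes\eta)=\xi\otimes\eta$ for all $\eta$, cofixed if $V(\eta\otimes\xi)=\eta\otimes\xi$ for all $\eta$; multiplicity 1 means the fixed vectors form a line (then so do cofixed vectors). Assume $V$ has multiplicity 1; fix a unit fixed vector $e$ and the unit cofixed vector $\hat e$ with $\langle e,\hat e\rangle=n^{-1/2}$. $L(\omega)=(\omega\otimes\mathrm{id})(V)$, $\rho(\omega)=(\mathrm{id}\otimes\omega)(V)$, $S=\{L(\omega)\}$, $\widehat S=\{\rho(\omega)\}$ ($\omega\in\mathcal L(\mathcal H)^*$). The map $\kappa:L(\omega)\mapsto(\omega\otimes\mathrm{id})(V^* )$ is a well-defined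 involutive antiautomorphism of $S$, and $U$ is the unitary on $\mathcal H$ with $U(xe)=\kappa(x)e$ for $x\in S$. A pre-subgroup is $f\in\mathcal H$ with $\|f\|=1$, $\langle f,e\rangle>0$, $V(f\otimes f)=f\otimes f$; $H^f=\{\eta:V(f\otimes\eta)=f\otimes\eta\}$, $H_f=\{\eta:V(\eta\otimes f)=\eta\otimes f\}$. Define $G_f=\{x\in S:xe\in H_f\}$, $D_g=\{x\in S:xe\in UH_g\}$, $\widehat D_f=\{y\in\widehat S:y\hat e\in H^f\}$, $\widehat G_g=\{y\in\widehat S: y\hat e\in UH^g\}$. Let $A_{f,f}$ be the linear span of $\{xy: x\in U\widehat D_fU,\ y\in G_f\}$ and $B_{g,g}$ the linear span of $\{xy: x\in D_g,\ y\in\widehat G_g\}$. *)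

theory Defs
  imports "HOL-Analysis.Analysis"
begin

text \<open>Finite-dimensional Hilbert space H = complex^'n (n = CARD('n)), operators are
  matrices complex^'n^'n, H\<otimes>H = complex^('n \<times> 'n), H\<otimes>H\<otimes>H = complex^('n \<times> 'n \<times> 'n).
  Inner product is linear in the second variable.\<close>

definition cinner :: "complex^'n::finite \<Rightarrow> complex^'n \<Rightarrow> complex" where
  "cinner x y = (\<Sum>i\<in>UNIV. cnj (x $ i) * y $ i)"

definition tens :: "complex^'n::finite \<Rightarrow> complex^'n \<Rightarrow> complex^('n \<times> 'n)" where
  "tens x y = (\<chi> p. x $ fst p * y $ snd p)"

definition cadj :: "complex^'m::finite^'n::finite \<Rightarrow> complex^'n^'m" where
  "cadj A = (\<chi> i j. cnj (A $ j $ i))"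

definition cmscale :: "complex \<Rightarrow> complex^'m::finite^'n::finite \<Rightarrow> complex^'m^'n" where
  "cmscale c A = (\<chi> i j. c * A $ i $ j)"

definition unitary_op :: "complex^'n::finite^'n \<Rightarrow> bool" where
  "unitary_op A \<longleftrightarrow> A ** cadj A = mat 1 \<and> cadj A ** A = mat 1"

definition leg12 :: "complex^('n::finite \<times> 'n)^('n \<times> 'n) \<Rightarrow> complex^('n \<times> 'n \<times> 'n)^('n \<times> 'n \<times> 'n)" where
  "leg12 V = (\<chi> p q. if snd (snd p) = snd (snd q)
       then V $ (fst p, fst (snd p)) $ (fst q, fst (snd q)) else 0)"

definition leg13 :: "complex^('n::finite \<times> 'n)^('n \<times> 'n) \<Rightarrow> complex^('n \<times> 'n \<times> 'n)^('n \<times> 'n \<times> 'n)" where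
  "leg13 V = (\<chi> p q. if fst (snd p) = fst (snd q)
       then V $ (fst p, snd (snd p)) $ (fst q, snd (snd q)) else 0)"

definition leg23 :: "complex^('n::finite \<times> 'n)^('n \<times> 'n) \<Rightarrow> complex^('n \<times> 'n \<times> 'n)^('n \<times> 'n \<times> 'n)" where
  "leg23 V = (\<chi> p q. if fst p = fst q then V $ snd p $ snd q else 0)"

definition mult_unitary :: "complex^('n::finite \<times> 'n)^('n \<times> 'n) \<Rightarrow> bool" where
  "mult_unitary V \<longleftrightarrow> unitary_op V \<and>
     leg12 V ** leg13 V ** leg23 V = leg23 V ** leg12 V"

definition fixedv :: "complex^('n::finite \<times> 'n)^('n \<times> 'n) \<Rightarrow> complex^'n \<Rightarrow> bool" where
  "fixedv V \<xi> \<longleftrightarrow> (\<forall>\<eta>. V *v tens \<xi> \<eta> = tens \<xi> \<eta>)"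

definition cofixedv :: "complex^('n::finite \<times> 'n)^('n \<times> 'n) \<Rightarrow> complex^'n \<Rightarrow> bool" where
  "cofixedv V \<xi> \<longleftrightarrow> (\<forall>\<eta>. V *v tens \<eta> \<xi> = tens \<eta> \<xi>)"

definition mult_one :: "complex^('n::finite \<times> 'n)^('n \<times> 'n) \<Rightarrow> bool" where
  "mult_one V \<longleftrightarrow> (\<exists>\<xi>. \<xi> \<noteq> 0 \<and> {\<eta>. fixedv V \<eta>} = range (\<lambda>c. c *s \<xi>))"

definition clin_functional :: "(complex^'n::finite^'n \<Rightarrow> complex) \<Rightarrow> bool" where
  "clin_functional \<omega> \<longleftrightarrow> (\<forall>a S T. \<omega> (cmscale a S + T) = a * \<omega> S + \<omega> T)"

definition slice_left :: "complex^('n::finite \<times> 'n)^('n \<times> 'n) \<Rightarrow> (complex^'n^'n \<Rightarrow> complex) \<Rightarrow> complex^'n^'n" where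
  "slice_left V \<omega> = (\<chi> k l. \<omega> (\<chi> i j. V $ (i, k) $ (j, l)))"

definition slice_right :: "complex^('n::finite \<times> 'n)^('n \<times> 'n) \<Rightarrow> (complex^'n^'n \<Rightarrow> complex) \<Rightarrow> complex^'n^'n" where
  "slice_right V \<omega> = (\<chi> i j. \<omega> (\<chi> k l. V $ (i, k) $ (j, l)))"

definition leftS :: "complex^('n::finite \<times> 'n)^('n \<times> 'n) \<Rightarrow> (complex^'n^'n) set" where
  "leftS V = {slice_left V \<omega> | \<omega>. clin_functional \<omega>}"

definition rightS :: "complex^('n::finite \<times> 'n)^('n \<times> 'n) \<Rightarrow> (complex^'n^'n) set" where
  "rightS V = {slice_right V \<omega> | \<omega>. clin_functional \<omega>}"

definition presubgroup :: "complex^('n::finite \<times> 'n)^('n \<times> 'n) \<Rightarrow> complex^'n \<Rightarrow> complex^'n \<Rightarrow> bool" where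
  "presubgroup V e f \<longleftrightarrow> norm f = 1 \<and> cinner f e \<in> \<real> \<and> Re (cinner f e) > 0 \<and>
     V *v tens f f = tens f f"

definition Hup :: "complex^('n::finite \<times> 'n)^('n \<times> 'n) \<Rightarrow> complex^'n \<Rightarrow> (complex^'n) set" where
  "Hup V f = {\<eta>. V *v tens f \<eta> = tens f \<eta>}"

definition Hdown :: "complex^('n::finite \<times> 'n)^('n \<times> 'n) \<Rightarrow> complex^'n \<Rightarrow> (complex^'n) set" where
  "Hdown V f = {\<eta>. V *v tens \<eta> f = tens \<eta> f}"

definition Gsub :: "complex^('n::finite \<times> 'n)^('n \<times> 'n) \<Rightarrow> complex^'n \<Rightarrow> complex^'n \<Rightarrow> (complex^'n^'n) set" where
  "Gsub V e f = {x \<in> leftS V. x *v e \<in> Hdown V f}"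

definition Dsub :: "complex^('n::finite \<times> 'n)^('n \<times> 'n) \<Rightarrow> complex^'n \<Rightarrow> complex^'n^'n \<Rightarrow> complex^'n \<Rightarrow> (complex^'n^'n) set" where
  "Dsub V e U g = {x \<in> leftS V. x *v e \<in> (\<lambda>v. U *v v) ` Hdown V g}"

definition hatDsub :: "complex^('n::finite \<times> 'n)^('n \<times> 'n) \<Rightarrow> complex^'n \<Rightarrow> complex^'n \<Rightarrow> (complex^'n^'n) set" where
  "hatDsub V ehat f = {y \<in> rightS V. y *v ehat \<in> Hup V f}"

definition hatGsub :: "complex^('n::finite \<times> 'n)^('n \<times> 'n) \<Rightarrow> complex^'n \<Rightarrow> complex^'n^'n \<Rightarrow> complex^'n \<Rightarrow> (complex^'n^'n) set" where
  "hatGsub V ehat U g = {y \<in> rightS V. y *v ehat \<in> (\<lambda>v. U *v v) ` Hup V g}"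

definition cspan_op :: "(complex^'n::finite^'n) set \<Rightarrow> (complex^'n^'n) set" where
  "cspan_op X = {x. \<exists>F c. finite F \<and> F \<subseteq> X \<and> x = (\<Sum>a\<in>F. cmscale (c a) a)}"

definition Aff :: "complex^('n::finite \<times> 'n)^('n \<times> 'n) \<Rightarrow> complex^'n \<Rightarrow> complex^'n \<Rightarrow> complex^'n^'n \<Rightarrow> complex^'n \<Rightarrow> (complex^'n^'n) set" where
  "Aff V e ehat U f = cspan_op {x ** y | x y. x \<in> {U ** z ** U | z. z \<in> hatDsub V ehat f} \<and> y \<in> Gsub V e f}"

definition Bgg :: "complex^('n::finite \<times> 'n)^('n \<times> 'n) \<Rightarrow> complex^'n \<Rightarrow> complex^'n \<Rightarrow> complex^'n^'n \<Rightarrow> complex^'n \<Rightarrow> (complex^'n^'n) set" where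
  "Bgg V e ehat U g = cspan_op {x ** y | x y. x \<in> Dsub V e U g \<and> y \<in> hatGsub V ehat U g}"

definition unital_star_subalg :: "(complex^'n::finite^'n) set \<Rightarrow> bool" where
  "unital_star_subalg A \<longleftrightarrow> mat 1 \<in> A \<and>
     (\<forall>a\<in>A. \<forall>b\<in>A. a + b \<in> A \<and> a ** b \<in> A) \<and>
     (\<forall>c. \<forall>a\<in>A. cmscale c a \<in> A) \<and> (\<forall>a\<in>A. cadj a \<in> A)"

end

theory Submission
  imports Defs
begin

text \<open>With \<open>\<delta>(x) = V(x \<otimes> 1)V\<^sup>*\<close> and \<open>\<beta>(y) = V(1 \<otimes> UyU)V\<^sup>*\<close>, the unitary is a product \<open>W = YX\<close>
  generalising the matched pair construction for a factorised group. The condition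
  \<open>\<langle>f,g\<rangle> = n\<^sup>-\<^sup>1\<^sup>/\<^sup>2\<close> forces the projections onto \<open>H\<^sup>f\<close> and \<open>H\<^sup>g\<close> to have the rank one product
  \<open>|e'\<rangle>\<langle>e'|\<close>, where \<open>e'\<close> is the cofixed vector, and those onto \<open>H\<^sub>f\<close> and \<open>H\<^sub>g\<close> the product
  \<open>|e\<rangle>\<langle>e|\<close>. Hence \<open>x\<zeta> \<otimes> \<eta> \<mapsto> \<delta>(x)(\<zeta> \<otimes> \<eta>)\<close> (\<open>x \<in> G\<^sub>f\<close>, \<open>\<zeta> \<in> H\<^sub>g\<close>) and
  \<open>y\<zeta> \<otimes> \<eta> \<mapsto> \<beta>(y)(\<zeta> \<otimes> \<eta>)\<close> (\<open>y \<in> D\<^sub>f\<close> of the dual, \<open>\<zeta> \<in> H\<^sup>g\<close>) define unitaries \<open>X\<close> and \<open>Y\<^sup>*\<close>.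
  Since \<open>V\<^sup>*X\<close> commutes with \<open>A \<otimes> 1\<close> and \<open>YV\<close> exchanges \<open>D\<^sub>g \<otimes> 1\<close> with \<open>1 \<otimes> D\<^sub>g\<close>, both sides of
  the pentagon equation for \<open>W\<close> intertwine \<open>a \<otimes> 1 \<otimes> 1\<close> (\<open>a \<in> A\<close>) with the same operator; they agree
  on \<open>g \<otimes> H \<otimes> H\<close> and \<open>Ag = H\<close>. Uniqueness holds because \<open>(f\<^sup>* \<otimes> 1)W(ag \<otimes> 1) = n\<^sup>-\<^sup>1\<^sup>/\<^sup>2 a\<close> for \<open>a \<in> A\<close>.\<close>

subsection \<open>Inner products and elementary tensors\<close>

text \<open>The products G_f H_g fill H without redundancy for this reason: slicing the coproduct by
  the state of g projects the algebra of left slices onto G_g, on G_f this projection takes only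
  scalar values, and the dimensions of G_f and H_g multiply to n. The obstacle is that A is only a
  span of products t x, and no exchange rule between the two factors is proved. Closure under
  multiplication therefore comes last, when A is recognised as a slice algebra of W. The pentagon
  argument must nevertheless place the coefficients of Y \<delta>(a) Y^* in A, and for this A is
  described as the commutant of the dual D_f together with U G_f U. At the start only unitarity, the
  pentagon equation, the line of fixed vectors and the defining relation of U are known. That the
  left slices form a star algebra with cyclic and separating vector e, and that U is self-adjoint,
  are derived from these; each fact is carried to the other leg through \<open>dualV\<close>, with
  the same U.\<close>

abbreviation ax :: "'n::finite \<Rightarrow> complex^'n" where "ax i \<equiv> axis i 1"

lemma ax_nth: "ax i $ j = (if i = j then 1 else 0)"
  by (simp add: axis_def)

lemma sum_UNIV_Times:
  fixes h :: "'a::finite \<times> 'b::finite \<Rightarrow> 'c::comm_monoid_add"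
  shows "(\<Sum>p\<in>UNIV. h p) = (\<Sum>i\<in>UNIV. \<Sum>k\<in>UNIV. h (i, k))"
  by (simp add: sum.cartesian_product UNIV_Times_UNIV[symmetric] del: UNIV_Times_UNIV)

lemma vec_expand: "(x :: complex^'n::finite) = (\<Sum>i\<in>UNIV. x $ i *s ax i)"
  by (simp add: vec_eq_iff ax_nth if_distrib cong: if_cong)

lemma mv_sum: "A *v (\<Sum>i\<in>I. h i) = (\<Sum>i\<in>I. A *v h i)" for A :: "complex^'n::finite^'m::finite"
  by (induction I rule: infinite_finite_induct) (simp_all add: matrix_vector_right_distrib)

lemma sum_mv: "(\<Sum>i\<in>I. M i) *v x = (\<Sum>i\<in>I. M i *v x)" for M :: "_ \<Rightarrow> complex^'n::finite^'m::finite"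
  by (induction I rule: infinite_finite_induct) (simp_all add: matrix_vector_mult_add_rdistrib)

lemma mv_scale: "A *v (c *s x) = c *s (A *v x)" for A :: "complex^'n::finite^'m::finite"
  by (simp add: vec_eq_iff matrix_vector_mult_def sum_distrib_left mult_ac)

lemma cmscale_mv: "cmscale c A *v x = c *s (A *v x)"
  by (simp add: vec_eq_iff matrix_vector_mult_def cmscale_def sum_distrib_left mult_ac)

lemma cmscale_mult_left: "cmscale c A ** B = cmscale c (A ** B)"
  by (simp add: vec_eq_iff matrix_matrix_mult_def cmscale_def sum_distrib_left mult_ac)

lemma cmscale_mult_right: "A ** cmscale c B = cmscale c (A ** B)"
  by (simp add: vec_eq_iff matrix_matrix_mult_def cmscale_def sum_distrib_left mult_ac)

lemma cmscale_cmscale: "cmscale c (cmscale d A) = cmscale (c * d) A"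
  by (simp add: vec_eq_iff cmscale_def mult_ac)

lemma cmscale_one: "cmscale 1 A = A"
  by (simp add: vec_eq_iff cmscale_def)

lemma cmscale_zero [simp]: "cmscale c 0 = 0" "cmscale 0 A = 0"
  by (simp_all add: vec_eq_iff cmscale_def)

lemma cmscale_add_right: "cmscale c (A + B) = cmscale c A + cmscale c B"
  by (simp add: vec_eq_iff cmscale_def algebra_simps)

lemma cmscale_sum: "cmscale c (\<Sum>i\<in>I. M i) = (\<Sum>i\<in>I. cmscale c (M i))"
  by (induction I rule: infinite_finite_induct) (simp_all add: cmscale_add_right)

lemma cmscale_eq_iff: "c \<noteq> 0 \<Longrightarrow> cmscale c A = cmscale c B \<longleftrightarrow> A = B"
  by (auto simp: vec_eq_iff cmscale_def)

lemma matrix_add_rdistrib: "(A + B) ** C = A ** C + B ** C" for A :: "complex^'n::finite^'m::finite"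
  by (simp add: vec_eq_iff matrix_matrix_mult_def algebra_simps sum.distrib)

lemma matrix_sum_mult: "(\<Sum>i\<in>I. M i) ** A = (\<Sum>i\<in>I. M i ** A)" for A :: "complex^'n::finite^'m::finite"
  by (induction I rule: infinite_finite_induct) (simp_all add: matrix_add_rdistrib)

lemma matrix_mult_sum: "A ** (\<Sum>i\<in>I. M i) = (\<Sum>i\<in>I. A ** M i)" for A :: "complex^'n::finite^'m::finite"
  by (induction I rule: infinite_finite_induct) (simp_all add: matrix_add_ldistrib)

lemma cadj_mult: "cadj (A ** B) = cadj B ** cadj A"
  by (simp add: vec_eq_iff cadj_def matrix_matrix_mult_def mult_ac)

lemma cadj_cadj [simp]: "cadj (cadj A) = A"
  by (simp add: vec_eq_iff cadj_def)

lemma cadj_add: "cadj (A + B) = cadj A + cadj B"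
  by (simp add: vec_eq_iff cadj_def)

lemma cadj_diff: "cadj (A - B) = cadj A - cadj B"
  by (simp add: vec_eq_iff cadj_def)

lemma cadj_zero [simp]: "cadj 0 = 0"
  by (simp add: vec_eq_iff cadj_def)

lemma cadj_one [simp]: "cadj (mat 1) = mat 1"
  by (simp add: vec_eq_iff cadj_def mat_def)

lemma cadj_sum: "cadj (\<Sum>i\<in>I. M i) = (\<Sum>i\<in>I. cadj (M i))"
  by (induction I rule: infinite_finite_induct) (simp_all add: cadj_add)

lemma cadj_cmscale: "cadj (cmscale c A) = cmscale (cnj c) (cadj A)"
  by (simp add: vec_eq_iff cadj_def cmscale_def)

lemma cadj_eq_iff: "cadj A = cadj B \<longleftrightarrow> A = B"
  by (metis cadj_cadj)

lemma cinner_add_right: "cinner x (y + z) = cinner x y + cinner x z"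
  by (simp add: cinner_def algebra_simps sum.distrib)

lemma cinner_add_left: "cinner (x + y) z = cinner x z + cinner y z"
  by (simp add: cinner_def algebra_simps sum.distrib)

lemma cinner_diff_right: "cinner x (y - z) = cinner x y - cinner x z"
  by (simp add: cinner_def algebra_simps sum_subtractf)

lemma cinner_diff_left: "cinner (x - y) z = cinner x z - cinner y z"
  by (simp add: cinner_def algebra_simps sum_subtractf)

lemma cinner_scale_right: "cinner x (c *s y) = c * cinner x y"
  by (simp add: cinner_def sum_distrib_left mult_ac)

lemma cinner_scale_left: "cinner (c *s x) y = cnj c * cinner x y"
  by (simp add: cinner_def sum_distrib_left mult_ac)

lemma cinner_zero [simp]: "cinner 0 x = 0" "cinner x 0 = 0"
  by (simp_all add: cinner_def)

lemma cinner_sum_right: "cinner x (\<Sum>i\<in>I. h i) = (\<Sum>i\<in>I. cinner x (h i))"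
  by (induction I rule: infinite_finite_induct) (simp_all add: cinner_add_right)

lemma cinner_sum_left: "cinner (\<Sum>i\<in>I. h i) x = (\<Sum>i\<in>I. cinner (h i) x)"
  by (induction I rule: infinite_finite_induct) (simp_all add: cinner_add_left)

lemma cinner_commute: "cinner y x = cnj (cinner x y)"
  by (simp add: cinner_def mult.commute)

lemma cinner_self: "cinner x x = complex_of_real ((norm x)\<^sup>2)"
proof -
  have "(norm x)\<^sup>2 = (\<Sum>i\<in>UNIV. (norm (x $ i))\<^sup>2)"
    by (simp add: norm_vec_def L2_set_def sum_nonneg)
  then show ?thesis
    by (simp add: cinner_def mult.commute flip: complex_norm_square)
qed

lemma cinner_self_eq_0: "cinner x x = 0 \<longleftrightarrow> x = 0"
  by (simp add: cinner_self)

lemma cinner_adj: "cinner x (A *v y) = cinner (cadj A *v x) y"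
proof -
  have "cinner x (A *v y) = (\<Sum>i\<in>UNIV. \<Sum>j\<in>UNIV. cnj (x $ i) * (A $ i $ j * y $ j))"
    by (simp add: cinner_def matrix_vector_mult_def sum_distrib_left)
  also have "\<dots> = (\<Sum>j\<in>UNIV. \<Sum>i\<in>UNIV. cnj (x $ i) * (A $ i $ j * y $ j))"
    by (rule sum.swap)
  also have "\<dots> = cinner (cadj A *v x) y"
    by (simp add: cinner_def matrix_vector_mult_def cadj_def sum_distrib_right sum_distrib_left mult_ac)
  finally show ?thesis .
qed

lemma cinner_adj': "cinner (A *v x) y = cinner x (cadj A *v y)"
  by (simp add: cinner_adj)

lemma cinner_ax [simp]: "cinner (ax i) x = x $ i" "cinner x (ax i) = cnj (x $ i)"
  by (simp_all add: cinner_def ax_nth if_distrib if_distribR cong: if_cong)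

lemma vec_ext_cinner: "(\<And>a. cinner a x = cinner a y) \<Longrightarrow> x = y"
  by (metis cinner_ax(1) vec_eq_iff)

lemma mat_ext_mv: "(\<And>x. A *v x = B *v x) \<Longrightarrow> A = B" for A :: "complex^'n::finite^'m::finite"
  by (simp add: matrix_eq)

lemma mat_ext_cinner: "(\<And>a b. cinner a (A *v b) = cinner a (B *v b)) \<Longrightarrow> A = B"
  by (rule mat_ext_mv, rule vec_ext_cinner) auto

text \<open>Expanding the norm of \<open>T *v x - x\<close> gives the equality case of
  Cauchy-Schwarz. It turns an equality of quadratic forms into a fixed vector of V.\<close>

lemma unitary_cinner_fix:
  assumes "cadj T ** T = mat 1" "Re (cinner x (T *v x)) \<ge> (norm x)\<^sup>2"
  shows "T *v x = x"
proof -
  have 1: "cinner (T *v x) (T *v x) = cinner x x"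
    by (simp add: cinner_adj matrix_vector_mul_assoc assms)
  have "cinner (T *v x - x) (T *v x - x) = 2 * cinner x x - cinner x (T *v x) - cnj (cinner x (T *v x))"
    using 1 cinner_commute[of x "T *v x"] by (simp add: cinner_diff_left cinner_diff_right)
  then have "Re (cinner (T *v x - x) (T *v x - x)) \<le> 0"
    using assms(2) by (simp add: cinner_self)
  then have "norm (T *v x - x) = 0"
    by (simp add: cinner_self)
  then show ?thesis by simp
qed

lemma unitary_cinner_le:
  assumes "cadj T ** T = mat 1"
  shows "Re (cinner x (T *v x)) \<le> (norm x)\<^sup>2"
proof -
  have 1: "cinner (T *v x) (T *v x) = cinner x x"
    by (simp add: cinner_adj matrix_vector_mul_assoc assms)
  have "cinner (T *v x - x) (T *v x - x) = 2 * cinner x x - cinner x (T *v x) - cnj (cinner x (T *v x))"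
    using 1 cinner_commute[of x "T *v x"] by (simp add: cinner_diff_left cinner_diff_right)
  moreover have "Re (cinner (T *v x - x) (T *v x - x)) \<ge> 0" by (simp add: cinner_self)
  ultimately show ?thesis by (simp add: cinner_self)
qed

lemma tens_nth [simp]: "tens x y $ p = x $ fst p * y $ snd p"
  by (simp add: tens_def)

lemma tens_add: "tens (x + y) z = tens x z + tens y z" "tens z (x + y) = tens z x + tens z y"
  by (simp_all add: vec_eq_iff algebra_simps)

lemma tens_scale: "tens (c *s x) y = c *s tens x y" "tens x (c *s y) = c *s tens x y"
  by (simp_all add: vec_eq_iff)

lemma tens_zero [simp]: "tens 0 y = 0" "tens x 0 = 0"
  by (simp_all add: vec_eq_iff)

lemma tens_sum: "tens (\<Sum>i\<in>I. h i) y = (\<Sum>i\<in>I. tens (h i) y)" "tens y (\<Sum>i\<in>I. h i) = (\<Sum>i\<in>I. tens y (h i))"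
  by (induction I rule: infinite_finite_induct, simp_all add: tens_add)+

lemma cinner_tens: "cinner (tens a b) (tens c d) = cinner a c * cinner b d"
  by (simp add: cinner_def sum_UNIV_Times sum_product mult_ac)

lemma norm_tens: "norm (tens a b) = norm a * norm b"
proof -
  have "(norm (tens a b))\<^sup>2 = (norm a * norm b)\<^sup>2"
    using cinner_tens[of a b a b] unfolding cinner_self power_mult_distrib
    by (metis of_real_eq_iff of_real_mult)
  then show ?thesis by (simp add: power2_eq_iff_nonneg)
qed

lemma tens_ax: "tens (ax i) (ax j) = ax (i, j)"
  by (auto simp: vec_eq_iff ax_nth)

lemma vec_ext_tens: "(\<And>a b. cinner (tens a b) x = cinner (tens a b) y) \<Longrightarrow> x = y"
proof -
  assume a: "\<And>a b. cinner (tens a b) x = cinner (tens a b) y"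
  have "x $ (i, j) = y $ (i, j)" for i j
    using a[of "ax i" "ax j"] by (simp add: tens_ax)
  then show ?thesis by (auto simp: vec_eq_iff)
qed

lemma mat_ext_tens: "(\<And>a b. A *v tens a b = B *v tens a b) \<Longrightarrow> A = B" for A :: "complex^('n::finite\<times>'n)^'m::finite"
proof -
  assume a: "\<And>a b. A *v tens a b = B *v tens a b"
  have "A *v x = B *v x" for x
  proof -
    have x: "x = (\<Sum>p\<in>UNIV. x $ p *s tens (ax (fst p)) (ax (snd p)))"
      using vec_expand[of x] by (simp add: tens_ax)
    show ?thesis by (subst (1 2) x) (simp add: mv_sum mv_scale a)
  qed
  then show ?thesis by (rule mat_ext_mv)
qed

definition ketbra :: "complex^'m::finite \<Rightarrow> complex^'n::finite \<Rightarrow> complex^'n^'m" where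
  "ketbra x y = (\<chi> i j. x $ i * cnj (y $ j))"

lemma ketbra_mv: "ketbra x y *v z = cinner y z *s x"
  by (simp add: vec_eq_iff ketbra_def matrix_vector_mult_def cinner_def sum_distrib_left mult_ac)

lemma cadj_ketbra: "cadj (ketbra x y) = ketbra y x"
  by (simp add: vec_eq_iff ketbra_def cadj_def mult_ac)

lemma mult_ketbra: "A ** ketbra x y = ketbra (A *v x) y"
  by (simp add: vec_eq_iff ketbra_def matrix_matrix_mult_def matrix_vector_mult_def sum_distrib_right sum_distrib_left mult_ac)

lemma ketbra_mult: "ketbra x y ** A = ketbra x (cadj A *v y)"
  using mult_ketbra[of "cadj A" y x] by (metis cadj_cadj cadj_ketbra cadj_mult)

lemma trace_ketbra: "trace (ketbra x y) = cinner y x"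
  by (simp add: trace_def ketbra_def cinner_def mult_ac)

lemma trace_eq_cinner: "trace A = (\<Sum>i\<in>UNIV. cinner (ax i) (A *v ax i))"
  by (simp add: trace_def matrix_vector_mult_def ax_nth if_distrib cong: if_cong)

lemma sum_ketbra_ax: "(\<Sum>i\<in>UNIV. ketbra (ax i) (ax i)) = (mat 1 :: complex^'n::finite^'n)"
  by (rule mat_ext_mv) (simp add: sum_mv ketbra_mv flip: vec_expand)

lemma trace_cmscale: "trace (cmscale c A) = c * trace A"
  by (simp add: trace_def cmscale_def sum_distrib_left)

lemma trace_cadj_mult_self: "trace (cadj A ** A) = (\<Sum>i\<in>UNIV. complex_of_real ((norm (A *v ax i))\<^sup>2))"
  by (simp add: trace_eq_cinner cinner_adj cinner_adj' cinner_self flip: matrix_vector_mul_assoc del: cinner_ax)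

lemma trace_cadj_mult_self_0: "trace (cadj A ** A) = 0 \<Longrightarrow> A = 0"
proof -
  assume "trace (cadj A ** A) = 0"
  then have "(\<Sum>i\<in>UNIV. (norm (A *v ax i))\<^sup>2) = 0"
    unfolding trace_cadj_mult_self by (metis of_real_eq_0_iff of_real_sum)
  then have *: "A *v ax i = 0" for i by (subst (asm) sum_nonneg_eq_0_iff) auto
  show "A = 0"
    by (rule mat_ext_mv, subst vec_expand) (simp add: mv_sum mv_scale *)
qed

lemma trace_cadj_mult_self_nonneg: "Re (trace (cadj A ** A)) \<ge> 0" "Im (trace (cadj A ** A)) = 0"
  by (simp_all add: trace_cadj_mult_self sum_nonneg)

text \<open>An operator is a projection as soon as it is idempotent and fixes every vector on which
  its quadratic form takes the value of the norm, because the latter condition passes to the adjoint.\<close>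
lemma idempotent_selfadjoint:
  assumes "r ** r = r" and "\<And>\<eta>. cinner \<eta> (r *v \<eta>) = cinner \<eta> \<eta> \<Longrightarrow> r *v \<eta> = \<eta>"
  shows "cadj r = r"
proof -
  have "r ** cadj r = cadj r"
  proof (rule mat_ext_mv)
    fix \<xi>
    have i: "cadj r ** cadj r = cadj r" using assms(1) by (metis cadj_mult)
    have "cinner (cadj r *v \<xi>) (r *v (cadj r *v \<xi>)) = cinner (cadj r *v \<xi>) (cadj r *v \<xi>)"
      by (metis cinner_adj matrix_vector_mul_assoc i)
    then show "(r ** cadj r) *v \<xi> = cadj r *v \<xi>"
      using assms(2)[of "cadj r *v \<xi>"] by (simp add: matrix_vector_mul_assoc)
  qed
  then show ?thesis by (metis cadj_cadj cadj_mult)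
qed

text \<open>The trace of a projection is its squared Hilbert-Schmidt norm.\<close>

lemma projection_trace_0:
  assumes "p ** p = p" "cadj p = p" "trace p = 0"
  shows "p = 0"
  by (rule trace_cadj_mult_self_0) (simp add: assms)

subsection \<open>Legs, blocks and slices\<close>

definition kron :: "complex^'n::finite^'n \<Rightarrow> complex^'n^'n \<Rightarrow> complex^('n \<times> 'n)^('n \<times> 'n)" where
  "kron A B = (\<chi> p q. A $ fst p $ fst q * B $ snd p $ snd q)"

text \<open>Coefficients in the standard basis: \<open>blk1\<close> leaves an operator on the second
  leg, \<open>blk2\<close> one on the first. That an operator has a leg in a given subspace is
  expressed by asking all its coefficients on that leg to lie there.\<close>

definition blk1 :: "complex^('n::finite \<times> 'n)^('n \<times> 'n) \<Rightarrow> 'n \<Rightarrow> 'n \<Rightarrow> complex^'n^'n" where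
  "blk1 T i j = (\<chi> k l. T $ (i, k) $ (j, l))"

definition blk2 :: "complex^('n::finite \<times> 'n)^('n \<times> 'n) \<Rightarrow> 'n \<Rightarrow> 'n \<Rightarrow> complex^'n^'n" where
  "blk2 T k l = (\<chi> i j. T $ (i, k) $ (j, l))"

text \<open>\<open>Lsl\<close> and \<open>Rsl\<close> are the slices by the vector functional a
  \<mapsto> \<langle>\<zeta>, a \<eta>\<rangle>, conjugate linear in the first vector. General
  functionals are reduced to these in \<open>slice_left_in\<close> and
  \<open>slice_left_vec\<close>.\<close>

definition Lsl :: "complex^('n::finite \<times> 'n)^('n \<times> 'n) \<Rightarrow> complex^'n \<Rightarrow> complex^'n \<Rightarrow> complex^'n^'n" where
  "Lsl T \<zeta> \<eta> = (\<Sum>i\<in>UNIV. \<Sum>j\<in>UNIV. cmscale (cnj (\<zeta> $ i) * \<eta> $ j) (blk1 T i j))"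

definition Rsl :: "complex^('n::finite \<times> 'n)^('n \<times> 'n) \<Rightarrow> complex^'n \<Rightarrow> complex^'n \<Rightarrow> complex^'n^'n" where
  "Rsl T \<alpha> \<beta> = (\<Sum>k\<in>UNIV. \<Sum>l\<in>UNIV. cmscale (cnj (\<alpha> $ k) * \<beta> $ l) (blk2 T k l))"

lemma kron_mult: "kron A B ** kron C D = kron (A ** C) (B ** D)"
  by (simp add: vec_eq_iff kron_def matrix_matrix_mult_def sum_UNIV_Times sum_product mult_ac)

lemma kron_tens: "kron A B *v tens x y = tens (A *v x) (B *v y)"
  by (simp add: vec_eq_iff kron_def matrix_vector_mult_def sum_UNIV_Times sum_product mult_ac)

lemma kron_one: "kron (mat 1) (mat 1) = mat 1"
  by (auto simp add: vec_eq_iff kron_def mat_def)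

lemma cadj_kron: "cadj (kron A B) = kron (cadj A) (cadj B)"
  by (simp add: vec_eq_iff kron_def cadj_def)

lemma kron_add: "kron (A + B) C = kron A C + kron B C" "kron C (A + B) = kron C A + kron C B"
  by (simp_all add: vec_eq_iff kron_def algebra_simps)

lemma kron_zero [simp]: "kron 0 A = 0" "kron A 0 = 0"
  by (simp_all add: vec_eq_iff kron_def)

lemma kron_sum: "kron (\<Sum>i\<in>I. M i) C = (\<Sum>i\<in>I. kron (M i) C)" "kron C (\<Sum>i\<in>I. M i) = (\<Sum>i\<in>I. kron C (M i))"
  by (induction I rule: infinite_finite_induct, simp_all add: kron_add)+

lemma kron_cmscale: "kron (cmscale c A) B = cmscale c (kron A B)" "kron A (cmscale c B) = cmscale c (kron A B)"
  by (simp_all add: vec_eq_iff kron_def cmscale_def)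

lemma blk_ext1: "(\<And>i j. blk1 S i j = blk1 T i j) \<Longrightarrow> S = T"
  by (simp add: vec_eq_iff blk1_def)

lemma blk_ext2: "(\<And>i j. blk2 S i j = blk2 T i j) \<Longrightarrow> S = T"
  by (simp add: vec_eq_iff blk2_def)

lemma blk_mult:
  "blk1 (S ** T) i j = (\<Sum>m\<in>UNIV. blk1 S i m ** blk1 T m j)"
  "blk2 (S ** T) k l = (\<Sum>m\<in>UNIV. blk2 S k m ** blk2 T m l)"
proof -
  show "blk1 (S ** T) i j = (\<Sum>m\<in>UNIV. blk1 S i m ** blk1 T m j)"
    by (simp add: vec_eq_iff blk1_def matrix_matrix_mult_def sum_UNIV_Times)
  show "blk2 (S ** T) k l = (\<Sum>m\<in>UNIV. blk2 S k m ** blk2 T m l)"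
    apply (simp add: vec_eq_iff blk2_def matrix_matrix_mult_def sum_UNIV_Times)
    apply (intro allI, rule sum.swap)
    done
qed

lemma blk_cadj: "blk1 (cadj T) i j = cadj (blk1 T j i)" "blk2 (cadj T) i j = cadj (blk2 T j i)"
  by (simp_all add: vec_eq_iff blk1_def blk2_def cadj_def)

lemma blk_kron: "blk1 (kron A B) i j = cmscale (A $ i $ j) B" "blk2 (kron A B) k l = cmscale (B $ k $ l) A"
  by (simp_all add: vec_eq_iff blk1_def blk2_def kron_def cmscale_def mult_ac)

lemma blk_sum: "blk1 (\<Sum>x\<in>I. M x) i j = (\<Sum>x\<in>I. blk1 (M x) i j)" "blk2 (\<Sum>x\<in>I. M x) i j = (\<Sum>x\<in>I. blk2 (M x) i j)"
  by (induction I rule: infinite_finite_induct, simp_all add: vec_eq_iff blk1_def blk2_def)+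

lemma sum_cmscale_mat: "(\<Sum>m\<in>UNIV. cmscale ((mat 1 :: complex^'n::finite^'n) $ i $ m) (M m)) = M i"
  "(\<Sum>m\<in>UNIV. cmscale ((mat 1 :: complex^'n::finite^'n) $ m $ i) (M m)) = M i"
  for M :: "'n::finite \<Rightarrow> complex^'k::finite^'l::finite"
proof -
  have "cmscale (mat 1 $ i $ m) (M m) = (if i = m then M m else 0)"
    "cmscale (mat 1 $ m $ i) (M m) = (if i = m then M m else 0)" for m
    by (auto simp: mat_def cmscale_def vec_eq_iff)
  then show "(\<Sum>m\<in>UNIV. cmscale ((mat 1 :: complex^'n::finite^'n) $ i $ m) (M m)) = M i"
    "(\<Sum>m\<in>UNIV. cmscale ((mat 1 :: complex^'n::finite^'n) $ m $ i) (M m)) = M i"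
    by simp_all
qed

lemma blk_mult_kron1:
  "blk2 (T ** kron c (mat 1)) k l = blk2 T k l ** c" "blk2 (kron c (mat 1) ** T) k l = c ** blk2 T k l"
  "blk1 (T ** kron (mat 1) c) k l = blk1 T k l ** c" "blk1 (kron (mat 1) c ** T) k l = c ** blk1 T k l"
  by (simp_all add: blk_mult blk_kron cmscale_mult_left cmscale_mult_right sum_cmscale_mat)

text \<open>Commuting with c on one leg is a condition on the coefficients of that same leg.
  Together with \<open>kron_commute2\<close> this passes between commuting algebras and commuting
  operators on two legs.\<close>

lemma kron_commute1:
  "T ** kron c (mat 1) = kron c (mat 1) ** T \<longleftrightarrow> (\<forall>k l. blk2 T k l ** c = c ** blk2 T k l)"
  by (metis blk_mult_kron1(1,2) blk_ext2)

lemma kron_commute2: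
  "T ** kron (mat 1) c = kron (mat 1) c ** T \<longleftrightarrow> (\<forall>k l. blk1 T k l ** c = c ** blk1 T k l)"
  by (metis blk_mult_kron1(3,4) blk_ext1)

lemma blk1_mv: "(T *v tens (ax j) \<eta>) $ (i, k) = (blk1 T i j *v \<eta>) $ k"
  by (simp add: matrix_vector_mult_def blk1_def sum_UNIV_Times ax_nth if_distrib if_distribR sum.If_cases cong: if_cong)

lemma blk2_mv: "(T *v tens \<eta> (ax l)) $ (i, k) = (blk2 T k l *v \<eta>) $ i"
  by (simp add: matrix_vector_mult_def blk2_def sum_UNIV_Times ax_nth if_distrib if_distribR sum.If_cases cong: if_cong)

lemma cinner_blk1: "cinner a (blk1 T i j *v b) = cinner (tens (ax i) a) (T *v tens (ax j) b)"
proof -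
  have "cinner (tens (ax i) a) (T *v tens (ax j) b) = (\<Sum>m\<in>UNIV. \<Sum>k\<in>UNIV. cnj (ax i $ m) * (cnj (a $ k) * (blk1 T m j *v b) $ k))"
    by (simp add: cinner_def sum_UNIV_Times blk1_mv mult.assoc del: cinner_ax)
  also have "\<dots> = (\<Sum>m\<in>UNIV. cnj (ax i $ m) * cinner a (blk1 T m j *v b))"
    by (simp add: cinner_def sum_distrib_left)
  also have "\<dots> = cinner a (blk1 T i j *v b)"
    by (simp add: ax_nth if_distrib if_distribR cong: if_cong)
  finally show ?thesis by simp
qed

lemma cinner_blk2: "cinner a (blk2 T i j *v b) = cinner (tens a (ax i)) (T *v tens b (ax j))"
proof -
  have "cinner (tens a (ax i)) (T *v tens b (ax j)) = (\<Sum>k\<in>UNIV. \<Sum>m\<in>UNIV. cnj (ax i $ m) * (cnj (a $ k) * (blk2 T m j *v b) $ k))"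
    by (simp add: cinner_def sum_UNIV_Times blk2_mv mult_ac del: cinner_ax)
  also have "\<dots> = (\<Sum>m\<in>UNIV. \<Sum>k\<in>UNIV. cnj (ax i $ m) * (cnj (a $ k) * (blk2 T m j *v b) $ k))"
    by (rule sum.swap)
  also have "\<dots> = (\<Sum>m\<in>UNIV. cnj (ax i $ m) * cinner a (blk2 T m j *v b))"
    by (simp add: cinner_def sum_distrib_left)
  also have "\<dots> = cinner a (blk2 T i j *v b)"
    by (simp add: ax_nth if_distrib if_distribR cong: if_cong)
  finally show ?thesis by simp
qed

lemma cinner_Lsl: "cinner a (Lsl T \<zeta> \<eta> *v b) = cinner (tens \<zeta> a) (T *v tens \<eta> b)"
proof -
  have "cinner (tens \<zeta> a) (T *v tens \<eta> b) =
     cinner (tens (\<Sum>i\<in>UNIV. \<zeta> $ i *s ax i) a) (T *v tens (\<Sum>j\<in>UNIV. \<eta> $ j *s ax j) b)"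
    using vec_expand[of \<zeta>] vec_expand[of \<eta>] by simp
  also have "\<dots> = (\<Sum>i\<in>UNIV. \<Sum>j\<in>UNIV. cnj (\<zeta> $ i) * (\<eta> $ j * cinner a (blk1 T i j *v b)))"
    by (simp add: tens_sum tens_scale cinner_sum_left cinner_sum_right mv_sum mv_scale
        cinner_scale_left cinner_scale_right cinner_blk1 sum_distrib_left)
      (subst sum.swap, simp add: mult_ac)
  also have "\<dots> = cinner a (Lsl T \<zeta> \<eta> *v b)"
    by (simp add: Lsl_def sum_mv cinner_sum_right cmscale_mv cinner_scale_right mult.assoc)
  finally show ?thesis by simp
qed

lemma cinner_Rsl: "cinner a (Rsl T \<zeta> \<eta> *v b) = cinner (tens a \<zeta>) (T *v tens b \<eta>)"
proof -
  have "cinner (tens a \<zeta>) (T *v tens b \<eta>) =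
     cinner (tens a (\<Sum>i\<in>UNIV. \<zeta> $ i *s ax i)) (T *v tens b (\<Sum>j\<in>UNIV. \<eta> $ j *s ax j))"
    using vec_expand[of \<zeta>] vec_expand[of \<eta>] by simp
  also have "\<dots> = (\<Sum>i\<in>UNIV. \<Sum>j\<in>UNIV. cnj (\<zeta> $ i) * (\<eta> $ j * cinner a (blk2 T i j *v b)))"
    by (simp add: tens_sum tens_scale cinner_sum_left cinner_sum_right mv_sum mv_scale
        cinner_scale_left cinner_scale_right cinner_blk2 sum_distrib_left)
      (subst sum.swap, simp add: mult_ac)
  also have "\<dots> = cinner a (Rsl T \<zeta> \<eta> *v b)"
    by (simp add: Rsl_def sum_mv cinner_sum_right cmscale_mv cinner_scale_right mult.assoc)
  finally show ?thesis by simp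
qed

text \<open>Both sides are the coefficient \<langle>\<zeta> \<otimes> a, T(\<eta> \<otimes>
  b)\<rangle>; this is the pairing between the two slice algebras.\<close>

lemma Lsl_Rsl: "cinner a (Lsl T \<zeta> \<eta> *v b) = cinner \<zeta> (Rsl T a b *v \<eta>)"
  by (simp add: cinner_Lsl cinner_Rsl)

lemma Lsl_cadj: "Lsl (cadj T) \<zeta> \<eta> = cadj (Lsl T \<eta> \<zeta>)"
  by (rule mat_ext_cinner)
     (metis cinner_Lsl cinner_adj cinner_adj' cinner_commute)

lemma Rsl_cadj: "Rsl (cadj T) \<zeta> \<eta> = cadj (Rsl T \<eta> \<zeta>)"
  by (rule mat_ext_cinner)
     (metis cinner_Rsl cinner_adj cinner_adj' cinner_commute)

lemma Lsl_ax [simp]: "Lsl T (ax i) (ax j) = blk1 T i j"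
  by (rule mat_ext_cinner) (simp add: cinner_Lsl cinner_blk1)

lemma Rsl_ax [simp]: "Rsl T (ax i) (ax j) = blk2 T i j"
  by (rule mat_ext_cinner) (simp add: cinner_Rsl cinner_blk2)

lemma Lsl_sum: "Lsl T \<zeta> (\<Sum>i\<in>I. h i) = (\<Sum>i\<in>I. Lsl T \<zeta> (h i))" "Lsl T (\<Sum>i\<in>I. h i) \<zeta> = (\<Sum>i\<in>I. Lsl T (h i) \<zeta>)"
  by (rule mat_ext_cinner, simp add: cinner_Lsl sum_mv tens_sum mv_sum cinner_sum_left cinner_sum_right)+

lemma Lsl_add: "Lsl T \<zeta> (x + y) = Lsl T \<zeta> x + Lsl T \<zeta> y" "Lsl T (x + y) \<zeta> = Lsl T x \<zeta> + Lsl T y \<zeta>"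
  by (rule mat_ext_cinner, simp add: cinner_Lsl tens_add cinner_add_left cinner_add_right
     matrix_vector_mult_add_rdistrib matrix_vector_right_distrib)+

lemma Lsl_scale: "Lsl T \<zeta> (c *s x) = cmscale c (Lsl T \<zeta> x)" "Lsl T (c *s x) \<zeta> = cmscale (cnj c) (Lsl T x \<zeta>)"
  by (rule mat_ext_cinner, simp add: cinner_Lsl tens_scale cinner_scale_left cinner_scale_right mv_scale cmscale_mv)+

lemma Rsl_scale: "Rsl T \<zeta> (c *s x) = cmscale c (Rsl T \<zeta> x)" "Rsl T (c *s x) \<zeta> = cmscale (cnj c) (Rsl T x \<zeta>)"
  by (rule mat_ext_cinner, simp add: cinner_Rsl tens_scale cinner_scale_left cinner_scale_right mv_scale cmscale_mv)+



lemma sum_if_const: "(\<Sum>x\<in>I. if P then h x else 0) = (if P then sum h I else 0)"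
  by simp

lemma leg_mult_entry:
  "(leg12 V ** M) $ (i, a, b) $ q = (\<Sum>m\<in>UNIV. \<Sum>n\<in>UNIV. V $ (i, a) $ (m, n) * M $ (m, n, b) $ q)"
  "(N ** leg23 V) $ p $ (j, c, d) = (\<Sum>m\<in>UNIV. \<Sum>n\<in>UNIV. N $ p $ (j, m, n) * V $ (m, n) $ (c, d))"
  "(N ** leg12 V) $ p $ (j, c, d) = (\<Sum>m\<in>UNIV. \<Sum>n\<in>UNIV. N $ p $ (m, n, d) * V $ (m, n) $ (j, c))"
  by (simp_all add: leg12_def leg23_def matrix_matrix_mult_def sum_UNIV_Times
     if_distrib[of "\<lambda>x. x * y" for y] if_distrib[of "\<lambda>x. y * x" for y] sum_if_const cong: if_cong)

lemma leg12_leg13_entry: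
  "(leg12 V ** leg13 V) $ (i, a, b) $ (j, m, n) = (\<Sum>k\<in>UNIV. V $ (i, a) $ (k, m) * V $ (k, b) $ (j, n))"
  by (simp add: leg_mult_entry leg13_def
     if_distrib[of "\<lambda>x. x * y" for y] if_distrib[of "\<lambda>x. y * x" for y] cong: if_cong)

lemma leg23_leg12_entry:
  "(leg23 V ** leg12 V) $ (i, a, b) $ (j, c, d) = (\<Sum>m\<in>UNIV. V $ (a, b) $ (m, d) * V $ (i, m) $ (j, c))"
  by (simp add: leg_mult_entry leg23_def sum_if_const
     if_distrib[of "\<lambda>x. x * y" for y] if_distrib[of "\<lambda>x. y * x" for y] cong: if_cong)

lemma pentagon_entry:
  assumes "leg12 V ** leg13 V ** leg23 V = leg23 V ** leg12 V"
  shows "(\<Sum>m\<in>UNIV. \<Sum>n\<in>UNIV. (\<Sum>k\<in>UNIV. V $ (i, a) $ (k, m) * V $ (k, b) $ (j, n)) * V $ (m, n) $ (c, d)) =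
     (\<Sum>m\<in>UNIV. V $ (a, b) $ (m, d) * V $ (i, m) $ (j, c))"
  using assms by (simp flip: leg23_leg12_entry leg12_leg13_entry leg_mult_entry(2))

text \<open>The (i,j) coefficient of the pentagon equation in the first leg: conjugation of x
  \<otimes> 1 by V acts on the left slices as the coproduct of a matrix corepresentation. In
  \<open>pentagon_right\<close> the coefficient is taken in the third leg instead.\<close>

lemma pentagon_left:
  assumes "leg12 V ** leg13 V ** leg23 V = leg23 V ** leg12 V"
  shows "V ** kron (blk1 V i j) (mat 1) = (\<Sum>k\<in>UNIV. kron (blk1 V i k) (blk1 V k j)) ** V"
proof -
  have "(V ** kron (blk1 V i j) (mat 1)) $ (a, b) $ (c, d) = ((\<Sum>k\<in>UNIV. kron (blk1 V i k) (blk1 V k j)) ** V) $ (a, b) $ (c, d)" for a b c d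
  proof -
    have "(V ** kron (blk1 V i j) (mat 1)) $ (a, b) $ (c, d) = (\<Sum>m\<in>UNIV. V $ (a, b) $ (m, d) * V $ (i, m) $ (j, c))"
      by (simp add: matrix_matrix_mult_def kron_def blk1_def mat_def sum_UNIV_Times
        if_distrib[of "\<lambda>x. y * x" for y] cong: if_cong)
    moreover have "((\<Sum>k\<in>UNIV. kron (blk1 V i k) (blk1 V k j)) ** V) $ (a, b) $ (c, d) =
        (\<Sum>m\<in>UNIV. \<Sum>n\<in>UNIV. (\<Sum>k\<in>UNIV. V $ (i, a) $ (k, m) * V $ (k, b) $ (j, n)) * V $ (m, n) $ (c, d))"
      by (simp add: matrix_matrix_mult_def kron_def blk1_def sum_UNIV_Times)
    ultimately show ?thesis using pentagon_entry[OF assms] by simp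
  qed
  then show ?thesis by (auto simp: vec_eq_iff)
qed

lemma pentagon_right:
  assumes "leg12 V ** leg13 V ** leg23 V = leg23 V ** leg12 V"
  shows "kron (mat 1) (blk2 V k l) ** V = V ** (\<Sum>m\<in>UNIV. kron (blk2 V k m) (blk2 V m l))"
proof -
  have "(kron (mat 1) (blk2 V k l) ** V) $ (a, b) $ (c, d) = (V ** (\<Sum>m\<in>UNIV. kron (blk2 V k m) (blk2 V m l))) $ (a, b) $ (c, d)" for a b c d
  proof -
    have "(kron (mat 1) (blk2 V k l) ** V) $ (a, b) $ (c, d) = (\<Sum>m\<in>UNIV. V $ (b, k) $ (m, l) * V $ (a, m) $ (c, d))"
      by (simp add: matrix_matrix_mult_def kron_def blk2_def mat_def sum_UNIV_Times sum_if_const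
        if_distrib[of "\<lambda>x. x * y" for y] if_distrib[of "\<lambda>x. y * x" for y] cong: if_cong)
    moreover have "(V ** (\<Sum>m\<in>UNIV. kron (blk2 V k m) (blk2 V m l))) $ (a, b) $ (c, d) =
        (\<Sum>m\<in>UNIV. \<Sum>n\<in>UNIV. \<Sum>r\<in>UNIV. V $ (a, b) $ (m, n) * (V $ (m, k) $ (c, r) * V $ (n, r) $ (d, l)))"
      by (simp add: matrix_matrix_mult_def kron_def blk2_def sum_UNIV_Times sum_distrib_left)
    moreover have "(\<Sum>m\<in>UNIV. \<Sum>n\<in>UNIV. \<Sum>r\<in>UNIV. V $ (a, b) $ (m, n) * (V $ (m, k) $ (c, r) * V $ (n, r) $ (d, l))) =
       (\<Sum>n\<in>UNIV. \<Sum>r\<in>UNIV. (\<Sum>m\<in>UNIV. V $ (a, b) $ (m, n) * V $ (m, k) $ (c, r)) * V $ (n, r) $ (d, l))"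
      by (subst sum.swap, rule sum.cong[OF refl], subst sum.swap) (simp add: sum_distrib_right mult.assoc)
    ultimately show ?thesis using pentagon_entry[OF assms, of a b k c d l] by simp
  qed
  then show ?thesis by (auto simp: vec_eq_iff)
qed

subsection \<open>Linear subspaces of operators\<close>

definition csub :: "(complex^'n::finite^'m::finite) set \<Rightarrow> bool" where
  "csub T \<longleftrightarrow> 0 \<in> T \<and> (\<forall>a\<in>T. \<forall>b\<in>T. a + b \<in> T) \<and> (\<forall>c. \<forall>a\<in>T. cmscale c a \<in> T)"

lemma csub_sum: "csub T \<Longrightarrow> (\<And>i. i \<in> I \<Longrightarrow> h i \<in> T) \<Longrightarrow> (\<Sum>i\<in>I. h i) \<in> T"
  by (induction I rule: infinite_finite_induct) (simp_all add: csub_def)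

lemma csub_add: "csub T \<Longrightarrow> a \<in> T \<Longrightarrow> b \<in> T \<Longrightarrow> a + b \<in> T"
  and csub_scale: "csub T \<Longrightarrow> a \<in> T \<Longrightarrow> cmscale c a \<in> T"
  by (simp_all add: csub_def)

lemma csub_diff: "csub T \<Longrightarrow> a \<in> T \<Longrightarrow> b \<in> T \<Longrightarrow> a - b \<in> T"
  by (metis (no_types) add_uminus_conv_diff csub_add csub_scale cmscale_def vec_lambda_unique
      mult_minus1 vector_uminus_component)

subsection \<open>The dual multiplicative unitary\<close>

text \<open>Entrywise form of \<open>\<Sigma>V\<^sup>*\<Sigma>\<close> with the flip \<open>\<Sigma>\<close>. Passing to it exchanges \<open>e\<close> with \<open>e'\<close>, \<open>H\<^sub>f\<close> with
  \<open>H\<^sup>f\<close>, and the two slice algebras.\<close>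
definition dualV :: "complex^('n::finite \<times> 'n)^('n \<times> 'n) \<Rightarrow> complex^('n \<times> 'n)^('n \<times> 'n)" where
  "dualV V = (\<chi> p q. cnj (V $ (snd q, fst q) $ (snd p, fst p)))"

definition swapv :: "complex^('n::finite \<times> 'n) \<Rightarrow> complex^('n \<times> 'n)" where
  "swapv t = (\<chi> p. t $ (snd p, fst p))"

lemma swapv_tens: "swapv (tens x y) = tens y x"
  by (simp add: vec_eq_iff swapv_def)

lemma swapv_swapv [simp]: "swapv (swapv t) = t"
  by (simp add: vec_eq_iff swapv_def)

lemma swapv_eq_iff: "swapv t = swapv u \<longleftrightarrow> t = u"
  by (metis swapv_swapv)

lemma sum_UNIV_swap: "(\<Sum>p\<in>UNIV. h (snd p, fst p)) = (\<Sum>p\<in>UNIV. h p)" for h :: "'a::finite \<times> 'b::finite \<Rightarrow> 'c::comm_monoid_add"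
  by (simp add: sum_UNIV_Times, rule sum.swap)

lemma dualV_mv: "dualV V *v t = swapv (cadj V *v swapv t)"
proof -
  have "(dualV V *v t) $ (i, k) = swapv (cadj V *v swapv t) $ (i, k)" for i k
    using sum_UNIV_swap[of "\<lambda>p. cnj (V $ p $ (k, i)) * t $ (snd p, fst p)"]
    by (simp add: dualV_def swapv_def cadj_def matrix_vector_mult_def)
  then show ?thesis by (simp add: vec_eq_iff)
qed

lemma dualV_tens: "dualV V *v tens x y = swapv (cadj V *v tens y x)"
  by (simp add: dualV_mv swapv_tens)

lemma cadj_dualV: "cadj (dualV V) = dualV (cadj V)"
  by (simp add: vec_eq_iff cadj_def dualV_def)

lemma dualV_mult: "dualV A ** dualV B = dualV (B ** A)"
  by (rule mat_ext_mv) (simp add: dualV_mv cadj_mult flip: matrix_vector_mul_assoc)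

lemma dualV_one: "dualV (mat 1) = mat 1"
  by (auto simp add: vec_eq_iff dualV_def mat_def)

lemma dualV_dualV [simp]: "dualV (dualV V) = V"
  by (simp add: vec_eq_iff dualV_def)

lemma blk_dualV: "blk1 (dualV V) i j = cadj (blk2 V j i)" "blk2 (dualV V) i j = cadj (blk1 V j i)"
  by (simp_all add: vec_eq_iff blk1_def blk2_def dualV_def cadj_def)

lemma swapv_cinner: "cinner (swapv t) (swapv u) = cinner t u"
  using sum_UNIV_swap[of "\<lambda>p. cnj (t $ p) * u $ p"] by (simp add: cinner_def swapv_def)

lemma Lsl_dualV: "Lsl (dualV V) \<zeta> \<eta> = cadj (Rsl V \<eta> \<zeta>)"
proof (rule mat_ext_cinner)
  fix a b
  have "cinner a (Lsl (dualV V) \<zeta> \<eta> *v b) = cinner (swapv (tens a \<zeta>)) (swapv (cadj V *v tens b \<eta>))"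
    by (simp only: cinner_Lsl dualV_tens swapv_tens)
  then show "cinner a (Lsl (dualV V) \<zeta> \<eta> *v b) = cinner a (cadj (Rsl V \<eta> \<zeta>) *v b)"
    by (simp add: swapv_cinner flip: cinner_Rsl Rsl_cadj)
qed

lemma Rsl_dualV: "Rsl (dualV V) \<zeta> \<eta> = cadj (Lsl V \<eta> \<zeta>)"
  using Lsl_dualV[of "dualV V" \<eta> \<zeta>] by (metis cadj_cadj dualV_dualV)

definition rev3 :: "'n \<times> 'n \<times> 'n \<Rightarrow> 'n \<times> 'n \<times> 'n" where
  "rev3 p = (snd (snd p), fst (snd p), fst p)"

text \<open>The adjoint conjugated by reversal of the three legs. It reverses products and exchanges
  legs 12 and 23, so the pentagon equation of V becomes that of \<open>dualV V\<close>.\<close>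

definition flip3 :: "complex^('n::finite \<times> 'n \<times> 'n)^('n \<times> 'n \<times> 'n) \<Rightarrow> complex^('n \<times> 'n \<times> 'n)^('n \<times> 'n \<times> 'n)" where
  "flip3 A = (\<chi> p q. cnj (A $ rev3 q $ rev3 p))"

lemma flip3_mult: "flip3 (A ** B) = flip3 B ** flip3 A"
proof -
  have "bij (rev3 :: 'n \<times> 'n \<times> 'n \<Rightarrow> _)"
    by (rule o_bij[of rev3]) (auto simp: rev3_def fun_eq_iff)
  then have "(\<Sum>p\<in>UNIV. h (rev3 p)) = (\<Sum>p\<in>UNIV. h p)" for h :: "'n \<times> 'n \<times> 'n \<Rightarrow> complex"
    by (rule sum.reindex_bij_betw)
  from this[of "\<lambda>p. cnj (A $ _ $ p) * cnj (B $ p $ _)"] show ?thesis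
    by (simp add: vec_eq_iff flip3_def matrix_matrix_mult_def mult.commute)
qed

lemma leg_dualV: "leg12 (dualV V) = flip3 (leg23 V)" "leg13 (dualV V) = flip3 (leg13 V)" "leg23 (dualV V) = flip3 (leg12 V)"
  by (auto simp add: vec_eq_iff flip3_def leg12_def leg13_def leg23_def dualV_def rev3_def)

lemma mult_unitary_dualV: "mult_unitary V \<Longrightarrow> mult_unitary (dualV V)"
  unfolding mult_unitary_def unitary_op_def
  by (simp add: cadj_dualV dualV_mult dualV_one leg_dualV matrix_mul_assoc flip: flip3_mult)

section \<open>Products of slices and the projection onto cofixed vectors\<close>

locale munitary =
  fixes V :: "complex^('n::finite \<times> 'n)^('n \<times> 'n)"
  assumes mult_unitary: "mult_unitary V"
begin

lemma dual: "munitary (dualV V)"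
  using mult_unitary by unfold_locales (rule mult_unitary_dualV)

lemma pentagon: "leg12 V ** leg13 V ** leg23 V = leg23 V ** leg12 V"
  using mult_unitary by (simp add: mult_unitary_def)

lemma VV [simp]: "V ** cadj V = mat 1" "cadj V ** V = mat 1"
  using mult_unitary by (simp_all add: mult_unitary_def unitary_op_def)

lemma VV_mult [simp]: "V ** (cadj V ** A) = A" "cadj V ** (V ** A) = A"
  by (simp_all add: matrix_mul_assoc)

lemma VV_mv [simp]: "V *v (cadj V *v t) = t" "cadj V *v (V *v t) = t"
  by (simp_all add: matrix_vector_mul_assoc)

lemma V_fix_iff: "cadj V *v t = t \<longleftrightarrow> V *v t = t"
  by (metis VV_mv)

lemmas pentagon_left = pentagon_left[OF pentagon]
lemmas pentagon_right = pentagon_right[OF pentagon]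

lemma pentagon_right': "(\<Sum>m\<in>UNIV. kron (blk2 V k m) (blk2 V m l)) = cadj V ** kron (mat 1) (blk2 V k l) ** V"
  by (simp add: pentagon_right flip: matrix_mul_assoc)

text \<open>By \<open>pentagon_right'\<close> a product of slices is a slice of V between V(\<zeta>
  \<otimes> \<zeta>') and V(\<eta> \<otimes> \<eta>'), with the first leg of these vectors summed
  out. In particular V(f \<otimes> f) = f \<otimes> f makes the slice by a unit vector f
  idempotent.\<close>

lemma Lsl_mult:
  "Lsl V \<zeta> \<eta> ** Lsl V \<zeta>' \<eta>' =
    (\<Sum>i\<in>UNIV. Lsl V (\<chi> k. (V *v tens \<zeta> \<zeta>') $ (i, k)) (\<chi> k. (V *v tens \<eta> \<eta>') $ (i, k)))"
proof -
  have *: "cinner t (kron (mat 1) B *v s) = (\<Sum>i\<in>UNIV. cinner (\<chi> k. t $ (i, k)) (B *v (\<chi> k. s $ (i, k))))" for t s and B :: "complex^'n^'n"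
    by (simp add: cinner_def kron_def matrix_vector_mult_def sum_UNIV_Times mat_def sum_if_const
        if_distrib[of "\<lambda>x. x * y" for y] cong: if_cong)
  have "(Lsl V \<zeta> \<eta> ** Lsl V \<zeta>' \<eta>') $ k $ l =
     (\<Sum>i\<in>UNIV. Lsl V (\<chi> k. (V *v tens \<zeta> \<zeta>') $ (i, k)) (\<chi> k. (V *v tens \<eta> \<eta>') $ (i, k))) $ k $ l" for k l
  proof -
    have e: "A $ k $ l = cinner (ax k) (A *v ax l)" for A :: "complex^'n^'n" and k l
      by (simp add: matrix_vector_mult_def ax_nth if_distrib cong: if_cong)
    have "(Lsl V \<zeta> \<eta> ** Lsl V \<zeta>' \<eta>') $ k $ l = (\<Sum>m\<in>UNIV. Lsl V \<zeta> \<eta> $ k $ m * Lsl V \<zeta>' \<eta>' $ m $ l)"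
      by (simp add: matrix_matrix_mult_def)
    also have "\<dots> = (\<Sum>m\<in>UNIV. cinner \<zeta> (blk2 V k m *v \<eta>) * cinner \<zeta>' (blk2 V m l *v \<eta>'))"
      unfolding e by (simp only: Lsl_Rsl Rsl_ax)
    also have "\<dots> = cinner (tens \<zeta> \<zeta>') ((\<Sum>m\<in>UNIV. kron (blk2 V k m) (blk2 V m l)) *v tens \<eta> \<eta>')"
      by (simp add: sum_mv kron_tens cinner_tens cinner_sum_right)
    also have "\<dots> = cinner (V *v tens \<zeta> \<zeta>') (kron (mat 1) (blk2 V k l) *v (V *v tens \<eta> \<eta>'))"
      unfolding pentagon_right' by (simp only: cinner_adj matrix_vector_mul_assoc matrix_mul_assoc cadj_cadj cadj_mult)
    also have "\<dots> = (\<Sum>i\<in>UNIV. Lsl V (\<chi> k. (V *v tens \<zeta> \<zeta>') $ (i, k)) (\<chi> k. (V *v tens \<eta> \<eta>') $ (i, k))) $ k $ l"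
      unfolding * by (simp only: e[of "sum _ _"] sum_mv cinner_sum_right Lsl_Rsl Rsl_ax)
    finally show ?thesis .
  qed
  then show ?thesis by (simp add: vec_eq_iff)
qed

text \<open>The slice of V by the normalised trace. It is the projection onto the cofixed vectors,
  the analogue of averaging over a group.\<close>

definition q :: "complex^'n^'n" where
  "q = cmscale (1 / of_nat CARD('n)) (\<Sum>i\<in>UNIV. blk1 V i i)"

lemma q_idem: "q ** q = q"
proof -
  let ?t = "\<Sum>i\<in>UNIV. blk1 V i i"
  have tr: "?t $ k $ l = trace (blk2 V k l)" for k l
    by (simp add: blk1_def blk2_def trace_def)
  have trk: "trace (kron A B) = trace A * trace B" for A B :: "complex^'n^'n"
    by (simp add: trace_def kron_def sum_UNIV_Times sum_product)
  have trs: "trace (\<Sum>i\<in>I. M i) = (\<Sum>i\<in>I. trace (M i))" for I and M :: "'n \<Rightarrow> complex^('n\<times>'n)^('n\<times>'n)"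
    by (induction I rule: infinite_finite_induct) (simp_all add: trace_add trace_0[unfolded mat_0])
  have "?t ** ?t = cmscale (of_nat CARD('n)) ?t"
  proof -
    have "(?t ** ?t) $ k $ l = of_nat CARD('n) * ?t $ k $ l" for k l
    proof -
      have "(?t ** ?t) $ k $ l = (\<Sum>m\<in>UNIV. trace (blk2 V k m) * trace (blk2 V m l))"
        by (simp only: matrix_matrix_mult_def vec_lambda_beta tr)
      also have "\<dots> = trace (\<Sum>m\<in>UNIV. kron (blk2 V k m) (blk2 V m l))"
        by (simp add: trs trk)
      \<comment> \<open>Conjugation by V disappears under the trace.\<close>
      also have "\<dots> = trace (kron (mat 1) (blk2 V k l))"
        unfolding pentagon_right' by (subst trace_mul_sym) (simp add: matrix_mul_assoc)
      also have "\<dots> = of_nat CARD('n) * ?t $ k $ l"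
        by (simp only: trk tr) (simp add: trace_def mat_def)
      finally show ?thesis .
    qed
    then show ?thesis by (simp add: vec_eq_iff cmscale_def)
  qed
  then show ?thesis
    by (simp add: q_def cmscale_mult_left cmscale_mult_right cmscale_cmscale)
qed

lemma cofixed_q: "cofixedv V \<eta> \<Longrightarrow> q *v \<eta> = \<eta>"
proof -
  assume "cofixedv V \<eta>"
  then have "(blk1 V i i *v \<eta>) $ k = \<eta> $ k" for i k
    by (simp add: cofixedv_def flip: blk1_mv)
  then have "blk1 V i i *v \<eta> = \<eta>" for i by (simp add: vec_eq_iff)
  then show ?thesis
    by (simp add: q_def cmscale_mv sum_mv vec_eq_iff)
qed

text \<open>The hypothesis equates an average of n real parts with their common upper bound, so each
  of them attains it and each basis vector gives a fixed tensor.\<close>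

lemma q_cofixed:
  assumes "cinner \<eta> (q *v \<eta>) = cinner \<eta> \<eta>"
  shows "cofixedv V \<eta>"
proof -
  let ?a = "\<lambda>i. Re (cinner (tens (ax i) \<eta>) (V *v tens (ax i) \<eta>))"
  have n: "norm (tens (ax i) \<eta>) = norm \<eta>" for i by (simp add: norm_tens)
  have le: "?a i \<le> (norm \<eta>)\<^sup>2" for i
    using unitary_cinner_le[of V "tens (ax i) \<eta>"] by (simp add: n)
  have "cinner \<eta> (q *v \<eta>) = (\<Sum>i\<in>UNIV. cinner (tens (ax i) \<eta>) (V *v tens (ax i) \<eta>)) / of_nat CARD('n)"
    by (simp add: q_def cmscale_mv cinner_scale_right sum_mv cinner_sum_right cinner_blk1)
  then have "(\<Sum>i\<in>UNIV. cinner (tens (ax i) \<eta>) (V *v tens (ax i) \<eta>)) = of_nat CARD('n) * complex_of_real ((norm \<eta>)\<^sup>2)"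
    using assms by (simp add: cinner_self field_simps)
  from arg_cong[OF this, of Re] have "(\<Sum>i\<in>UNIV. ?a i) = (\<Sum>i\<in>(UNIV::'n set). (norm \<eta>)\<^sup>2)"
    by simp
  then have "(\<Sum>i\<in>UNIV. (norm \<eta>)\<^sup>2 - ?a i) = 0"
    by (simp add: sum_subtractf)
  then have "(norm \<eta>)\<^sup>2 - ?a i = 0" for i
    by (subst (asm) sum_nonneg_eq_0_iff) (auto simp: le)
  then have *: "V *v tens (ax i) \<eta> = tens (ax i) \<eta>" for i
    by (intro unitary_cinner_fix) (auto simp: n)
  show ?thesis unfolding cofixedv_def
  proof
    fix \<xi>
    have "V *v tens (\<Sum>i\<in>UNIV. \<xi> $ i *s ax i) \<eta> = tens (\<Sum>i\<in>UNIV. \<xi> $ i *s ax i) \<eta>"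
      by (simp add: tens_sum tens_scale mv_sum mv_scale *)
    then show "V *v tens \<xi> \<eta> = tens \<xi> \<eta>" using vec_expand[of \<xi>] by simp
  qed
qed

lemma q_selfadjoint: "cadj q = q"
  using q_idem q_cofixed cofixed_q by (intro idempotent_selfadjoint) auto

lemma fixed_dual: "fixedv (dualV V) \<eta> \<longleftrightarrow> cofixedv V \<eta>"
  unfolding fixedv_def cofixedv_def dualV_tens
  by (metis V_fix_iff swapv_tens swapv_swapv)

lemma cofixed_dual: "cofixedv (dualV V) \<eta> \<longleftrightarrow> fixedv V \<eta>"
  unfolding fixedv_def cofixedv_def dualV_tens
  by (metis V_fix_iff swapv_tens swapv_swapv)

text \<open>Both traces come from the full trace of V, up to a conjugation that self-adjointness of
  \<open>q\<close> removes. Hence the spaces of fixed and of cofixed vectors have equal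
  dimension.\<close>

lemma trace_q_dual: "trace (munitary.q (dualV V)) = trace q"
proof -
  have tr: "trace (cadj A) = cnj (trace A)" for A :: "complex^'n^'n"
    by (simp add: trace_def cadj_def)
  have "trace (munitary.q (dualV V)) = cnj (\<Sum>i\<in>UNIV. \<Sum>k\<in>UNIV. V $ (k, i) $ (k, i)) / of_nat CARD('n)"
    by (simp add: munitary.q_def[OF dual] trace_cmscale) (simp add: trace_def blk1_def dualV_def, rule sum.swap)
  also have "\<dots> = cnj (trace q)"
    by (simp add: q_def trace_cmscale) (simp add: trace_def blk1_def)
  also have "\<dots> = trace q" using q_selfadjoint tr by metis
  finally show ?thesis .
qed

end

definition bra :: "complex^'n::finite \<Rightarrow> complex^('n \<times> 'n) \<Rightarrow> complex^'n" where
  "bra y t = (\<chi> k. \<Sum>i\<in>UNIV. cnj (y $ i) * t $ (i, k))"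

lemma cinner_bra: "cinner a (bra y t) = cinner (tens y a) t"
  by (simp add: cinner_def bra_def sum_UNIV_Times sum_distrib_left mult_ac, rule sum.swap)

lemma bra_Lsl: "bra \<zeta> (V *v tens \<eta> b) = Lsl V \<zeta> \<eta> *v b"
  by (rule vec_ext_cinner) (simp add: cinner_bra cinner_Lsl)

lemma kron_ketbra1: "kron (ketbra x y) (mat 1) *v t = tens x (bra y t)"
proof (rule vec_ext_tens)
  fix a b
  have "cinner (tens a b) (kron (ketbra x y) (mat 1) *v t) = cinner (tens (cinner x a *s y) b) t"
    by (simp add: cinner_adj cadj_kron kron_tens cadj_ketbra ketbra_mv)
  then show "cinner (tens a b) (kron (ketbra x y) (mat 1) *v t) = cinner (tens a b) (tens x (bra y t))"
    by (simp add: tens_scale cinner_scale_left cinner_tens cinner_bra flip: cinner_commute)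
qed

lemma Lsl_ax_expand:
  "Lsl V \<zeta> (ax k) = (\<Sum>i\<in>UNIV. cmscale (cnj (\<zeta> $ i)) (blk1 V i k))"
  "Lsl V (ax k) \<eta> = (\<Sum>j\<in>UNIV. cmscale (\<eta> $ j) (blk1 V k j))"
proof -
  have "Lsl V (\<Sum>i\<in>UNIV. \<zeta> $ i *s ax i) (ax k) = (\<Sum>i\<in>UNIV. cmscale (cnj (\<zeta> $ i)) (blk1 V i k))"
    by (simp add: Lsl_sum Lsl_scale)
  then show "Lsl V \<zeta> (ax k) = (\<Sum>i\<in>UNIV. cmscale (cnj (\<zeta> $ i)) (blk1 V i k))"
    using vec_expand[of \<zeta>] by simp
  have "Lsl V (ax k) (\<Sum>i\<in>UNIV. \<eta> $ i *s ax i) = (\<Sum>i\<in>UNIV. cmscale (\<eta> $ i) (blk1 V k i))"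
    by (simp add: Lsl_sum Lsl_scale)
  then show "Lsl V (ax k) \<eta> = (\<Sum>j\<in>UNIV. cmscale (\<eta> $ j) (blk1 V k j))"
    using vec_expand[of \<eta>] by simp
qed

lemma trace_sum: "trace (\<Sum>i\<in>I. M i) = (\<Sum>i\<in>I. trace (M i))" for M :: "_ \<Rightarrow> complex^'n::finite^'n"
  by (induction I rule: infinite_finite_induct) (simp_all add: trace_add trace_0[unfolded mat_0])

section \<open>The coproduct and the two projections of a pre-subgroup\<close>

context munitary begin

definition delta :: "complex^'n^'n \<Rightarrow> complex^('n\<times>'n)^('n\<times>'n)" where
  "delta x = V ** kron x (mat 1) ** cadj V"

lemma pentagon_Lsl:
  "V ** kron (Lsl V \<zeta> \<eta>) (mat 1) = (\<Sum>k\<in>UNIV. kron (Lsl V \<zeta> (ax k)) (Lsl V (ax k) \<eta>)) ** V"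
proof -
  have "(\<Sum>k\<in>UNIV. kron (Lsl V \<zeta> (ax k)) (Lsl V (ax k) \<eta>)) =
    (\<Sum>k\<in>UNIV. \<Sum>i\<in>UNIV. \<Sum>j\<in>UNIV. cmscale (cnj (\<zeta> $ i) * \<eta> $ j) (kron (blk1 V i k) (blk1 V k j)))"
    by (simp add: Lsl_ax_expand kron_sum kron_cmscale cmscale_sum cmscale_cmscale mult.commute)
       (rule sum.cong[OF refl], rule sum.swap)
  also have "\<dots> = (\<Sum>i\<in>UNIV. \<Sum>j\<in>UNIV. \<Sum>k\<in>UNIV. cmscale (cnj (\<zeta> $ i) * \<eta> $ j) (kron (blk1 V i k) (blk1 V k j)))"
    by (subst sum.swap, rule sum.cong[OF refl], rule sum.swap)
  finally show ?thesis
    by (simp add: Lsl_def[of V \<zeta> \<eta>] kron_sum kron_cmscale matrix_mult_sum cmscale_mult_right pentagon_left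
      matrix_sum_mult cmscale_mult_left cmscale_sum)
qed

lemma delta_Lsl: "delta (Lsl V \<zeta> \<eta>) = (\<Sum>k\<in>UNIV. kron (Lsl V \<zeta> (ax k)) (Lsl V (ax k) \<eta>))"
  by (simp add: delta_def pentagon_Lsl flip: matrix_mul_assoc)

lemma V_delta: "V *v tens (x *v \<xi>) \<eta> = delta x *v (V *v tens \<xi> \<eta>)"
  by (simp add: delta_def kron_tens flip: matrix_vector_mul_assoc)

lemma delta_mult: "delta (x ** y) = delta x ** delta y"
  using kron_mult[of x "mat 1" y "mat 1"] by (simp add: delta_def flip: matrix_mul_assoc)
    (simp add: matrix_mul_assoc)

lemma delta_cadj: "delta (cadj x) = cadj (delta x)"
  by (simp add: delta_def cadj_mult cadj_kron matrix_mul_assoc)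

text \<open>The conditions on a pre-subgroup that make no reference to e and so pass unchanged to
  the dual unitary. The positivity of \<langle>f,e\<rangle> enters in
  \<open>complementary_pairI\<close>.\<close>

definition psub :: "complex^'n \<Rightarrow> bool" where
  "psub f \<longleftrightarrow> norm f = 1 \<and> V *v tens f f = tens f f"

lemma psub_cinner: "psub f \<Longrightarrow> cinner f f = 1"
  by (simp add: psub_def cinner_self)

lemma psub_dual: "munitary.psub (dualV V) f \<longleftrightarrow> psub f"
  by (simp add: psub_def munitary.psub_def[OF dual] dualV_tens) (metis V_fix_iff swapv_tens swapv_eq_iff)

text \<open>For a pre-subgroup f these slices are the projections onto H^f (\<open>p\<close>) and
  onto H_f (\<open>ph\<close>).\<close>

abbreviation "p f \<equiv> Lsl V f f"
abbreviation "ph f \<equiv> Rsl V f f"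

lemma p_fixI: "norm f = 1 \<Longrightarrow> V *v tens f \<eta> = tens f \<eta> \<Longrightarrow> p f *v \<eta> = \<eta>"
  by (rule vec_ext_cinner) (simp add: cinner_Lsl cinner_tens cinner_self)

lemma p_fixD: "norm f = 1 \<Longrightarrow> cinner \<eta> (p f *v \<eta>) = cinner \<eta> \<eta> \<Longrightarrow> V *v tens f \<eta> = tens f \<eta>"
  unfolding cinner_Lsl by (rule unitary_cinner_fix) (simp_all add: norm_tens cinner_self)

lemma p_fix_iff: "norm f = 1 \<Longrightarrow> p f *v \<eta> = \<eta> \<longleftrightarrow> V *v tens f \<eta> = tens f \<eta>"
  using p_fixI p_fixD by metis

lemma p_idem: assumes "psub f" shows "p f ** p f = p f"
proof -
  have r: "(\<chi> k. f $ i * f $ k) = f $ i *s f" for i by (simp add: vec_eq_iff)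
  have "p f ** p f = (\<Sum>i\<in>UNIV. cmscale (cnj (f $ i) * f $ i) (p f))"
    using assms unfolding Lsl_mult by (simp add: psub_def r Lsl_scale cmscale_cmscale mult.commute)
  also have "\<dots> = cmscale (cinner f f) (p f)"
    by (simp add: cinner_def vec_eq_iff cmscale_def sum_distrib_right)
  finally show ?thesis using psub_cinner[OF assms] by (simp add: cmscale_one)
qed

lemma p_idem_mv: "psub f \<Longrightarrow> p f *v (p f *v \<eta>) = p f *v \<eta>"
  by (simp add: matrix_vector_mul_assoc p_idem)

lemma p_selfadjoint: "psub f \<Longrightarrow> cadj (p f) = p f"
  using p_idem p_fixD p_fixI by (intro idempotent_selfadjoint) (auto simp: psub_def)

lemma ph_dual: assumes "psub f" shows "Lsl (dualV V) f f = ph f"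
proof -
  interpret d: munitary "dualV V" by (rule dual)
  have "cadj (d.p f) = d.p f" using assms psub_dual d.p_selfadjoint by blast
  then show ?thesis by (simp add: Lsl_dualV)
qed

lemma ph_idem: "psub f \<Longrightarrow> ph f ** ph f = ph f"
  using munitary.p_idem[OF dual, of f] by (simp add: ph_dual psub_dual)

lemma ph_idem_mv: "psub f \<Longrightarrow> ph f *v (ph f *v \<eta>) = ph f *v \<eta>"
  by (simp add: matrix_vector_mul_assoc ph_idem)

lemma ph_selfadjoint: "psub f \<Longrightarrow> cadj (ph f) = ph f"
  using munitary.p_selfadjoint[OF dual, of f] by (simp add: ph_dual psub_dual)

lemma dual_fix_iff: "dualV V *v tens x y = tens x y \<longleftrightarrow> V *v tens y x = tens y x"
  unfolding dualV_tens by (metis V_fix_iff swapv_tens swapv_eq_iff)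

lemma ph_fix_iff: "psub f \<Longrightarrow> ph f *v \<eta> = \<eta> \<longleftrightarrow> V *v tens \<eta> f = tens \<eta> f"
  using munitary.p_fix_iff[OF dual, of f \<eta>] by (simp add: ph_dual dual_fix_iff psub_def)

end

subsection \<open>Multiplicity one\<close>

locale munitary_one = munitary V for V :: "complex^('n::finite \<times> 'n)^('n \<times> 'n)" +
  fixes e e' :: "complex^'n"
  assumes norm_e: "norm e = 1" and norm_e': "norm e' = 1"
    and fixed_e: "fixedv V e" and cofixed_e': "cofixedv V e'"
    and ee': "cinner e e' = complex_of_real (1 / sqrt (real CARD('n)))"
    and fixed_line: "fixedv V \<eta> \<Longrightarrow> \<eta> = cinner e \<eta> *s e"
begin

text \<open>This is the square root of the dimension, expressed by the vectors because \<open>'n\<close> does not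
  occur in its type.\<close>
definition sN :: complex where "sN = inverse (cinner e e')"

lemma sN_eq: "sN = complex_of_real (sqrt (real CARD('n)))"
  by (simp add: sN_def ee' inverse_eq_divide)

lemma sN_nz [simp]: "sN \<noteq> 0"
  by (simp add: sN_eq)

lemma cnj_sN [simp]: "cnj sN = sN"
  by (simp add: sN_eq)

lemma ee'': "cinner e' e = 1 / sN" "cinner e e' = 1 / sN"
  using ee' cinner_commute[of e' e] by (simp_all add: sN_eq)

lemma e_e: "cinner e e = 1" "cinner e' e' = 1"
  by (simp_all add: cinner_self norm_e norm_e')

lemma V_e: "V *v tens e \<eta> = tens e \<eta>" "cadj V *v tens e \<eta> = tens e \<eta>"
  using fixed_e by (simp_all add: fixedv_def V_fix_iff)

lemma V_e': "V *v tens \<eta> e' = tens \<eta> e'" "cadj V *v tens \<eta> e' = tens \<eta> e'"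
  using cofixed_e' by (simp_all add: cofixedv_def V_fix_iff)

lemma Lsl_e: "Lsl V \<zeta> e = cmscale (cinner \<zeta> e) (mat 1)" "Lsl V e \<eta> = cmscale (cinner e \<eta>) (mat 1)"
  by (rule mat_ext_cinner, simp add: cinner_Lsl V_e cinner_tens cmscale_mv cinner_scale_right cinner_adj[of "tens e _"])+

lemma Lsl_mv_e': "Lsl V \<zeta> \<eta> *v e' = cinner \<zeta> \<eta> *s e'"
  by (rule vec_ext_cinner) (simp add: cinner_Lsl V_e' cinner_tens cinner_scale_right)

lemma Rsl_mv_e: "Rsl V \<zeta> \<eta> *v e = cinner \<zeta> \<eta> *s e"
  by (rule vec_ext_cinner) (simp add: cinner_Rsl V_e cinner_tens cinner_scale_right)

lemma psub_e: "psub e" "psub e'"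
  by (simp_all add: psub_def norm_e norm_e' V_e V_e')

lemma q_dual_eq: "munitary.q (dualV V) = ketbra e e"
proof -
  interpret d: munitary "dualV V" by (rule dual)
  have e: "d.q *v e = e" by (rule d.cofixed_q) (simp add: cofixed_dual fixed_e)
  show ?thesis
  proof (rule mat_ext_mv)
    fix \<xi>
    have "cofixedv (dualV V) (d.q *v \<xi>)"
      by (rule d.q_cofixed) (simp add: matrix_vector_mul_assoc d.q_idem)
    then have "d.q *v \<xi> = cinner e (d.q *v \<xi>) *s e" by (simp add: cofixed_dual fixed_line)
    then show "d.q *v \<xi> = ketbra e e *v \<xi>"
      by (simp add: ketbra_mv cinner_adj[of e] d.q_selfadjoint e)
  qed
qed

text \<open>\<open>q\<close> fixes e' and has trace one by comparison with the dual, so nothing is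
  left after removing the line of e'. This is how multiplicity one passes to the cofixed
  vectors.\<close>

lemma q_eq: "q = ketbra e' e'"
proof -
  have e: "q *v e' = e'" by (rule cofixed_q[OF cofixed_e'])
  have t: "trace q = 1" using trace_q_dual by (simp add: q_dual_eq trace_ketbra e_e)
  have "q - ketbra e' e' = 0"
  proof (rule projection_trace_0)
    show "(q - ketbra e' e') ** (q - ketbra e' e') = q - ketbra e' e'"
    proof (rule mat_ext_mv)
      fix x
      have "cinner e' (q *v x) = cinner e' x" by (simp add: cinner_adj[of e'] q_selfadjoint e)
      then show "((q - ketbra e' e') ** (q - ketbra e' e')) *v x = (q - ketbra e' e') *v x"
        using q_idem matrix_vector_mul_assoc[of q q x]
        by (simp add: matrix_vector_mult_diff_rdistrib matrix_vector_mult_diff_distrib ketbra_mv mv_scale e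
          cinner_diff_right cinner_scale_right e_e flip: matrix_vector_mul_assoc)
    qed
    show "cadj (q - ketbra e' e') = q - ketbra e' e'"
      by (simp add: cadj_diff q_selfadjoint cadj_ketbra)
    show "trace (q - ketbra e' e') = 0"
      by (simp add: trace_sub t trace_ketbra e_e)
  qed
  then show ?thesis by simp
qed

lemma dual_munitary_one: "munitary_one (dualV V) e' e"
proof (unfold_locales)
  show "mult_unitary (dualV V)" using dual by (rule munitary.mult_unitary)
  fix \<eta> assume "fixedv (dualV V) \<eta>"
  then have "q *v \<eta> = \<eta>" by (simp add: fixed_dual cofixed_q)
  then show "\<eta> = cinner e' \<eta> *s e'" by (simp add: q_eq ketbra_mv)
qed (simp_all add: norm_e norm_e' fixed_dual cofixed_dual fixed_e cofixed_e' ee'' sN_eq)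

text \<open>Testing on the single vector e suffices. Let w collect the coefficients of V(\<eta>
  \<otimes> \<theta>) along b. The coproduct formula applied to e \<otimes> \<theta> shows that V
  sends w \<otimes> e and \<langle>b,\<theta>\<rangle> \<eta> \<otimes> e to the same vector, and V
  can be cancelled.\<close>

lemma fixedI: assumes "V *v tens \<eta> e = tens \<eta> e" shows "fixedv V \<eta>"
  unfolding fixedv_def
proof
  fix \<theta>
  have L: "Lsl V \<zeta> \<eta> *v e = cinner \<zeta> \<eta> *s e" for \<zeta>
    by (rule vec_ext_cinner) (simp add: cinner_Lsl assms cinner_tens cinner_scale_right)
  have b: "Lsl V (ax k) \<eta> *v \<theta> = \<eta> $ k *s \<theta>" for k
  proof (rule vec_ext_cinner)
    fix b
    define w where "w = (\<chi> k. cinner b (Lsl V (ax k) \<eta> *v \<theta>))"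
    have "V *v tens w e = V *v tens (cinner b \<theta> *s \<eta>) e"
    proof (rule vec_ext_tens)
      fix \<zeta> a
      have "cinner (tens a b) (V *v tens (Lsl V \<zeta> \<eta> *v e) \<theta>) =
         cinner (tens a b) ((\<Sum>k\<in>UNIV. kron (Lsl V \<zeta> (ax k)) (Lsl V (ax k) \<eta>)) *v (V *v tens e \<theta>))"
        by (simp add: V_delta delta_Lsl)
      then have 1: "cinner \<zeta> \<eta> * (cinner a e * cinner b \<theta>) =
          (\<Sum>k\<in>UNIV. cinner a (Lsl V \<zeta> (ax k) *v e) * w $ k)"
        by (simp add: L tens_scale mv_scale V_e cinner_scale_right cinner_tens sum_mv kron_tens cinner_sum_right w_def)
      have "cinner (tens \<zeta> a) (V *v tens (\<Sum>k\<in>UNIV. w $ k *s ax k) e) = (\<Sum>k\<in>UNIV. cinner a (Lsl V \<zeta> (ax k) *v e) * w $ k)"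
        by (simp add: tens_sum tens_scale mv_sum mv_scale cinner_sum_right cinner_scale_right cinner_Lsl mult.commute)
      then have "cinner (tens \<zeta> a) (V *v tens w e) = cinner \<zeta> \<eta> * (cinner a e * cinner b \<theta>)"
        using 1 vec_expand[of w] by simp
      then show "cinner (tens \<zeta> a) (V *v tens w e) = cinner (tens \<zeta> a) (V *v tens (cinner b \<theta> *s \<eta>) e)"
        by (simp add: tens_scale mv_scale assms cinner_scale_right cinner_tens)
    qed
    then have "tens w e = tens (cinner b \<theta> *s \<eta>) e" by (metis VV_mv(2))
    then have "cinner (tens (ax k) e) (tens w e) = cinner (tens (ax k) e) (tens (cinner b \<theta> *s \<eta>) e)" by simp
    then show "cinner b (Lsl V (ax k) \<eta> *v \<theta>) = cinner b (\<eta> $ k *s \<theta>)"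
      by (simp add: cinner_tens e_e w_def cinner_scale_right mult.commute)
  qed
  show "V *v tens \<eta> \<theta> = tens \<eta> \<theta>"
  proof -
    have "(V *v tens \<eta> \<theta>) $ (i, k) = (Lsl V (ax i) \<eta> *v \<theta>) $ k" for i k
      using cinner_Lsl[of "ax k" V "ax i" \<eta> \<theta>] by (simp add: tens_ax)
    then show ?thesis by (simp add: vec_eq_iff b)
  qed
qed

lemma Ree: "Rsl V e e = ketbra e e"
proof (rule mat_ext_mv)
  fix \<xi>
  have "V *v tens (ph e *v \<xi>) e = tens (ph e *v \<xi>) e"
    by (metis ph_fix_iff ph_idem_mv psub_e(1))
  then have "ph e *v \<xi> = cinner e (ph e *v \<xi>) *s e" by (metis fixedI fixed_line)
  also have "cinner e (ph e *v \<xi>) = cinner e \<xi>"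
    by (simp add: cinner_adj[of e] ph_selfadjoint psub_e Rsl_mv_e e_e)
  finally show "ph e *v \<xi> = ketbra e e *v \<xi>" by (simp add: ketbra_mv)
qed

text \<open>The third-leg form of the pentagon equation, with one V moved across by unitarity, is
  evaluated between \<zeta> \<otimes> e' and \<eta> \<otimes> e. Invariance of e and e' collapses
  the sums, and the adjoint of any slice becomes a slice by e'. The factor is
  \<langle>e',e\<rangle>.\<close>

lemma Lsl_e'_adjoint: "cmscale (1 / sN) (cadj (Lsl V \<eta> \<zeta>)) = Lsl V e' (cadj (Lsl V \<eta> \<zeta>) *v e)"
proof -
  let ?B = "blk2 (cadj V)"
  have s: "(\<Sum>m\<in>UNIV. ?B k m ** blk2 V m pp) = cmscale ((mat 1 :: complex^'n^'n) $ k $ pp) (mat 1)" for k pp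
  proof -
    have "(\<Sum>m\<in>UNIV. ?B k m ** blk2 V m pp) = blk2 (kron (mat 1) (mat 1)) k pp"
      by (simp add: kron_one flip: blk_mult)
    then show ?thesis by (simp add: blk_kron)
  qed
  have 1: "kron (mat 1) (blk2 V k l) ** cadj V = (\<Sum>m\<in>UNIV. kron (?B k m) (mat 1) ** (cadj V ** kron (mat 1) (blk2 V m l)))" for k l
  proof -
    have 2: "cadj V ** kron (mat 1) (blk2 V m l) = (\<Sum>pp\<in>UNIV. kron (blk2 V m pp) (blk2 V pp l)) ** cadj V" for m
      unfolding pentagon_right' by (simp flip: matrix_mul_assoc)
    have "(\<Sum>m\<in>UNIV. kron (?B k m) (mat 1) ** (\<Sum>pp\<in>UNIV. kron (blk2 V m pp) (blk2 V pp l))) =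
       (\<Sum>m\<in>UNIV. \<Sum>pp\<in>UNIV. kron (?B k m ** blk2 V m pp) (blk2 V pp l))"
      by (simp add: matrix_mult_sum kron_mult)
    also have "\<dots> = (\<Sum>pp\<in>UNIV. kron (\<Sum>m\<in>UNIV. ?B k m ** blk2 V m pp) (blk2 V pp l))"
      by (subst sum.swap) (simp add: kron_sum)
    also have "\<dots> = kron (mat 1) (blk2 V k l)"
      unfolding s kron_cmscale by (rule sum_cmscale_mat)
    finally show ?thesis unfolding 2 by (simp add: matrix_mul_assoc flip: matrix_sum_mult)
  qed
  have "cinner (ax k) (cmscale (1 / sN) (cadj (Lsl V \<eta> \<zeta>)) *v ax l) = cinner (ax k) (Lsl V e' (cadj (Lsl V \<eta> \<zeta>) *v e) *v ax l)" for k l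
  proof -
    have "cinner (tens \<zeta> e') ((kron (mat 1) (blk2 V k l) ** cadj V) *v tens \<eta> e) = cinner e' (blk2 V k l *v (Lsl (cadj V) \<zeta> \<eta> *v e))"
    proof -
      have "cinner (tens \<zeta> e') ((kron (mat 1) (blk2 V k l) ** cadj V) *v tens \<eta> e) =
         cinner (kron (mat 1) (cadj (blk2 V k l)) *v tens \<zeta> e') (cadj V *v tens \<eta> e)"
        unfolding matrix_vector_mul_assoc[symmetric] by (subst cinner_adj) (simp add: cadj_kron)
      also have "\<dots> = cinner (cadj (blk2 V k l) *v e') (Lsl (cadj V) \<zeta> \<eta> *v e)"
        by (simp add: kron_tens cinner_Lsl)
      finally show ?thesis by (simp add: cinner_adj)
    qed
    moreover have "cinner (tens \<zeta> e') ((kron (mat 1) (blk2 V k l) ** cadj V) *v tens \<eta> e) = cinner \<zeta> (?B k l *v \<eta>) * (1 / sN)"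
    proof -
      have R: "blk2 V m l *v e = (if m = l then e else 0)" for m
        using Rsl_mv_e[of "ax m" "ax l"] by (simp add: ax_nth)
      have "cinner (tens \<zeta> e') ((kron (mat 1) (blk2 V k l) ** cadj V) *v tens \<eta> e) =
         (\<Sum>m\<in>UNIV. cinner (tens \<zeta> e') (kron (?B k m) (mat 1) *v (cadj V *v tens \<eta> (blk2 V m l *v e))))"
        unfolding 1 by (simp add: sum_mv cinner_sum_right kron_tens flip: matrix_vector_mul_assoc)
      also have "\<dots> = (\<Sum>m\<in>UNIV. if m = l then cinner (tens \<zeta> e') (kron (?B k l) (mat 1) *v (cadj V *v tens \<eta> e)) else 0)"
        by (rule sum.cong) (auto simp: R)
      also have "\<dots> = cinner (tens \<zeta> e') (kron (?B k l) (mat 1) *v (cadj V *v tens \<eta> e))" by simp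
      also have "\<dots> = cinner (V *v (kron (cadj (?B k l)) (mat 1) *v tens \<zeta> e')) (tens \<eta> e)"
        by (simp add: cinner_adj cadj_kron)
      also have "\<dots> = cinner \<zeta> (?B k l *v \<eta>) * (1 / sN)"
        by (simp add: kron_tens V_e' cinner_tens cinner_adj ee'')
      finally show ?thesis .
    qed
    ultimately have "cinner \<zeta> (Rsl (cadj V) (ax k) (ax l) *v \<eta>) * (1 / sN) = cinner e' (Rsl V (ax k) (ax l) *v (Lsl (cadj V) \<zeta> \<eta> *v e))"
      by simp
    then show ?thesis
      unfolding Lsl_Rsl[symmetric] Lsl_cadj by (simp add: cmscale_mv cinner_scale_right mult.commute del: cinner_ax)
  qed
  then have "cmscale (1 / sN) (cadj (Lsl V \<eta> \<zeta>)) $ k $ l = Lsl V e' (cadj (Lsl V \<eta> \<zeta>) *v e) $ k $ l" for k l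
    by (simp add: matrix_vector_mult_def ax_nth if_distrib cong: if_cong)
  then show ?thesis by (simp add: vec_eq_iff)
qed

text \<open>The coproduct of \<open>q\<close> between \<alpha> \<otimes> e and \<beta> \<otimes> e
  is computed twice: with \<open>q\<close> as the projection on e', and with \<open>q\<close> as an
  average of slices, where \<open>Ree\<close> contracts the sum to the slice by e, which is the
  identity.\<close>

lemma isometry_e'e:
  "cinner (cadj (Lsl V \<alpha> e') *v e) (cadj (Lsl V \<beta> e') *v e) = cinner \<alpha> \<beta> / of_nat CARD('n)"
proof -
  let ?t = "\<lambda>\<beta>. cadj V *v tens \<beta> e"
  have b: "bra e' (?t \<beta>) = cadj (Lsl V \<beta> e') *v e" for \<beta> by (simp add: bra_Lsl Lsl_cadj)
  have d: "delta q = cmscale (1 / of_nat CARD('n)) (\<Sum>i\<in>UNIV. \<Sum>k\<in>UNIV. kron (blk1 V i k) (blk1 V k i))"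
  proof -
    have "delta q = cmscale (1 / of_nat CARD('n)) (\<Sum>i\<in>UNIV. delta (Lsl V (ax i) (ax i)))"
      by (simp add: q_def delta_def kron_cmscale kron_sum matrix_mult_sum matrix_sum_mult cmscale_mult_left cmscale_mult_right)
    then show ?thesis by (simp add: delta_Lsl del: Lsl_ax) simp
  qed
  have k: "cinner e (blk1 V k i *v e) = e $ k * cnj (e $ i)" for k i
    using Lsl_Rsl[of e V "ax k" "ax i" e] by (simp add: Ree ketbra_mv)
  have "cinner (tens \<alpha> e) (delta q *v tens \<beta> e) = (\<Sum>i\<in>UNIV. \<Sum>k\<in>UNIV. cinner \<alpha> (blk1 V i k *v \<beta>) * (e $ k * cnj (e $ i))) / of_nat CARD('n)"
    unfolding d by (simp add: cmscale_mv cinner_scale_right sum_mv cinner_sum_right kron_tens cinner_tens k)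
  also have "\<dots> = cinner \<alpha> (Lsl V e e *v \<beta>) / of_nat CARD('n)"
    by (simp add: Lsl_def sum_mv cmscale_mv cinner_sum_right cinner_scale_right mult_ac)
  also have "\<dots> = cinner \<alpha> \<beta> / of_nat CARD('n)"
    by (simp add: Lsl_e e_e cmscale_one)
  finally have 1: "cinner (tens \<alpha> e) (delta q *v tens \<beta> e) = cinner \<alpha> \<beta> / of_nat CARD('n)" .
  have "cinner (tens \<alpha> e) (delta q *v tens \<beta> e) = cinner (?t \<alpha>) (kron q (mat 1) *v ?t \<beta>)"
    unfolding delta_def matrix_vector_mul_assoc[symmetric] by (subst cinner_adj) simp
  also have "\<dots> = cinner (?t \<alpha>) (tens e' (cadj (Lsl V \<beta> e') *v e))"
    by (simp add: q_eq kron_ketbra1 b)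
  also have "\<dots> = cnj (cinner (cadj (Lsl V \<beta> e') *v e) (bra e' (?t \<alpha>)))"
    by (simp only: cinner_bra flip: cinner_commute)
  also have "\<dots> = cinner (cadj (Lsl V \<alpha> e') *v e) (cadj (Lsl V \<beta> e') *v e)"
    by (simp add: b flip: cinner_commute)
  finally show ?thesis using 1 by simp
qed

text \<open>By \<open>isometry_e'e\<close> the vectors \<open>cadj (Lsl V \<xi> e') *v e\<close>
  depend on \<xi> through a multiple of an isometry, hence exhaust H in finite dimension. On such
  vectors the claim is \<open>Lsl_e'_adjoint\<close> applied to e.\<close>

lemma Lsl_e'_mv_e: "Lsl V e' \<eta> *v e = (1 / sN) *s \<eta>"
proof -
  let ?T = "\<lambda>\<eta>. cadj (Lsl V \<eta> e') *v e"
  define T :: "complex^'n^'n" where "T = (\<chi> k j. ?T (ax j) $ k)"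
  have T: "T *v \<eta> = ?T \<eta>" for \<eta>
  proof -
    have "?T (\<Sum>j\<in>UNIV. \<eta> $ j *s ax j) = (\<Sum>j\<in>UNIV. \<eta> $ j *s ?T (ax j))"
      by (simp add: Lsl_sum Lsl_scale cadj_sum cadj_cmscale sum_mv cmscale_mv)
    then have "?T \<eta> = (\<Sum>j\<in>UNIV. \<eta> $ j *s ?T (ax j))"
      using vec_expand[of \<eta>] by simp
    then show ?thesis
      by (simp add: vec_eq_iff T_def matrix_vector_mult_def mult.commute)
  qed
  have "cmscale (of_nat CARD('n)) (cadj T) ** T = mat 1"
  proof (rule mat_ext_cinner)
    fix a b
    have "cinner a (cadj T *v (T *v b)) = cinner a b / of_nat CARD('n)"
      by (subst cinner_adj) (simp add: T isometry_e'e)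
    then show "cinner a ((cmscale (of_nat CARD('n)) (cadj T) ** T) *v b) = cinner a (mat 1 *v b)"
      by (simp add: cmscale_mult_left cmscale_mv cinner_scale_right flip: matrix_vector_mul_assoc)
  qed
  then have "T ** cmscale (of_nat CARD('n)) (cadj T) = mat 1"
    by (simp add: matrix_left_right_inverse)
  then have "T *v (cmscale (of_nat CARD('n)) (cadj T) *v \<eta>) = \<eta>"
    by (simp add: matrix_vector_mul_assoc)
  then obtain \<xi> where \<xi>: "\<eta> = cadj (Lsl V \<xi> e') *v e" using T by metis
  show ?thesis
    unfolding \<xi> by (simp add: cmscale_mv flip: Lsl_e'_adjoint)
qed

end

lemma blk_cmscale: "blk1 (cmscale c T) i j = cmscale c (blk1 T i j)" "blk2 (cmscale c T) i j = cmscale c (blk2 T i j)"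
  by (simp_all add: vec_eq_iff blk1_def blk2_def cmscale_def)

section \<open>The slice algebra: counit, trace, coproduct and the subalgebras of a
  pre-subgroup\<close>

context munitary_one begin

text \<open>The inverse of x \<mapsto> x e on the left slices; it turns subspaces of H into spaces
  of operators.\<close>

definition lam :: "complex^'n \<Rightarrow> complex^'n^'n" where "lam v = cmscale sN (Lsl V e' v)"

definition S :: "(complex^'n^'n) set" where "S = range lam"

definition counit :: "complex^'n^'n \<Rightarrow> complex" where "counit x = cinner e' (x *v e')"

lemma sN_inv [simp]: "sN * (1 / sN) = 1" "(1 / sN) * sN = 1"
  by simp_all

lemma lam_mv_e [simp]: "lam v *v e = v"
  by (simp add: lam_def cmscale_mv Lsl_e'_mv_e vector_smult_assoc)

lemma lam_add: "lam (x + y) = lam x + lam y"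
  by (simp add: lam_def Lsl_add cmscale_add_right)

lemma lam_scale: "lam (c *s x) = cmscale c (lam x)"
  by (simp add: lam_def Lsl_scale cmscale_cmscale mult.commute)

lemma lam_0 [simp]: "lam 0 = 0"
  using lam_scale[of 0 0] by simp

lemma S_iff: "x \<in> S \<longleftrightarrow> x = lam (x *v e)"
  unfolding S_def by (metis lam_mv_e rangeI rangeE)

lemma S_eqI: "x \<in> S \<Longrightarrow> y \<in> S \<Longrightarrow> x *v e = y *v e \<Longrightarrow> x = y"
  by (metis S_iff)

lemma lam_S [simp]: "lam v \<in> S"
  by (simp add: S_def)

lemma csub_S: "csub S"
  unfolding csub_def S_def
  by (auto simp flip: lam_add lam_scale lam_0)

lemma S_cadj: "x \<in> S \<Longrightarrow> cadj x \<in> S"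
proof -
  have c: "cadj (Lsl V \<eta> \<zeta>) = lam (cadj (Lsl V \<eta> \<zeta>) *v e)" for \<eta> \<zeta>
    by (simp add: lam_def cmscale_cmscale cmscale_one flip: Lsl_e'_adjoint)
  assume "x \<in> S"
  then obtain v where "x = lam v" by (auto simp: S_def)
  then have "cadj x = cmscale sN (cadj (Lsl V e' v))" by (simp add: lam_def cadj_cmscale)
  also have "\<dots> \<in> S" by (subst c) (intro csub_scale csub_S lam_S)
  finally show ?thesis .
qed

lemma Lsl_S [simp]: "Lsl V \<zeta> \<eta> \<in> S"
proof -
  have "cadj (Lsl V \<zeta> \<eta>) = lam (cadj (Lsl V \<zeta> \<eta>) *v e)"
    by (simp add: lam_def cmscale_cmscale cmscale_one flip: Lsl_e'_adjoint)
  then have "cadj (Lsl V \<zeta> \<eta>) \<in> S" by (metis lam_S)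
  then show ?thesis using S_cadj by fastforce
qed

lemma blk1_S [simp]: "blk1 V i j \<in> S"
  using Lsl_S[of "ax i" "ax j"] by simp

lemma one_S [simp]: "mat 1 \<in> S"
  using Lsl_S[of e e] by (simp add: Lsl_e e_e cmscale_one)

lemma S_mult: "x \<in> S \<Longrightarrow> y \<in> S \<Longrightarrow> x ** y \<in> S"
proof -
  have "Lsl V \<zeta> \<eta> ** Lsl V \<zeta>' \<eta>' \<in> S" for \<zeta> \<eta> \<zeta>' \<eta>'
    unfolding Lsl_mult by (intro csub_sum csub_S) simp
  then show "x \<in> S \<Longrightarrow> y \<in> S \<Longrightarrow> x ** y \<in> S"
    by (auto simp: S_def[of ] lam_def cmscale_mult_left cmscale_mult_right intro!: csub_scale csub_S[unfolded S_def lam_def])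
qed

lemma S_mv_e': "x \<in> S \<Longrightarrow> x *v e' = counit x *s e'"
  by (auto simp: S_def lam_def counit_def cmscale_mv Lsl_mv_e' cinner_scale_right e_e)

lemma counit_lam: "counit (lam v) = sN * cinner e' v"
  by (simp add: counit_def lam_def cmscale_mv Lsl_mv_e' cinner_scale_right e_e)

lemma counit_cadj: "counit (cadj x) = cnj (counit x)"
  unfolding counit_def by (metis cinner_adj cinner_commute cadj_cadj)

text \<open>The diagonal \<open>blk2\<close> coefficients sum to n times the projection on e, which
  is the adjoint form of \<open>q_dual_eq\<close>. Consequently the vector state of e is tracial on
  \<open>S\<close>.\<close>

lemma trace_Lsl: "trace (Lsl V \<zeta> \<eta>) = of_nat CARD('n) * (cinner \<zeta> e * cinner e \<eta>)"
proof -
  have "cmscale (1 / of_nat CARD('n)) (\<Sum>i\<in>UNIV. cadj (blk2 V i i)) = ketbra e e"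
    using q_dual_eq by (simp add: munitary.q_def[OF dual] blk_dualV)
  then have "cmscale (of_nat CARD('n)) (cmscale (1 / of_nat CARD('n)) (\<Sum>i\<in>UNIV. cadj (blk2 V i i))) = cmscale (of_nat CARD('n)) (ketbra e e)"
    by simp
  then have "(\<Sum>i\<in>UNIV. cadj (blk2 V i i)) = cmscale (of_nat CARD('n)) (ketbra e e)"
    by (simp add: cmscale_cmscale cmscale_one)
  then have "cadj (\<Sum>i\<in>UNIV. cadj (blk2 V i i)) = cadj (cmscale (of_nat CARD('n)) (ketbra e e))"
    by simp
  then have b: "(\<Sum>i\<in>UNIV. blk2 V i i) = cmscale (of_nat CARD('n)) (ketbra e e)"
    by (simp add: cadj_sum cadj_cmscale cadj_ketbra)
  have "trace (Lsl V \<zeta> \<eta>) = cinner \<zeta> ((\<Sum>i\<in>UNIV. blk2 V i i) *v \<eta>)"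
    by (simp only: trace_eq_cinner Lsl_Rsl Rsl_ax sum_mv cinner_sum_right)
  then show ?thesis by (simp add: b cmscale_mv ketbra_mv cinner_scale_right mult_ac)
qed

lemma trace_S: "x \<in> S \<Longrightarrow> trace x = of_nat CARD('n) * cinner e (x *v e)"
proof -
  assume "x \<in> S"
  then obtain v where x: "x = lam v" by (auto simp: S_def)
  have "trace x = sN * (1 / sN) * (of_nat CARD('n) * cinner e v)"
    by (simp only: x lam_def trace_cmscale trace_Lsl ee'') simp
  then show ?thesis by (simp add: x)
qed

lemma trace_S_commute: "x \<in> S \<Longrightarrow> y \<in> S \<Longrightarrow> cinner e (x *v (y *v e)) = cinner e (y *v (x *v e))"
  using trace_S[of "x ** y"] trace_S[of "y ** x"] trace_mul_sym[of x y]
  by (simp add: S_mult matrix_vector_mul_assoc)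

lemma delta_lam: "delta (lam \<eta>) = cmscale sN (\<Sum>k\<in>UNIV. kron (Lsl V e' (ax k)) (Lsl V (ax k) \<eta>))"
  by (simp add: delta_Lsl[symmetric]) (simp add: delta_def lam_def kron_cmscale cmscale_mult_left cmscale_mult_right)

lemma delta_blk: "x \<in> S \<Longrightarrow> blk1 (delta x) i j \<in> S" "x \<in> S \<Longrightarrow> blk2 (delta x) i j \<in> S"
proof -
  have "blk1 (delta (lam v)) i j \<in> S" "blk2 (delta (lam v)) i j \<in> S" for v
    by (simp_all add: delta_lam blk_cmscale blk_sum blk_kron csub_sum csub_scale csub_S)
  then show "x \<in> S \<Longrightarrow> blk1 (delta x) i j \<in> S" "x \<in> S \<Longrightarrow> blk2 (delta x) i j \<in> S"
    by (auto simp: S_def)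
qed

lemma Lsl_e'_sum: "(\<Sum>k\<in>UNIV. \<eta> $ k *s (Lsl V \<zeta> (ax k) *v \<xi>)) = Lsl V \<zeta> \<eta> *v \<xi>"
proof -
  have "Lsl V \<zeta> (\<Sum>k\<in>UNIV. \<eta> $ k *s ax k) *v \<xi> = (\<Sum>k\<in>UNIV. \<eta> $ k *s (Lsl V \<zeta> (ax k) *v \<xi>))"
    by (simp add: Lsl_sum Lsl_scale sum_mv cmscale_mv)
  then show ?thesis using vec_expand[of \<eta>] by simp
qed

text \<open>The counit property of the first leg: e' is an eigenvector of each first factor, and the
  sum over k reassembles the slice.\<close>

lemma delta_e': "x \<in> S \<Longrightarrow> delta x *v tens e' \<theta> = tens e' (x *v \<theta>)"
proof -
  have "(\<Sum>k\<in>UNIV. cmscale (cnj (\<zeta> $ k)) (Lsl V (ax k) \<eta>)) = Lsl V \<zeta> \<eta>" for \<zeta> \<eta>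
  proof -
    have "Lsl V (\<Sum>k\<in>UNIV. \<zeta> $ k *s ax k) \<eta> = (\<Sum>k\<in>UNIV. cmscale (cnj (\<zeta> $ k)) (Lsl V (ax k) \<eta>))"
      by (simp add: Lsl_sum Lsl_scale)
    then show ?thesis using vec_expand[of \<zeta>] by simp
  qed
  then have "(\<Sum>k\<in>UNIV. cnj (\<zeta> $ k) *s (Lsl V (ax k) \<eta> *v \<theta>)) = Lsl V \<zeta> \<eta> *v \<theta>" for \<zeta> \<eta>
    by (simp flip: cmscale_mv sum_mv)
  then have "delta (Lsl V \<zeta> \<eta>) *v tens e' \<theta> = tens e' (Lsl V \<zeta> \<eta> *v \<theta>)" for \<zeta> \<eta>
    by (simp add: delta_Lsl sum_mv kron_tens Lsl_mv_e' tens_scale flip: tens_sum)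
       (simp add: tens_sum tens_scale flip: tens_scale(2) tens_sum(2))
  then have "delta (lam v) *v tens e' \<theta> = tens e' (lam v *v \<theta>)" for v
    by (simp add: lam_def delta_def kron_cmscale cmscale_mult_left cmscale_mult_right cmscale_mv tens_scale)
  then show "x \<in> S \<Longrightarrow> delta x *v tens e' \<theta> = tens e' (x *v \<theta>)"
    by (auto simp: S_def)
qed

lemma delta_mv_e': "delta x *v tens \<theta> e' = tens (x *v \<theta>) e'"
  by (simp add: delta_def V_e' kron_tens flip: matrix_vector_mul_assoc)

text \<open>Both sides have norm \<open>|\<langle>f,e\<rangle>|\<close>, by the formula for \<open>Rsl V e e\<close>, and equal inner products with \<open>f\<close>.\<close>
lemma p_e: assumes "psub f" shows "p f *v e = cinner f e *s f"
proof -
  let ?F = "p f *v e"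
  have ff: "cinner f f = 1" by (rule psub_cinner[OF assms])
  have pf: "p f *v f = f" using assms by (simp add: p_fixI psub_def)
  have 1: "cinner ?F ?F = cinner f e * cinner e f"
  proof -
    have "cinner ?F ?F = cinner e (p f *v e)"
      by (simp add: cinner_adj'[of "p f"] p_selfadjoint[OF assms] p_idem_mv[OF assms])
    also have "\<dots> = cinner f e * cinner e f"
      unfolding Lsl_Rsl by (simp add: Ree ketbra_mv cinner_scale_right)
    finally show ?thesis .
  qed
  have 2: "cinner f ?F = cinner f e"
    by (subst cinner_adj) (simp add: p_selfadjoint[OF assms] pf)
  have 3: "cinner ?F f = cinner e f" using 2 by (metis cinner_commute)
  have "cinner (?F - cinner f e *s f) (?F - cinner f e *s f) = 0"
    by (simp add: cinner_diff_left cinner_diff_right cinner_scale_left cinner_scale_right 1 2 3 ff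
       flip: cinner_commute)
  then show ?thesis by (simp add: cinner_self_eq_0)
qed

lemma p_e': "psub f \<Longrightarrow> p f *v e' = e'"
  by (simp add: Lsl_mv_e' psub_cinner)

lemma ph_e: "psub f \<Longrightarrow> ph f *v e = e"
  by (simp add: Rsl_mv_e psub_cinner)

lemma ph_e': assumes "psub f" shows "ph f *v e' = cinner f e' *s f"
  using munitary_one.p_e[OF dual_munitary_one, of f] assms by (simp add: ph_dual psub_dual)

text \<open>The projection \<open>p f\<close> fixes e' and sends e to a multiple of f. So the
  overlap of f with e determines its overlap with e'.\<close>

lemma psub_product: assumes "psub f" shows "cinner f e * cinner e' f = 1 / sN"
proof -
  have "cinner e' (p f *v e) = 1 / sN"
    by (subst cinner_adj) (simp add: p_selfadjoint[OF assms] p_e' assms ee'')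
  then show ?thesis by (simp add: p_e[OF assms] cinner_scale_right)
qed

lemma psub_nz: "psub f \<Longrightarrow> cinner f e \<noteq> 0" "psub f \<Longrightarrow> cinner e' f \<noteq> 0"
  using psub_product[of f] by auto

text \<open>For the dual unitary this is the algebra \<open>D\<^sub>f\<close> with a hat.\<close>
definition G :: "complex^'n \<Rightarrow> (complex^'n^'n) set" where
  "G f = {x \<in> S. ph f *v (x *v e) = x *v e}"

lemma G_S: "x \<in> G f \<Longrightarrow> x \<in> S"
  by (simp add: G_def)

lemma G_iff: "psub f \<Longrightarrow> x \<in> G f \<longleftrightarrow> x \<in> S \<and> V *v tens (x *v e) f = tens (x *v e) f"
  by (simp add: G_def ph_fix_iff)

lemma lam_G: "psub f \<Longrightarrow> lam (ph f *v \<eta>) \<in> G f"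
  by (simp add: G_def ph_idem_mv)

lemma csub_G: "csub (G f)"
  using csub_S by (auto simp: csub_def G_def matrix_vector_mult_add_rdistrib matrix_vector_right_distrib cmscale_mv mv_scale)

lemma Lsl_fix: "V *v tens \<eta> f = tens \<eta> f \<Longrightarrow> Lsl V \<zeta> \<eta> *v f = cinner \<zeta> \<eta> *s f"
  by (rule vec_ext_cinner) (simp add: cinner_Lsl cinner_tens cinner_scale_right)

lemma delta_Lsl_fix:
  assumes "V *v tens \<eta> f = tens \<eta> f"
  shows "delta (Lsl V \<zeta> \<eta>) *v tens \<xi> f = tens (Lsl V \<zeta> \<eta> *v \<xi>) f"
  using Lsl_e'_sum[of \<eta> \<zeta> \<xi>]
  by (simp add: delta_Lsl sum_mv kron_tens Lsl_fix[OF assms] tens_scale flip: tens_scale(1)) (simp flip: tens_sum)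

text \<open>With \<open>G_if_fix\<close> this characterises \<open>G f\<close> inside
  \<open>S\<close> by \<delta>(x)(\<xi> \<otimes> f) = x \<xi> \<otimes> f. That form is visibly
  stable under products, while the definition speaks only of the vector x e.\<close>

lemma G_fix: assumes "psub f" "x \<in> G f" shows "delta x *v tens \<xi> f = tens (x *v \<xi>) f"
proof -
  have x: "x = lam (x *v e)" "V *v tens (x *v e) f = tens (x *v e) f"
    using assms by (simp_all add: G_iff flip: S_iff)
  have "delta (lam (x *v e)) *v tens \<xi> f = tens (lam (x *v e) *v \<xi>) f"
    using delta_Lsl_fix[OF x(2), of e' \<xi>] unfolding lam_def
    by (simp add: delta_def kron_cmscale cmscale_mult_left cmscale_mult_right cmscale_mv tens_scale)
  then show ?thesis using x(1) by simp
qed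

lemma G_if_fix: assumes "psub f" "x \<in> S" "delta x *v tens e f = tens (x *v e) f" shows "x \<in> G f"
  using assms by (simp add: G_iff V_delta V_e)

lemma Lsl_G: "psub f \<Longrightarrow> V *v tens \<eta> f = tens \<eta> f \<Longrightarrow> Lsl V \<zeta> \<eta> \<in> G f"
  by (simp add: G_if_fix delta_Lsl_fix)

text \<open>Slicing the second leg of \<delta>(x) by the state of f is the projection of
  \<open>S\<close> onto \<open>G f\<close>. It respects adjoints, whence \<open>G_cadj\<close>;
  taken for a second pre-subgroup it yields \<open>G_tau\<close>.\<close>

lemma cinner_delta_ph:
  assumes "x \<in> S"
  shows "cinner (tens a f) (delta x *v tens b f) = cinner a (lam (ph f *v (x *v e)) *v b)"
proof -
  obtain \<eta> where x: "x = lam \<eta>" using assms by (auto simp: S_def)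
  have "cinner (tens a f) (delta x *v tens b f) = sN * (\<Sum>k\<in>UNIV. (ph f *v \<eta>) $ k * cinner a (Lsl V e' (ax k) *v b))"
    by (simp add: x delta_lam cmscale_mv cinner_scale_right sum_mv cinner_sum_right kron_tens cinner_tens Lsl_Rsl[of f] mult.commute)
  also have "\<dots> = sN * cinner a (Lsl V e' (ph f *v \<eta>) *v b)"
    by (simp add: cinner_sum_right cinner_scale_right flip: Lsl_e'_sum[of "ph f *v \<eta>"])
  finally have "cinner (tens a f) (delta x *v tens b f) = cinner a (lam (ph f *v \<eta>) *v b)"
    by (simp add: lam_def cmscale_mv cinner_scale_right)
  then show ?thesis by (simp add: x)
qed

lemma G_cadj: assumes "psub f" "x \<in> G f" shows "cadj x \<in> G f"
proof -
  have s: "cadj x \<in> S" using assms by (simp add: G_S S_cadj)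
  have "lam (ph f *v (cadj x *v e)) = cadj x"
  proof (rule mat_ext_cinner)
    fix a b
    have "cinner (tens a f) (delta (cadj x) *v tens b f) = cinner (delta x *v tens a f) (tens b f)"
      by (subst cinner_adj) (simp add: delta_cadj)
    then show "cinner a (lam (ph f *v (cadj x *v e)) *v b) = cinner a (cadj x *v b)"
      using psub_cinner[OF assms(1)] by (simp add: cinner_delta_ph[OF s] G_fix[OF assms] cinner_tens cinner_adj')
  qed
  then have "lam (ph f *v (cadj x *v e)) *v e = cadj x *v e" by simp
  then show ?thesis using s by (simp add: G_def)
qed

lemma G_mult: assumes "psub f" "x \<in> G f" "y \<in> G f" shows "x ** y \<in> G f"
  using assms by (intro G_if_fix) (auto simp: S_mult G_S delta_mult G_fix simp flip: matrix_vector_mul_assoc)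

lemma one_G: "psub f \<Longrightarrow> mat 1 \<in> G f"
  by (simp add: G_def ph_e)

lemma G_mv_f: assumes "psub f" "x \<in> G f" shows "x *v f = counit x *s f"
proof -
  have x: "x = lam (x *v e)" "V *v tens (x *v e) f = tens (x *v e) f"
    using assms by (simp_all add: G_iff flip: S_iff)
  have "lam (x *v e) *v f = counit (lam (x *v e)) *s f"
    by (simp add: counit_lam) (simp add: lam_def cmscale_mv Lsl_fix[OF x(2)] vector_smult_assoc)
  then show ?thesis using x(1) by simp
qed

lemma p_S: "p f \<in> S" by simp

lemma G_p: assumes "psub f" "x \<in> G f" shows "x ** p f = cmscale (counit x) (p f)" "p f ** x = cmscale (counit x) (p f)"
proof -
  have 1: "x ** p f = cmscale (counit x) (p f)" if "x \<in> G f" for x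
  proof (rule S_eqI)
    show "x ** p f \<in> S" using that by (simp add: G_S S_mult)
    show "cmscale (counit x) (p f) \<in> S" by (simp add: csub_scale csub_S)
    show "(x ** p f) *v e = cmscale (counit x) (p f) *v e"
      by (simp add: p_e assms(1) mv_scale G_mv_f[OF assms(1) that] cmscale_mv vector_smult_assoc mult.commute flip: matrix_vector_mul_assoc)
  qed
  show "x ** p f = cmscale (counit x) (p f)" by (rule 1[OF assms(2)])
  have "cadj (cadj x ** p f) = cadj (cmscale (counit (cadj x)) (p f))"
    using 1[OF G_cadj[OF assms]] by simp
  then show "p f ** x = cmscale (counit x) (p f)"
    by (simp add: cadj_mult cadj_cmscale p_selfadjoint[OF assms(1)] counit_cadj)
qed

lemma delta_blk1_G: assumes "psub f" "x \<in> G f" shows "blk1 (delta x) i j \<in> G f"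
proof -
  have x: "x = lam (x *v e)" "V *v tens (x *v e) f = tens (x *v e) f"
    using assms by (simp_all add: G_iff flip: S_iff)
  have "blk1 (delta (lam (x *v e))) i j \<in> G f"
    by (simp add: delta_lam blk_cmscale blk_sum blk_kron csub_sum csub_scale csub_G Lsl_G assms(1) x(2))
  then show ?thesis using x(1) by simp
qed

text \<open>The second leg of \<delta>(x) stays in \<open>G f\<close>, where multiplication by
  \<open>p f\<close> amounts to the counit, and the counit of the second leg returns x.\<close>

lemma delta_p: assumes "psub f" "x \<in> G f" shows "delta x ** kron (mat 1) (p f) = kron x (p f)"
proof (rule blk_ext1)
  fix i j
  have z: "blk1 (delta x) i j \<in> G f" by (rule delta_blk1_G[OF assms])
  \<comment> \<open>Every element of \<open>S\<close> has e' as an eigenvector, so one nonzero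
    coordinate of e' is enough to read off the counit.\<close>
  obtain k where k: "e' $ k \<noteq> 0" using norm_e' by (metis norm_zero vec_eq_iff zero_index zero_neq_one)
  have "(blk1 (delta x) i j *v e') $ k = (delta x *v tens (ax j) e') $ (i, k)" by (rule blk1_mv[symmetric])
  also have "\<dots> = x $ i $ j * e' $ k"
    unfolding delta_mv_e' by (simp add: matrix_vector_mult_def ax_nth if_distrib cong: if_cong)
  finally have "counit (blk1 (delta x) i j) = x $ i $ j"
    using k by (simp add: S_mv_e'[OF G_S[OF z]])
  then show "blk1 (delta x ** kron (mat 1) (p f)) i j = blk1 (kron x (p f)) i j"
    by (simp add: blk_mult_kron1 G_p[OF assms(1) z] blk_kron)
qed

lemma delta_p_mv: "psub f \<Longrightarrow> x \<in> G f \<Longrightarrow> p f *v \<eta> = \<eta> \<Longrightarrow> delta x *v tens \<xi> \<eta> = tens (x *v \<xi>) \<eta>"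
  using arg_cong[OF delta_p[of f x], of "\<lambda>A. A *v tens \<xi> \<eta>"]
  by (simp add: kron_tens flip: matrix_vector_mul_assoc)

text \<open>The definition of H_f gives this for \<eta> = f only. Write \<zeta> as
  \<open>lam \<zeta> *v e\<close> with \<open>lam \<zeta>\<close> in \<open>G f\<close>; then V
  passes through the coproduct to the fixed vector e and \<open>delta_p_mv\<close> covers all of
  H^f.\<close>

lemma V_down_up:
  assumes "psub f" "ph f *v \<zeta> = \<zeta>" "p f *v \<eta> = \<eta>" shows "V *v tens \<zeta> \<eta> = tens \<zeta> \<eta>"
proof -
  have "lam \<zeta> \<in> G f" using assms by (simp add: G_def)
  then have "V *v tens (lam \<zeta> *v e) \<eta> = tens (lam \<zeta> *v e) \<eta>"
    by (subst V_delta) (simp only: V_e delta_p_mv[OF assms(1) _ assms(3)])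
  then show ?thesis by simp
qed

lemma d_delta: "munitary.delta (dualV V) y *v tens b a = swapv (cadj V *v (kron (mat 1) y *v (V *v tens a b)))"
proof -
  have "kron A B *v swapv t = swapv (kron B A *v t)" for A B :: "complex^'n^'n" and t
    using sum_UNIV_swap[of "\<lambda>p. A $ _ $ snd p * B $ _ $ fst p * t $ p"]
    by (simp add: vec_eq_iff kron_def swapv_def matrix_vector_mult_def mult_ac)
  then show ?thesis
    by (simp add: munitary.delta_def[OF dual] cadj_dualV dualV_mv swapv_tens flip: matrix_vector_mul_assoc)
qed

lemma p_dual: "psub f \<Longrightarrow> Rsl (dualV V) f f = p f"
  by (simp add: Rsl_dualV p_selfadjoint)

text \<open>The dual of \<open>delta_p_mv\<close> says that 1 \<otimes> y passes through V on \<eta>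
  \<otimes> H when \<eta> is in H_f. Slicing by e' turns this into commutation with
  \<open>lam \<eta>\<close>.\<close>

lemma G_dual_commute:
  assumes "psub f" "x \<in> G f" "y \<in> munitary_one.G (dualV V) e' e f" shows "x ** y = y ** x"
proof -
  interpret d: munitary_one "dualV V" e' e by (rule dual_munitary_one)
  have df: "d.psub f" using assms(1) by (simp add: psub_dual)
  have x: "x = lam (x *v e)" "ph f *v (x *v e) = x *v e"
    using assms(2) by (simp_all add: G_def flip: S_iff)
  define \<eta> where "\<eta> = x *v e"
  have "d.delta y *v tens b \<eta> = tens (y *v b) \<eta>" for b
    by (rule d.delta_p_mv[OF df assms(3)]) (simp add: ph_dual assms(1) \<eta>_def x(2))
  then have "cadj V *v (kron (mat 1) y *v (V *v tens \<eta> b)) = tens \<eta> (y *v b)" for b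
    by (metis d_delta swapv_tens swapv_swapv)
  then have k: "kron (mat 1) y *v (V *v tens \<eta> b) = V *v tens \<eta> (y *v b)" for b
    by (metis VV_mv(1))
  have "Lsl V e' \<eta> ** y = y ** Lsl V e' \<eta>"
  proof (rule mat_ext_cinner)
    fix a b
    have "cinner a (y *v (Lsl V e' \<eta> *v b)) = cinner (tens e' (cadj y *v a)) (V *v tens \<eta> b)"
      by (simp add: cinner_adj[of a y] cinner_Lsl)
    also have "\<dots> = cinner (tens e' a) (kron (mat 1) y *v (V *v tens \<eta> b))"
      by (simp add: cinner_adj[of _ "kron _ _"] cadj_kron kron_tens)
    finally show "cinner a ((Lsl V e' \<eta> ** y) *v b) = cinner a ((y ** Lsl V e' \<eta>) *v b)"
      by (simp add: k cinner_Lsl flip: matrix_vector_mul_assoc)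
  qed
  then have "lam \<eta> ** y = y ** lam \<eta>" by (simp add: lam_def cmscale_mult_left cmscale_mult_right)
  then show ?thesis using x(1) by (simp add: \<eta>_def)
qed

end

text \<open>Split off the common vector v. The remainders P and R are projections, and the trace of
  the product exceeds one by the squared Hilbert-Schmidt norm of R P.\<close>

lemma projection_pair:
  fixes p r :: "complex^'n::finite^'n"
  assumes p: "p ** p = p" "cadj p = p" "p *v v = v" and r: "r ** r = r" "cadj r = r" "r *v v = v"
    and v: "cinner v v = 1"
  shows "Re (trace (p ** r)) \<ge> 1" and "trace (p ** r) = 1 \<Longrightarrow> p ** r = ketbra v v"
proof -
  let ?k = "ketbra v v"
  define P where "P = p - ?k"
  define R where "R = r - ?k"
  have c: "p ** ?k = ?k" "?k ** p = ?k" "r ** ?k = ?k" "?k ** r = ?k" "?k ** ?k = ?k"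
    using p r v by (simp_all add: mult_ketbra ketbra_mult ketbra_mv)
  have d: "(A - B) ** C = A ** C - B ** C" "C ** (A - B) = C ** A - C ** B" for A B C :: "complex^'n^'n"
    by (simp_all add: vec_eq_iff matrix_matrix_mult_def algebra_simps sum_subtractf)
  have P: "P ** P = P" "cadj P = P" and R: "R ** R = R" "cadj R = R"
    using p r by (simp_all add: P_def R_def d c cadj_diff cadj_ketbra)
  have PR: "P ** R = p ** r - ?k" by (simp add: P_def R_def d c)
  have "trace (cadj (R ** P) ** (R ** P)) = trace (P ** R ** P)"
    using P R by (simp add: cadj_mult) (metis matrix_mul_assoc)
  also have "\<dots> = trace (P ** R)" using P by (subst trace_mul_sym) (simp add: matrix_mul_assoc)
  also have "\<dots> = trace (p ** r) - 1" by (simp add: PR trace_sub trace_ketbra v)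
  finally have t: "trace (cadj (R ** P) ** (R ** P)) = trace (p ** r) - 1" .
  then show "Re (trace (p ** r)) \<ge> 1" using trace_cadj_mult_self_nonneg(1)[of "R ** P"] by simp
  assume "trace (p ** r) = 1"
  then have "R ** P = 0" using t trace_cadj_mult_self_0 by simp
  then have "cadj (R ** P) = 0" by simp
  then show "p ** r = ?k" using PR P R by (simp add: cadj_mult)
qed

subsection \<open>The antipode\<close>

definition swapm :: "complex^('n::finite \<times> 'n)^('n \<times> 'n) \<Rightarrow> complex^('n \<times> 'n)^('n \<times> 'n)" where
  "swapm T = (\<chi> p q. T $ (snd p, fst p) $ (snd q, fst q))"

lemma swapm_mv: "swapm T *v swapv t = swapv (T *v t)"
  using sum_UNIV_swap[of "\<lambda>p. T $ _ $ p * t $ p"]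
  by (simp add: vec_eq_iff swapm_def swapv_def matrix_vector_mult_def)

lemma blk_swapm: "blk1 (swapm T) i j = blk2 T i j" "blk2 (swapm T) i j = blk1 T i j"
  by (simp_all add: vec_eq_iff swapm_def blk1_def blk2_def)

lemma kron_swapv: "kron A B *v swapv t = swapv (kron B A *v t)"
proof -
  have "kron A B = swapm (kron B A)" by (simp add: vec_eq_iff swapm_def kron_def mult.commute)
  then show ?thesis by (simp add: swapm_mv)
qed

context munitary_one begin

lemma delta_ph_mv:
  assumes "psub f" "x \<in> G f" shows "kron (mat 1) (ph f) *v (delta x *v tens \<xi> e) = delta x *v tens \<xi> e"
proof -
  have x: "x = lam (x *v e)" "V *v tens (x *v e) f = tens (x *v e) f"
    using assms by (simp_all add: G_iff flip: S_iff)
  have "ph f *v (Lsl V (ax k) (x *v e) *v e) = Lsl V (ax k) (x *v e) *v e" for k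
    using Lsl_G[OF assms(1) x(2)] by (simp add: G_def)
  then have "kron (mat 1) (ph f) *v (delta (lam (x *v e)) *v tens \<xi> e) = delta (lam (x *v e)) *v tens \<xi> e"
    by (simp add: delta_lam cmscale_mv sum_mv kron_tens mv_scale mv_sum)
  then show ?thesis using x(1) by simp
qed

lemma swapm_dual_delta: "cadj V ** kron (mat 1) y ** V = swapm (munitary.delta (dualV V) y)"
proof (rule mat_ext_tens)
  fix a b
  have "swapm (munitary.delta (dualV V) y) *v tens a b = swapv (munitary.delta (dualV V) y *v tens b a)"
    using swapm_mv[of "munitary.delta (dualV V) y" "tens b a"] by (simp add: swapv_tens)
  then show "(cadj V ** kron (mat 1) y ** V) *v tens a b = swapm (munitary.delta (dualV V) y) *v tens a b"
    by (simp add: d_delta flip: matrix_vector_mul_assoc)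
qed

lemma dual_lam: "munitary_one.lam (dualV V) e' e v = cmscale sN (cadj (Rsl V v e))"
  using munitary_one.lam_def[OF dual_munitary_one] munitary_one.sN_eq[OF dual_munitary_one] by (simp add: sN_eq Lsl_dualV)

lemma Rsl_dual_S: "Rsl V \<alpha> \<beta> \<in> munitary_one.S (dualV V) e' e"
proof -
  interpret d: munitary_one "dualV V" e' e by (rule dual_munitary_one)
  have "cadj (cadj (Rsl V \<alpha> \<beta>)) \<in> d.S" by (rule d.S_cadj) (simp flip: Lsl_dualV)
  then show ?thesis by simp
qed

lemma blk2_dual_S: "blk2 V i j \<in> munitary_one.S (dualV V) e' e"
  using Rsl_dual_S[of "ax i" "ax j"] by simp

end

text \<open>The condition is U x e = \<kappa>(x) e for slices by vector functionals: slicing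
  \<open>cadj V\<close> gives the adjoint slice with the two vectors exchanged.\<close>

locale munitary_U = munitary_one V e e' for V :: "complex^('n::finite \<times> 'n)^('n \<times> 'n)" and e e' +
  fixes U :: "complex^'n^'n"
  assumes unitary_U: "unitary_op U"
    and U_Lsl: "U *v (Lsl V \<zeta> \<eta> *v e) = cadj (Lsl V \<eta> \<zeta>) *v e"
begin

definition antipode :: "complex^'n^'n \<Rightarrow> complex^'n^'n" where "antipode x = lam (U *v (x *v e))"

lemma antipode_S [simp]: "antipode x \<in> S" by (simp add: antipode_def)

lemma antipode_mv_e: "antipode x *v e = U *v (x *v e)" by (simp add: antipode_def)

lemma antipode_add: "antipode (x + y) = antipode x + antipode y"
  by (simp add: antipode_def matrix_vector_mult_add_rdistrib matrix_vector_right_distrib lam_add)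

lemma antipode_scale: "antipode (cmscale c x) = cmscale c (antipode x)"
  by (simp add: antipode_def cmscale_mv mv_scale lam_scale)

lemma antipode_0 [simp]: "antipode 0 = 0" by (simp add: antipode_def)

lemma antipode_sum: "antipode (\<Sum>i\<in>I. h i) = (\<Sum>i\<in>I. antipode (h i))"
  by (induction I rule: infinite_finite_induct) (simp_all add: antipode_add)

lemma antipode_Lsl: "antipode (Lsl V \<zeta> \<eta>) = cadj (Lsl V \<eta> \<zeta>)"
  by (rule S_eqI) (simp_all add: antipode_mv_e U_Lsl S_cadj)

lemma S_form: assumes "x \<in> S" obtains v where "x = cmscale sN (Lsl V e' v)"
  using assms by (auto simp: S_def lam_def)

lemma antipode_mult: assumes "x \<in> S" "y \<in> S" shows "antipode (x ** y) = antipode y ** antipode x"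
proof -
  obtain v w where x: "x = cmscale sN (Lsl V e' v)" "y = cmscale sN (Lsl V e' w)"
    using assms by (metis S_form)
  have "antipode (Lsl V \<zeta> \<eta> ** Lsl V \<zeta>' \<eta>') = antipode (Lsl V \<zeta>' \<eta>') ** antipode (Lsl V \<zeta> \<eta>)" for \<zeta> \<eta> \<zeta>' \<eta>'
    unfolding Lsl_mult antipode_sum antipode_Lsl cadj_mult[symmetric] by (simp add: Lsl_mult cadj_sum)
  then show ?thesis
    by (simp add: x antipode_scale cmscale_mult_left cmscale_mult_right)
qed

text \<open>Read off on slices by e', before anything is known about applying
  \<open>antipode\<close> twice. It feeds the proof that U is self-adjoint and afterwards becomes
  \<open>antipode_cadj\<close>.\<close>

lemma antipode_cadj_antipode: assumes "x \<in> S" shows "antipode (cadj (antipode x)) = cadj x"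
proof -
  obtain v where x: "x = cmscale sN (Lsl V e' v)" using assms by (rule S_form)
  show ?thesis by (simp add: x antipode_scale cadj_cmscale antipode_Lsl)
qed

lemma UU_cadj: "cadj U ** U = mat 1" "U ** cadj U = mat 1"
  using unitary_U by (simp_all add: unitary_op_def)

lemma U_e: "U *v e = e"
  using U_Lsl[of e e] by (simp add: Lsl_e e_e cmscale_one)

lemma cadj_U_e: "cadj U *v e = e"
  by (metis U_e UU_cadj(1) matrix_vector_mul_assoc matrix_vector_mul_lid)

text \<open>Self-adjointness of \<open>U\<close> comes from traciality of the vector state given by \<open>e\<close> on \<open>S\<close>.\<close>
lemma U_selfadjoint: "cadj U = U"
proof (rule mat_ext_cinner)
  fix a b
  have tau: "cinner e (antipode z *v e) = cinner e (z *v e)" for z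
    by (simp add: antipode_mv_e cinner_adj[of e U] cadj_U_e)
  define x where "x = lam b"
  define y where "y = lam a"
  have S: "x \<in> S" "y \<in> S" by (simp_all add: x_def y_def)
  let ?w = "cadj (antipode y)"
  have w: "?w \<in> S" by (simp add: S_cadj)
  have "cinner a (U *v b) = cinner (y *v e) (antipode x *v e)"
    by (simp add: x_def y_def antipode_mv_e)
  also have "\<dots> = cinner e (cadj y *v (antipode x *v e))" by (simp add: cinner_adj'[of y])
  also have "\<dots> = cinner e (antipode x *v (cadj y *v e))" by (rule trace_S_commute) (simp_all add: S S_cadj)
  also have "\<dots> = cinner e ((antipode x ** antipode ?w) *v e)"
    by (simp add: antipode_cadj_antipode S flip: matrix_vector_mul_assoc)
  also have "\<dots> = cinner e (antipode (?w ** x) *v e)" by (simp add: antipode_mult S w)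
  also have "\<dots> = cinner e (?w *v (x *v e))" by (simp add: tau matrix_vector_mul_assoc)
  also have "\<dots> = cinner (antipode y *v e) (x *v e)" by (simp add: cinner_adj)
  also have "\<dots> = cinner (U *v a) b" by (simp add: x_def y_def antipode_mv_e)
  finally show "cinner a (cadj U *v b) = cinner a (U *v b)" by (simp add: cinner_adj)
qed

lemma UU [simp]: "U ** U = mat 1"
  using UU_cadj U_selfadjoint by simp

lemma UU_mult [simp]: "U ** (U ** A) = A"
  by (simp add: matrix_mul_assoc)

lemma UU_mv [simp]: "U *v (U *v x) = x"
  by (simp add: matrix_vector_mul_assoc)

lemma antipode_antipode: "x \<in> S \<Longrightarrow> antipode (antipode x) = x"
  by (rule S_eqI) (simp_all add: antipode_mv_e)

lemma antipode_cadj: "x \<in> S \<Longrightarrow> antipode (cadj x) = cadj (antipode x)"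
  using antipode_cadj_antipode[of "antipode x"] by (simp add: antipode_antipode)

text \<open>On vectors y e the operator U x U is right multiplication by \<open>antipode x\<close>,
  because \<open>antipode\<close> reverses products; right multiplications commute with left
  ones.\<close>

lemma U_commute: assumes "x \<in> S" "y \<in> S" shows "(U ** x ** U) ** y = y ** (U ** x ** U)"
proof (rule mat_ext_mv)
  fix v
  define z where "z = lam v"
  have z: "z \<in> S" "z *v e = v" by (simp_all add: z_def)
  have U: "U *v (w *v e) = antipode w *v e" for w by (simp add: antipode_mv_e)
  have "(U ** x ** U ** y) *v v = U *v (x *v (U *v ((y ** z) *v e)))"
    by (simp add: z flip: matrix_vector_mul_assoc)
  also have "U *v ((y ** z) *v e) = (antipode z ** antipode y) *v e"
    by (simp only: U antipode_mult assms z)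
  also have "U *v (x *v ((antipode z ** antipode y) *v e)) = U *v ((x ** antipode z ** antipode y) *v e)"
    by (simp only: matrix_vector_mul_assoc matrix_mul_assoc)
  also have "\<dots> = (y ** z ** antipode x) *v e"
    by (simp add: U antipode_mult antipode_antipode assms z S_mult matrix_mul_assoc)
  also have "\<dots> = y *v (antipode (x ** antipode z) *v e)"
    by (simp add: antipode_mult antipode_antipode assms z matrix_vector_mul_assoc matrix_mul_assoc)
  also have "\<dots> = (y ** (U ** x ** U)) *v v"
    by (simp add: antipode_mv_e z(2) flip: matrix_vector_mul_assoc)
  finally show "(U ** x ** U ** y) *v v = (y ** (U ** x ** U)) *v v" .
qed

lemma U_f: assumes "psub f" shows "U *v f = f"
proof -
  have "U *v (p f *v e) = p f *v e" by (simp add: U_Lsl p_selfadjoint[OF assms])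
  then show ?thesis using psub_nz(1)[OF assms] by (simp add: p_e[OF assms] mv_scale)
qed

lemma U_e': "U *v e' = e'" by (rule U_f) (rule psub_e)

text \<open>The same U serves the dual. On \<open>S\<close> the functional of \<eta> and \<zeta>
  equals \<langle>v, x e\<rangle> up to the factor \<open>sN\<close>, where v is the vector at which
  U has to be evaluated. Its adjoint is \<langle>e, x v\<rangle>, and the relation between U and the
  slices of V computes what the resulting operator does to e'.\<close>

lemma dual_munitary_U: "munitary_U (dualV V) e' e U"
proof -
  interpret d: munitary_one "dualV V" e' e by (rule dual_munitary_one)
  show ?thesis
  proof (unfold_locales, rule unitary_U)
    fix \<zeta> \<eta>
    define v where "v = cadj (Rsl V \<eta> \<zeta>) *v e'"
    have "cadj (Rsl V \<eta> \<zeta>) \<in> d.S" by (simp flip: Lsl_dualV)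
    then have "cadj (Rsl V \<eta> \<zeta>) = d.lam v" unfolding v_def by (simp flip: d.S_iff)
    then have "cadj (Rsl V \<eta> \<zeta>) = cadj (cmscale sN (Rsl V v e))"
      by (simp add: dual_lam cadj_cmscale)
    then have "Rsl V \<eta> \<zeta> = cmscale sN (Rsl V v e)" by (simp add: cadj_eq_iff)
    then have "cinner \<eta> (Lsl V a b *v \<zeta>) = sN * cinner v (Lsl V a b *v e)" for a b
      by (simp add: Lsl_Rsl cmscale_mv cinner_scale_right)
    then have 0: "cinner \<eta> (lam w *v \<zeta>) = sN * cinner v (lam w *v e)" for w
      unfolding lam_def cmscale_mv cinner_scale_right by simp
    have 1: "cinner \<eta> (cadj x *v \<zeta>) = sN * cinner v (cadj x *v e)" if xS: "x \<in> S" for x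
    proof -
      obtain w where "cadj x = lam w" using S_cadj[OF xS] by (auto simp: S_def)
      then show ?thesis using 0 by simp
    qed
    have 2: "cinner \<zeta> (x *v \<eta>) = sN * cinner e (x *v v)" if "x \<in> S" for x
      using arg_cong[OF 1[OF that], of cnj] by (simp add: cinner_adj flip: cinner_commute)
    have "Rsl V \<zeta> \<eta> = cmscale sN (Rsl V e v)"
      by (rule mat_ext_cinner) (simp add: 2 cmscale_mv cinner_scale_right flip: Lsl_Rsl)
    then have 3: "Rsl V \<zeta> \<eta> *v e' = sN *s (Rsl V e v *v e')" by (simp add: cmscale_mv)
    have "sN *s (Rsl V e v *v e') = U *v v"
    proof (rule vec_ext_cinner)
      fix \<alpha>
      have "sN *s (cadj (Lsl V \<alpha> e') *v e) = U *v (lam \<alpha> *v e)"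
        unfolding lam_def cmscale_mv mv_scale U_Lsl ..
      then have "cinner (U *v \<alpha>) v = sN * cinner (cadj (Lsl V \<alpha> e') *v e) v"
        by (metis cinner_scale_left cnj_sN lam_mv_e)
      also have "\<dots> = sN * cinner \<alpha> (Rsl V e v *v e')" by (simp add: cinner_adj' flip: Lsl_Rsl)
      finally show "cinner \<alpha> (sN *s (Rsl V e v *v e')) = cinner \<alpha> (U *v v)"
        by (simp add: cinner_scale_right cinner_adj U_selfadjoint)
    qed
    then show "U *v (Lsl (dualV V) \<zeta> \<eta> *v e') = cadj (Lsl (dualV V) \<eta> \<zeta>) *v e'"
      using 3 by (simp add: Lsl_dualV v_def)
  qed
qed

lemma U_V_e: "kron (mat 1) U *v (V *v tens \<xi> e) = cadj V *v tens \<xi> e"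
proof (rule vec_ext_tens)
  fix \<zeta> a
  have "cinner (tens \<zeta> a) (kron (mat 1) U *v (V *v tens \<xi> e)) = cinner (tens \<zeta> (U *v a)) (V *v tens \<xi> e)"
    by (subst cinner_adj) (simp add: cadj_kron kron_tens U_selfadjoint)
  also have "\<dots> = cinner a (U *v (Lsl V \<zeta> \<xi> *v e))"
    by (subst cinner_adj) (simp add: cinner_Lsl U_selfadjoint)
  finally show "cinner (tens \<zeta> a) (kron (mat 1) U *v (V *v tens \<xi> e)) = cinner (tens \<zeta> a) (cadj V *v tens \<xi> e)"
    by (simp add: U_Lsl flip: cinner_Lsl Lsl_cadj)
qed

lemma U_V_e': "kron U (mat 1) *v (V *v tens e' \<xi>) = cadj V *v tens e' \<xi>"
proof -
  interpret d: munitary_U "dualV V" e' e U by (rule dual_munitary_U)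
  have "kron (mat 1) U *v (swapv (cadj V *v tens e' \<xi>)) = swapv (V *v tens e' \<xi>)"
    using d.U_V_e[of \<xi>] by (simp add: dualV_tens cadj_dualV)
  then have 1: "kron U (mat 1) *v (cadj V *v tens e' \<xi>) = V *v tens e' \<xi>"
    by (simp add: kron_swapv swapv_eq_iff)
  have "kron U (mat 1) *v (kron U (mat 1) *v t) = t" for t
    by (simp add: matrix_vector_mul_assoc kron_mult kron_one)
  then show ?thesis using 1 by metis
qed

text \<open>For the dual unitary this is the algebra \<open>G\<^sub>f\<close> with a hat.\<close>
definition D :: "complex^'n \<Rightarrow> (complex^'n^'n) set" where
  "D f = {x \<in> S. ph f *v (U *v (x *v e)) = U *v (x *v e)}"

lemma D_S: "x \<in> D f \<Longrightarrow> x \<in> S" by (simp add: D_def)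

lemma D_iff: "x \<in> D f \<longleftrightarrow> x \<in> S \<and> antipode x \<in> G f"
  by (simp add: D_def G_def antipode_mv_e)

lemma csub_D: "csub (D f)"
  using csub_S csub_G by (auto simp: csub_def D_iff antipode_add antipode_scale)

lemma D_cadj: "psub f \<Longrightarrow> x \<in> D f \<Longrightarrow> cadj x \<in> D f"
  by (simp add: D_iff S_cadj antipode_cadj G_cadj)

lemma lam_D: "psub f \<Longrightarrow> lam (U *v (ph f *v \<eta>)) \<in> D f"
  by (simp add: D_def ph_idem_mv)

lemma antipode_p: "psub f \<Longrightarrow> antipode (p f) = p f"
  by (simp add: antipode_Lsl p_selfadjoint)

lemma D_p: assumes "psub f" "x \<in> D f" shows "x ** p f = cmscale (counit x) (p f)"
proof -
  have k: "antipode x \<in> G f" "x \<in> S" using assms by (simp_all add: D_iff)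
  have "antipode (p f ** antipode x) = antipode (cmscale (counit (antipode x)) (p f))"
    by (simp add: G_p[OF assms(1) k(1)])
  then have 1: "x ** p f = cmscale (counit (antipode x)) (p f)"
    by (simp add: antipode_mult antipode_antipode k antipode_scale antipode_p assms)
  then have "(x ** p f) *v e' = cmscale (counit (antipode x)) (p f) *v e'" by simp
  then have "x *v e' = counit (antipode x) *s e'"
    by (simp add: p_e' assms cmscale_mv flip: matrix_vector_mul_assoc)
  then have "counit x = counit (antipode x)" by (simp add: counit_def cinner_scale_right e_e)
  then show ?thesis using 1 by simp
qed

lemma Lsl_D: "psub f \<Longrightarrow> V *v tens \<zeta> f = tens \<zeta> f \<Longrightarrow> Lsl V \<zeta> \<eta> \<in> D f"
  by (simp add: D_iff antipode_Lsl G_cadj Lsl_G)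

lemma delta_blk2_D: assumes "psub f" "x \<in> D f" shows "blk2 (delta x) i j \<in> D f"
proof -
  have k: "antipode x \<in> G f" "x \<in> S" using assms by (simp_all add: D_iff)
  define \<eta> where "\<eta> = antipode x *v e"
  have \<eta>: "V *v tens \<eta> f = tens \<eta> f" using k assms by (simp add: \<eta>_def G_iff)
  have "antipode x = lam \<eta>" using k(1) by (simp add: \<eta>_def G_S flip: S_iff)
  then have "x = antipode (lam \<eta>)" using k by (metis antipode_antipode)
  then have x: "cadj x = cmscale sN (Lsl V \<eta> e')"
    by (simp add: lam_def antipode_scale antipode_Lsl cadj_cmscale)
  have "delta (cadj x) = cmscale sN (\<Sum>k\<in>UNIV. kron (Lsl V \<eta> (ax k)) (Lsl V (ax k) e'))"
    by (simp add: delta_Lsl[symmetric]) (simp add: x delta_def kron_cmscale cmscale_mult_left cmscale_mult_right)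
  then have "blk2 (delta (cadj x)) j i \<in> D f"
    by (simp add: blk_cmscale blk_sum blk_kron csub_sum csub_scale csub_D Lsl_D assms(1) \<eta>)
  then have "cadj (blk2 (cadj (delta x)) j i) \<in> D f"
    using D_cadj[OF assms(1)] by (simp add: delta_cadj)
  then show ?thesis by (simp add: blk_cadj)
qed

lemma delta_D: assumes "psub f" "x \<in> D f" shows "delta x ** kron (p f) (mat 1) = kron (p f) x"
proof (rule blk_ext2)
  fix i j
  have z: "blk2 (delta x) i j \<in> D f" by (rule delta_blk2_D[OF assms])
  obtain k where k: "e' $ k \<noteq> 0" using norm_e' by (metis norm_zero vec_eq_iff zero_index zero_neq_one)
  have "(blk2 (delta x) i j *v e') $ k = (delta x *v tens e' (ax j)) $ (k, i)" by (rule blk2_mv[symmetric])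
  also have "\<dots> = e' $ k * x $ i $ j"
    unfolding delta_e'[OF D_S[OF assms(2)]] by (simp add: matrix_vector_mult_def ax_nth if_distrib cong: if_cong)
  finally have "counit (blk2 (delta x) i j) = x $ i $ j"
    using k by (simp add: S_mv_e'[OF D_S[OF z]])
  then show "blk2 (delta x ** kron (p f) (mat 1)) i j = blk2 (kron (p f) x) i j"
    by (simp add: blk_mult_kron1 D_p[OF assms(1) z] blk_kron)
qed

text \<open>Conjugation by U places the second factor in the commutant of the dual algebra, and it
  makes y reappear on the first leg over the vector e, see \<open>bet_mv_e\<close>.\<close>

definition bet :: "complex^'n^'n \<Rightarrow> complex^('n\<times>'n)^('n\<times>'n)" where
  "bet y = V ** kron (mat 1) (U ** y ** U) ** cadj V"

lemma bet_mult: "bet (x ** y) = bet x ** bet y"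
proof -
  have "U ** (x ** y) ** U = (U ** x ** U) ** (U ** y ** U)"
    by (simp flip: matrix_mul_assoc)
  then have "kron (mat 1) (U ** (x ** y) ** U) = kron (mat 1) (U ** x ** U) ** kron (mat 1) (U ** y ** U)"
    by (simp add: kron_mult)
  then show ?thesis by (simp add: bet_def flip: matrix_mul_assoc)
qed

lemma bet_cadj: "bet (cadj y) = cadj (bet y)"
  by (simp add: bet_def cadj_mult cadj_kron U_selfadjoint matrix_mul_assoc)

lemma bet_one: "bet (mat 1) = mat 1"
  by (simp add: bet_def kron_one)

lemma bet_add: "bet (x + y) = bet x + bet y"
  by (simp add: bet_def matrix_add_ldistrib matrix_add_rdistrib kron_add)

lemma bet_scale: "bet (cmscale c x) = cmscale c (bet x)"
  by (simp add: bet_def cmscale_mult_left cmscale_mult_right kron_cmscale)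

lemma delta_bet: "delta x ** bet y = bet y ** delta x"
  by (simp add: delta_def bet_def matrix_mul_assoc[symmetric])
     (simp add: matrix_mul_assoc kron_mult)

lemma delta_add: "delta (x + y) = delta x + delta y"
  by (simp add: delta_def matrix_add_ldistrib matrix_add_rdistrib kron_add)

lemma delta_scale: "delta (cmscale c x) = cmscale c (delta x)"
  by (simp add: delta_def cmscale_mult_left cmscale_mult_right kron_cmscale)

lemma delta_one: "delta (mat 1) = mat 1"
  by (simp add: delta_def kron_one)

end

lemma kron_row: "(kron A (mat 1) *v t) $ (i, k) = (A *v (\<chi> m. t $ (m, k))) $ i"
  by (simp add: kron_def matrix_vector_mult_def sum_UNIV_Times mat_def
     if_distrib[of "\<lambda>x. x * y" for y] if_distrib[of "\<lambda>x. y * x" for y] cong: if_cong)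

text \<open>The hypotheses say that Q x \<otimes> P \<eta> \<mapsto> u(Q x) P \<eta> is isometric,
  and the trace condition that its domain has dimension n. It is therefore onto, and the sum is its
  range projection.\<close>

lemma resolution:
  fixes u :: "complex^'n::finite \<Rightarrow> complex^'n^'n"
  assumes P: "P ** P = P" "cadj P = P" and Q: "Q ** Q = Q" "cadj Q = Q"
    and u: "\<And>x y. u (x + y) = u x + u y" "\<And>c x. u (c *s x) = cmscale c (u x)"
    and m: "\<And>x y. P ** (cadj (u (Q *v x)) ** u (Q *v y)) ** P = cmscale (cinner (Q *v x) (Q *v y)) P"
    and t: "trace P * trace Q = of_nat CARD('n)"
  shows "(\<Sum>k\<in>UNIV. u (Q *v ax k) ** (P ** cadj (u (Q *v ax k)))) = mat 1"
proof -
  let ?u = "\<lambda>k. u (Q *v ax k)"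
  define R where "R = (\<Sum>k\<in>UNIV. ?u k ** (P ** cadj (?u k)))"
  have us: "u (\<Sum>k\<in>I. h k) = (\<Sum>k\<in>I. u (h k))" for I :: "'n set" and h
    using u(1) u(2)[of 0 0] by (induction I rule: infinite_finite_induct) simp_all
  have q: "cinner (Q *v x) (Q *v y) = cinner x (Q *v y)" for x y
    using Q by (simp add: cinner_adj' matrix_vector_mul_assoc)
  have c: "(\<Sum>k\<in>UNIV. cmscale (cinner (Q *v ax k) (Q *v ax l)) (?u k)) = ?u l" for l
  proof -
    have "(\<Sum>k\<in>UNIV. cmscale (cinner (Q *v ax k) (Q *v ax l)) (?u k)) = u (Q *v (\<Sum>k\<in>UNIV. (Q *v ax l) $ k *s ax k))"
      by (simp add: mv_sum mv_scale us u q)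
    also have "\<dots> = u (Q *v (Q *v ax l))" by (simp flip: vec_expand)
    finally show ?thesis by (simp add: matrix_vector_mul_assoc Q)
  qed
  have "R ** R = (\<Sum>k\<in>UNIV. \<Sum>l\<in>UNIV. ?u k ** (P ** (cadj (?u k) ** ?u l) ** P) ** cadj (?u l))"
    by (simp add: R_def matrix_sum_mult matrix_mult_sum matrix_mul_assoc) (rule sum.swap)
  also have "\<dots> = (\<Sum>k\<in>UNIV. \<Sum>l\<in>UNIV. cmscale (cinner (Q *v ax k) (Q *v ax l)) (?u k) ** (P ** cadj (?u l)))"
    by (simp only: m) (simp add: cmscale_mult_left cmscale_mult_right matrix_mul_assoc)
  also have "\<dots> = (\<Sum>l\<in>UNIV. (\<Sum>k\<in>UNIV. cmscale (cinner (Q *v ax k) (Q *v ax l)) (?u k)) ** (P ** cadj (?u l)))"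
    by (subst sum.swap) (simp add: matrix_sum_mult)
  finally have RR: "R ** R = R" by (simp only: c R_def)
  have R: "cadj R = R"
    by (simp add: R_def cadj_sum cadj_mult P matrix_mul_assoc)
  have "trace (?u k ** (P ** cadj (?u k))) = cinner (ax k) (Q *v ax k) * trace P" for k
  proof -
    have "trace (?u k ** (P ** cadj (?u k))) = trace ((?u k ** P) ** (P ** cadj (?u k)))"
      using P(1) by (metis matrix_mul_assoc)
    also have "\<dots> = trace (P ** (cadj (?u k) ** ?u k) ** P)"
      by (subst trace_mul_sym) (simp add: matrix_mul_assoc)
    finally show ?thesis by (simp only: m trace_cmscale q)
  qed
  then have "trace R = trace Q * trace P"
    by (simp add: R_def trace_sum trace_eq_cinner[of Q] sum_distrib_right del: cinner_ax)
  then have tR: "trace R = of_nat CARD('n)" using t by (simp add: mult.commute)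
  have "mat 1 - R = 0"
  proof (rule projection_trace_0)
    show "(mat 1 - R) ** (mat 1 - R) = mat 1 - R"
    proof (rule mat_ext_mv)
      fix x
      have "R *v (R *v x) = R *v x" by (simp add: matrix_vector_mul_assoc RR)
      then show "((mat 1 - R) ** (mat 1 - R)) *v x = (mat 1 - R) *v x"
        by (simp add: matrix_vector_mult_diff_rdistrib matrix_vector_mult_diff_distrib flip: matrix_vector_mul_assoc)
    qed
    show "cadj (mat 1 - R) = mat 1 - R" by (simp add: cadj_diff R)
    show "trace (mat 1 - R) = 0" using tR by (simp add: trace_sub trace_I)
  qed
  then show ?thesis by (simp add: R_def)
qed

section \<open>The representation of the dual algebra on two legs\<close>

context munitary_U begin

definition gam :: "complex^'n^'n \<Rightarrow> complex^('n\<times>'n)^('n\<times>'n)" where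
  "gam c = V ** kron (mat 1) c ** cadj V"

lemma bet_gam: "bet y = gam (U ** y ** U)" by (simp add: bet_def gam_def)

lemma gam_cadj: "gam (cadj y) = cadj (gam y)"
  by (simp add: gam_def cadj_mult cadj_kron matrix_mul_assoc)

lemma delta_gam: "delta x ** gam y = gam y ** delta x"
  by (simp add: delta_def gam_def matrix_mul_assoc[symmetric])
     (simp add: matrix_mul_assoc kron_mult)

interpretation d: munitary_U "dualV V" e' e U by (rule dual_munitary_U)

text \<open>Moving 1 \<otimes> b through V yields the flipped dual coproduct, whose second leg stays
  in the dual algebra and so commutes with c.\<close>

lemma gam_dual_commute:
  assumes "c \<in> {U ** y ** U | y. y \<in> d.S}" "b \<in> d.S"
  shows "gam c ** kron (mat 1) b = kron (mat 1) b ** gam c"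
proof -
  define M where "M = swapm (d.delta b)"
  have M: "cadj V ** kron (mat 1) b ** V = M" by (simp add: M_def swapm_dual_delta)
  have "V ** (cadj V ** kron (mat 1) b ** V) = kron (mat 1) b ** V"
    "cadj V ** kron (mat 1) b ** V ** cadj V = cadj V ** kron (mat 1) b"
    by (simp_all flip: matrix_mul_assoc)
  then have 1: "kron (mat 1) b ** V = V ** M" "cadj V ** kron (mat 1) b = M ** cadj V"
    unfolding M by simp_all
  have "M ** kron (mat 1) c = kron (mat 1) c ** M"
    unfolding kron_commute2 M_def blk_swapm using assms d.delta_blk(2)[OF assms(2)] d.U_commute by auto
  then have "V ** kron (mat 1) c ** M = V ** M ** kron (mat 1) c"
    by (simp flip: matrix_mul_assoc)
  then have "V ** kron (mat 1) c ** (cadj V ** kron (mat 1) b) = kron (mat 1) b ** V ** kron (mat 1) c ** cadj V"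
    unfolding 1 by (simp add: matrix_mul_assoc)
  then show ?thesis
    unfolding gam_def by (simp add: matrix_mul_assoc)
qed

lemma blk2_gam: "blk2 (gam c) k l \<in> d.S"
proof -
  have "blk2 (cadj V) i j \<in> d.S" for i j
    using d.S_cadj[OF blk2_dual_S] by (simp add: blk_cadj)
  moreover have "blk2 (V ** kron (mat 1) c) i j \<in> d.S" for i j
    by (simp add: blk_mult blk_kron cmscale_mult_right csub_sum csub_scale d.csub_S blk2_dual_S)
  ultimately show ?thesis
    unfolding gam_def blk_mult(2)[of "_ ** _" "cadj V"] by (intro csub_sum d.csub_S d.S_mult)
qed

lemma bet_mv_e': "bet y *v tens a e' = V *v tens a (U *v (y *v e'))"
  by (simp add: bet_def V_e' kron_tens U_e' flip: matrix_vector_mul_assoc)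

lemma bet_dual_commute: "y \<in> d.S \<Longrightarrow> b \<in> d.S \<Longrightarrow> bet y ** kron (mat 1) b = kron (mat 1) b ** bet y"
  unfolding bet_gam by (rule gam_dual_commute) auto

text \<open>Since \<open>bet y\<close> commutes with the dual algebra on the second leg, and e' is
  cyclic for that algebra, the values on vectors a \<otimes> e' determine everything.\<close>

lemma bet_mv: assumes "y \<in> d.S" shows "bet y *v tens a \<theta> = kron (mat 1) (d.lam \<theta>) *v (bet y *v tens a e')"
proof -
  have "bet y *v (kron (mat 1) (d.lam \<theta>) *v tens a e') = kron (mat 1) (d.lam \<theta>) *v (bet y *v tens a e')"
    using bet_dual_commute[OF assms, of "d.lam \<theta>"] by (simp add: matrix_vector_mul_assoc)
  then show ?thesis by (simp add: kron_tens)
qed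

text \<open>On H_g \<otimes> e' this holds because V fixes H_g \<otimes> H^g pointwise
  (\<open>V_down_up\<close>) and U y e' lies in H^g. The dual algebra on the second leg carries it
  to all vectors.\<close>

lemma bet_ph:
  assumes "psub g" "y \<in> d.D g"
  shows "bet y ** kron (ph g) (mat 1) = kron (ph g) (U ** y ** U)"
proof (rule mat_ext_tens)
  fix a \<theta>
  have yS: "y \<in> d.S" using assms(2) by (rule d.D_S)
  have dg: "d.psub g" using assms(1) by (simp add: psub_dual)
  have y: "p g *v (U *v (y *v e')) = U *v (y *v e')"
    using assms by (simp add: d.D_def p_dual)
  have "bet y *v tens (ph g *v a) \<theta> = kron (mat 1) (d.lam \<theta>) *v (V *v tens (ph g *v a) (U *v (y *v e')))"
    by (subst bet_mv[OF yS]) (simp only: bet_mv_e')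
  also have "V *v tens (ph g *v a) (U *v (y *v e')) = tens (ph g *v a) (U *v (y *v e'))"
    by (rule V_down_up[OF assms(1) _ y]) (simp add: ph_idem_mv assms(1))
  also have "kron (mat 1) (d.lam \<theta>) *v tens (ph g *v a) (U *v (y *v e')) =
      tens (ph g *v a) ((d.lam \<theta> ** (U ** y ** U)) *v e')"
    by (simp add: kron_tens U_e' flip: matrix_vector_mul_assoc)
  also have "d.lam \<theta> ** (U ** y ** U) = (U ** y ** U) ** d.lam \<theta>"
    by (rule d.U_commute[symmetric]) (simp_all add: yS)
  also have "tens (ph g *v a) ((U ** y ** U ** d.lam \<theta>) *v e') = kron (ph g) (U ** y ** U) *v tens a \<theta>"
    by (simp add: kron_tens flip: matrix_vector_mul_assoc)
  finally show "(bet y ** kron (ph g) (mat 1)) *v tens a \<theta> = kron (ph g) (U ** y ** U) *v tens a \<theta>"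
    by (simp add: kron_tens flip: matrix_vector_mul_assoc)
qed

text \<open>Applying U to the first leg replaces V by its adjoint on e' \<otimes> \<eta>, and the
  result is the flipped dual coproduct of \<open>d.lam \<eta>\<close> at e' \<otimes> e'. By
  \<open>delta_ph_mv\<close> for the dual, its first leg lies in H^g.\<close>

lemma bet_blk2_D:
  assumes "psub g" "y \<in> d.D g" shows "blk2 (bet y) k l \<in> d.D g"
proof -
  have yS: "y \<in> d.S" using assms(2) by (rule d.D_S)
  have dg: "d.psub g" using assms(1) by (simp add: psub_dual)
  define \<eta> where "\<eta> = U *v (y *v e')"
  have \<eta>: "p g *v \<eta> = \<eta>"
    using assms by (simp add: d.D_def p_dual \<eta>_def)
  define w where "w = d.lam \<eta>"
  have w: "w \<in> d.G g" by (simp add: w_def d.G_def p_dual assms(1) \<eta>)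
  have "d.delta w *v tens e' e' = swapv (cadj V *v tens e' \<eta>)"
    by (simp add: d_delta V_e' kron_tens w_def)
  then have "kron (mat 1) (p g) *v swapv (cadj V *v tens e' \<eta>) = swapv (cadj V *v tens e' \<eta>)"
    using d.delta_ph_mv[OF dg w, of e'] by (simp add: p_dual assms(1))
  then have 1: "kron (p g) (mat 1) *v (cadj V *v tens e' \<eta>) = cadj V *v tens e' \<eta>"
    by (simp add: kron_swapv swapv_eq_iff)
  have 2: "kron (p g) (mat 1) *v (kron U (mat 1) *v (bet y *v tens e' e')) = kron U (mat 1) *v (bet y *v tens e' e')"
    by (simp add: bet_mv_e' U_V_e' 1 flip: \<eta>_def)
  have 3: "kron (p g) (mat 1) *v (kron U (mat 1) *v (bet y *v tens e' \<theta>)) = kron U (mat 1) *v (bet y *v tens e' \<theta>)" for \<theta>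
  proof -
    have c: "kron A (mat 1) *v (kron (mat 1) B *v t) = kron (mat 1) B *v (kron A (mat 1) *v t)" for A B :: "complex^'n^'n" and t
      by (simp add: matrix_vector_mul_assoc kron_mult)
    show ?thesis by (simp only: bet_mv[OF yS, of e' \<theta>] c 2)
  qed
  let ?z = "blk2 (bet y) k l"
  have z: "?z *v e' = (\<chi> m. (bet y *v tens e' (ax l)) $ (m, k))"
    by (simp add: vec_eq_iff blk2_mv)
  have "(p g *v (U *v (?z *v e'))) $ i = (U *v (?z *v e')) $ i" for i
    unfolding z using arg_cong[OF 3[of "ax l"], of "\<lambda>t. t $ (i, k)"]
    by (simp add: kron_row)
  then have "p g *v (U *v (?z *v e')) = U *v (?z *v e')" by (simp add: vec_eq_iff)
  then show ?thesis by (simp add: d.D_def p_dual assms(1) bet_gam blk2_gam)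
qed

text \<open>The coefficient z commutes with the dual algebra, hence is determined by z e'. The
  vector U z e' arises from y e' by an operator of U S U, which commutes with \<open>p f\<close> and
  so keeps it in H^f.\<close>

lemma bet_blk1_G:
  assumes "psub f" "y \<in> d.G f" shows "\<exists>w\<in>d.G f. blk1 (bet y) i j = U ** w ** U"
proof -
  have yS: "y \<in> d.S" using assms(2) by (rule d.G_S)
  have df: "d.psub f" using assms(1) by (simp add: psub_dual)
  have y: "p f *v (y *v e') = y *v e'" using assms by (simp add: d.G_def p_dual)
  define z where "z = blk1 (bet y) i j"
  define w where "w = d.lam (U *v (z *v e'))"
  have "z *v e' = blk1 V i j *v (U *v (y *v e'))"
    by (simp add: z_def vec_eq_iff bet_mv_e' flip: blk1_mv)
  then have "U *v (z *v e') = (U ** blk1 V i j ** U) *v (p f *v (y *v e'))"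
    by (simp add: y flip: matrix_vector_mul_assoc)
  also have "\<dots> = p f *v ((U ** blk1 V i j ** U) *v (y *v e'))"
    using arg_cong[OF U_commute[of "blk1 V i j" "p f"], of "\<lambda>A. A *v (y *v e')"]
    by (simp flip: matrix_vector_mul_assoc)
  finally have "p f *v (U *v (z *v e')) = U *v (z *v e')"
    using p_idem_mv[OF assms(1)] by simp
  then have w: "w \<in> d.G f" by (simp add: w_def d.G_def p_dual assms(1))
  have "z = U ** w ** U"
  proof (rule mat_ext_mv)
    fix \<xi>
    have "\<forall>k l. blk1 (bet y) k l ** d.lam \<xi> = d.lam \<xi> ** blk1 (bet y) k l"
      unfolding kron_commute2[symmetric] by (rule bet_dual_commute[OF yS d.lam_S])
    then have "z *v (d.lam \<xi> *v e') = d.lam \<xi> *v (z *v e')"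
      unfolding matrix_vector_mul_assoc z_def by simp
    also have "z *v e' = (U ** w ** U) *v e'"
      by (simp add: w_def U_e' flip: matrix_vector_mul_assoc)
    also have "d.lam \<xi> *v \<dots> = (U ** w ** U) *v (d.lam \<xi> *v e')"
      using d.U_commute[OF d.G_S[OF w] d.lam_S] unfolding matrix_vector_mul_assoc by simp
    finally show "z *v \<xi> = (U ** w ** U) *v \<xi>" by simp
  qed
  then show ?thesis using w by (intro bexI[of _ w]) (simp_all flip: z_def)
qed

text \<open>On \<xi> \<otimes> e the operator U on the second leg exchanges V with its adjoint,
  which reduces the claim to the counit property of the dual coproduct.\<close>

lemma bet_mv_e: assumes "y \<in> d.S" shows "bet y *v tens \<xi> e = tens (y *v \<xi>) e"
proof -
  have UU1: "kron (mat 1) U *v (kron (mat 1) U *v t) = t" for t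
    by (simp add: matrix_vector_mul_assoc kron_mult kron_one)
  have "d.delta y *v tens e \<xi> = tens e (y *v \<xi>)" by (rule d.delta_e'[OF assms])
  then have "cadj V *v (kron (mat 1) y *v (V *v tens \<xi> e)) = tens (y *v \<xi>) e"
    unfolding d_delta by (metis swapv_tens swapv_swapv)
  then have 1: "kron (mat 1) y *v (V *v tens \<xi> e) = V *v tens (y *v \<xi>) e" by (metis VV_mv(1))
  have 2: "kron (mat 1) U *v (cadj V *v tens \<xi> e) = V *v tens \<xi> e" for \<xi>
    by (metis U_V_e UU1)
  have "bet y = V ** (kron (mat 1) U ** (kron (mat 1) y ** (kron (mat 1) U ** cadj V)))"
    by (simp add: bet_def matrix_mul_assoc[symmetric]) (simp add: matrix_mul_assoc kron_mult)
  then show ?thesis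
    by (simp add: 1 2 U_V_e flip: matrix_vector_mul_assoc)
qed

lemma bet_Uph:
  assumes "psub f" "y \<in> d.G f"
  shows "bet y ** kron (mat 1) (U ** ph f ** U) = kron y (U ** ph f ** U)"
proof (rule blk_ext1)
  fix i j
  have df: "d.psub f" using assms(1) by (simp add: psub_dual)
  obtain w where w: "w \<in> d.G f" "blk1 (bet y) i j = U ** w ** U" using bet_blk1_G[OF assms] by blast
  obtain k where k: "e $ k \<noteq> 0" using norm_e by (metis norm_zero vec_eq_iff zero_index zero_neq_one)
  have "U *v (w *v (U *v e)) = d.counit w *s e"
    by (simp add: U_e d.S_mv_e'[OF d.G_S[OF w(1)]] mv_scale)
  moreover have "(blk1 (bet y) i j *v e) $ k = y $ i $ j * e $ k"
    unfolding blk1_mv[symmetric] bet_mv_e[OF d.G_S[OF assms(2)]]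
    by (simp add: matrix_vector_mult_def ax_nth if_distrib cong: if_cong)
  ultimately have counit: "d.counit w = y $ i $ j"
    using k by (simp add: w(2) flip: matrix_vector_mul_assoc)
  have "w ** ph f = cmscale (d.counit w) (ph f)"
    using d.G_p(1)[OF df w(1)] by (simp add: ph_dual assms(1))
  moreover have "(U ** w ** U) ** (U ** ph f ** U) = U ** (w ** ph f) ** U"
    by (simp flip: matrix_mul_assoc)
  ultimately have "(U ** w ** U) ** (U ** ph f ** U) = cmscale (y $ i $ j) (U ** ph f ** U)"
    by (simp add: counit cmscale_mult_left cmscale_mult_right)
  then show "blk1 (bet y ** kron (mat 1) (U ** ph f ** U)) i j = blk1 (kron y (U ** ph f ** U)) i j"
    by (simp add: blk_mult_kron1 w(2) blk_kron)
qed

end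

subsection \<open>Complementary pairs of pre-subgroups\<close>

text \<open>What the construction extracts from the value of \<langle>f,g\<rangle>: rank one
  products, and ranks that multiply to n. Each condition appears twice because duality exchanges
  \<open>p\<close> with \<open>ph\<close>.\<close>

locale complementary_pair = munitary_U V e e' U for V :: "complex^('n::finite \<times> 'n)^('n \<times> 'n)" and e e' U +
  fixes f g :: "complex^'n"
  assumes psub_f: "psub f" and psub_g: "psub g"
    and pp: "p f ** p g = ketbra e' e'" and phph: "ph f ** ph g = ketbra e e"
    and tr_p: "trace (p f) * trace (p g) = of_nat CARD('n)"
    and tr_ph: "trace (ph f) * trace (ph g) = of_nat CARD('n)"
begin

lemma dual_complementary_pair: "complementary_pair (dualV V) e' e U f g"
proof -
  interpret d: munitary_U "dualV V" e' e U by (rule dual_munitary_U)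
  show ?thesis
    by unfold_locales (simp_all add: psub_dual psub_f psub_g ph_dual p_dual pp phph tr_p tr_ph)
qed

lemma phph': "ph g ** ph f = ketbra e e"
  using arg_cong[OF phph, of cadj] by (simp add: cadj_mult ph_selfadjoint psub_f psub_g cadj_ketbra)

abbreviation "xk k \<equiv> lam (ph f *v ax k)"

lemma xk_G: "lam (ph f *v \<eta>) \<in> G f" by (rule lam_G[OF psub_f])

lemma lam_e: "lam e = mat 1"
  by (rule S_eqI) simp_all

text \<open>Compressing by \<open>ph g\<close> slices the coproduct by the state of g and so
  projects x onto \<open>G g\<close>. On \<open>G f\<close> the rank one product leaves only a
  multiple of the identity. This is the orthogonality relation that \<open>resolution\<close> asks
  for.\<close>

lemma G_tau: assumes "x \<in> G f" shows "ph g ** x ** ph g = cmscale (cinner e (x *v e)) (ph g)"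
proof (rule mat_ext_cinner)
  fix a b
  have x: "x \<in> S" "ph f *v (x *v e) = x *v e" using assms by (simp_all add: G_def)
  define \<zeta> where "\<zeta> = ph g *v b"
  have \<zeta>: "V *v tens \<zeta> g = tens \<zeta> g" by (metis \<zeta>_def ph_fix_iff ph_idem_mv psub_g)
  have "ph g *v (x *v e) = (ph g ** ph f) *v (x *v e)" using x by (simp flip: matrix_vector_mul_assoc)
  then have 1: "lam (ph g *v (x *v e)) = cmscale (cinner e (x *v e)) (mat 1)"
    by (simp add: phph' ketbra_mv lam_scale lam_e)
  have "cinner a (ph g *v (x *v \<zeta>)) = cinner (tens a g) (delta x *v tens \<zeta> g)"
    by (simp add: cinner_Rsl V_delta \<zeta>)
  then show "cinner a ((ph g ** x ** ph g) *v b) = cinner a (cmscale (cinner e (x *v e)) (ph g) *v b)"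
    by (simp add: cinner_delta_ph[OF x(1)] 1 cmscale_mv \<zeta>_def flip: matrix_vector_mul_assoc)
qed

lemma cadj_lam_tau: "ph g ** (cadj (lam (ph f *v x)) ** lam (ph f *v y)) ** ph g = cmscale (cinner (ph f *v x) (ph f *v y)) (ph g)"
  using G_tau[OF G_mult[OF psub_f G_cadj[OF psub_f xk_G[of x]] xk_G[of y]]]
  by (simp add: cinner_adj flip: matrix_vector_mul_assoc)

lemma ores: "(\<Sum>k\<in>UNIV. xk k ** (ph g ** cadj (xk k))) = mat 1"
  by (rule resolution) (simp_all add: ph_idem ph_selfadjoint psub_f psub_g lam_add lam_scale cadj_lam_tau tr_ph mult.commute[of "trace (ph g)"])

lemma ores_kron: "(\<Sum>k\<in>UNIV. kron (xk k ** (ph g ** cadj (xk k))) A) = kron (mat 1) A"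
  by (simp add: ores flip: kron_sum)

text \<open>\<open>ores\<close> writes U \<xi> as a sum of elements of \<open>G f\<close> applied to
  vectors of H_g. Each of these vectors is U d U e with d in \<open>D g\<close>, and U d U commutes
  with \<open>G f\<close>, so operator and vector exchange roles.\<close>

lemma span_D: "\<exists>d. (\<forall>k. d k \<in> D g) \<and> \<xi> = (\<Sum>k\<in>UNIV. d k *v (U *v (ph f *v ax k)))"
proof -
  define \<zeta> where "\<zeta> k = ph g *v (cadj (xk k) *v (U *v \<xi>))" for k
  define d where "d k = lam (U *v \<zeta> k)" for k
  have d: "d k \<in> D g" for k by (simp add: d_def \<zeta>_def lam_D psub_g)
  have "U *v \<xi> = (\<Sum>k\<in>UNIV. xk k *v \<zeta> k)"
    using arg_cong[OF ores, of "\<lambda>A. A *v (U *v \<xi>)"] by (simp add: sum_mv \<zeta>_def flip: matrix_vector_mul_assoc)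
  also have "\<dots> = (\<Sum>k\<in>UNIV. U *v (d k *v (U *v (ph f *v ax k))))"
  proof (rule sum.cong[OF refl])
    fix k
    have "xk k *v \<zeta> k = (xk k ** (U ** d k ** U)) *v e"
      by (simp add: d_def U_e flip: matrix_vector_mul_assoc)
    also have "\<dots> = ((U ** d k ** U) ** xk k) *v e"
      using U_commute[OF D_S[OF d], of "xk k" k] by simp
    also have "\<dots> = U *v (d k *v (U *v (ph f *v ax k)))" by (simp flip: matrix_vector_mul_assoc)
    finally show "xk k *v \<zeta> k = U *v (d k *v (U *v (ph f *v ax k)))" .
  qed
  finally have "U *v (U *v \<xi>) = U *v (U *v (\<Sum>k\<in>UNIV. d k *v (U *v (ph f *v ax k))))"
    by (simp add: mv_sum)
  then show ?thesis using d by auto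
qed

end

text \<open>The common pattern of \<open>X\<close> and \<open>Y\<^sup>*\<close>: the first is obtained with \<open>\<beta> = \<delta>\<close>, the second from
  the dual with \<open>\<beta>(y) = V(1 \<otimes> UyU)V\<^sup>*\<close>. The second family \<open>\<Gamma>\<close> serves to prove unitarity and to
  locate the first leg.\<close>
locale pair_representation = complementary_pair V e e' U f g for V :: "complex^('n::finite \<times> 'n)^('n \<times> 'n)" and e e' U f g +
  fixes \<beta> \<Gamma> :: "complex^'n^'n \<Rightarrow> complex^('n \<times> 'n)^('n \<times> 'n)" and Dset :: "(complex^'n^'n) set" and R :: "complex^'n^'n"
  assumes \<beta>_add: "\<beta> (x + y) = \<beta> x + \<beta> y" and \<beta>_scale: "\<beta> (cmscale s x) = cmscale s (\<beta> x)"
    and \<beta>_mult: "\<beta> (x ** y) = \<beta> x ** \<beta> y" and \<beta>_cadj: "\<beta> (cadj x) = cadj (\<beta> x)" and \<beta>_one: "\<beta> (mat 1) = mat 1"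
    and \<Gamma>_commute: "\<beta> x ** \<Gamma> c = \<Gamma> c ** \<beta> x"
    and \<Gamma>_ph: "c \<in> Dset \<Longrightarrow> \<Gamma> c ** kron (ph g) (mat 1) = kron (ph g) c"
    and \<Gamma>_cadj: "\<Gamma> (cadj c) = cadj (\<Gamma> c)" and Dset_cadj: "c \<in> Dset \<Longrightarrow> cadj c \<in> Dset"
    and \<beta>_R: "x \<in> G f \<Longrightarrow> \<beta> x ** kron (mat 1) R = kron x R"
    and span: "\<exists>d w. (\<forall>k. d k \<in> Dset) \<and> \<xi> = (\<Sum>k\<in>(UNIV::'n set). d k *v (R *v w k))"
begin

text \<open>The map x \<zeta> \<otimes> \<eta> \<mapsto> \<beta>(x)(\<zeta> \<otimes> \<eta>),
  written through the resolution \<open>ores\<close> so that well-definedness is not an issue;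
  \<open>ext_G0\<close> recovers the rule.\<close>

definition ext :: "complex^('n \<times> 'n)^('n \<times> 'n)" where
  "ext = (\<Sum>k\<in>UNIV. \<beta> (xk k) ** kron (ph g ** cadj (xk k)) (mat 1))"

lemma \<beta>_sum: "\<beta> (\<Sum>k\<in>I. h k) = (\<Sum>k\<in>I. \<beta> (h k))"
proof -
  have "\<beta> 0 = 0" using \<beta>_scale[of 0 0] by simp
  then show ?thesis by (induction I rule: infinite_finite_induct) (simp_all add: \<beta>_add)
qed

lemma ext_G0: assumes "x \<in> G f" shows "ext ** kron (x ** ph g) (mat 1) = \<beta> x ** kron (ph g) (mat 1)"
proof -
  define v where "v = x *v e"
  have v: "x = lam (ph f *v v)" "ph f *v v = v"
    using assms by (simp_all add: v_def G_def flip: S_iff)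
  have "ext ** kron (x ** ph g) (mat 1) = (\<Sum>k\<in>UNIV. \<beta> (xk k) ** kron (ph g ** (cadj (xk k) ** x) ** ph g) (mat 1))"
    by (simp add: ext_def matrix_sum_mult kron_mult flip: matrix_mul_assoc)
  also have "\<dots> = (\<Sum>k\<in>UNIV. cmscale (cinner (ph f *v ax k) (ph f *v v)) (\<beta> (xk k)) ** kron (ph g) (mat 1))"
    by (subst (1) v(1)) (simp add: cadj_lam_tau kron_cmscale cmscale_mult_left cmscale_mult_right)
  also have "\<dots> = \<beta> (\<Sum>k\<in>UNIV. cmscale (cinner (ph f *v ax k) (ph f *v v)) (xk k)) ** kron (ph g) (mat 1)"
    by (simp add: \<beta>_sum \<beta>_scale matrix_sum_mult)
  also have "(\<Sum>k\<in>UNIV. cmscale (cinner (ph f *v ax k) (ph f *v v)) (xk k)) = lam (ph f *v (\<Sum>k\<in>UNIV. v $ k *s ax k))"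
  proof -
    have "cinner (ph f *v ax k) (ph f *v v) = v $ k" for k
      using v(2) by (simp add: cinner_adj'[of "ph f"] ph_selfadjoint psub_f)
    moreover have "lam (\<Sum>k\<in>I. h k) = (\<Sum>k\<in>I. lam (h k))" for I :: "'n set" and h
      by (induction I rule: infinite_finite_induct) (simp_all add: lam_add)
    ultimately show ?thesis by (simp add: mv_sum mv_scale lam_scale)
  qed
  also have "\<dots> = x" by (simp add: v(1) flip: vec_expand)
  finally show ?thesis .
qed

lemma ext_resolve: "T = (\<Sum>k\<in>UNIV. T ** kron (xk k ** ph g) (mat 1) ** kron (cadj (xk k)) (mat 1))"
proof -
  have "T ** (\<Sum>k\<in>UNIV. kron (xk k ** (ph g ** cadj (xk k))) (mat 1)) = T"
    by (simp add: ores_kron kron_one)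
  then show ?thesis by (simp add: matrix_mult_sum kron_mult flip: matrix_mul_assoc)
qed

lemma ext_eqI: "(\<And>x. x \<in> G f \<Longrightarrow> T ** kron (x ** ph g) (mat 1) = T' ** kron (x ** ph g) (mat 1)) \<Longrightarrow> T = T'"
  by (subst ext_resolve[of T], subst ext_resolve[of T']) (simp add: xk_G)

lemma ext_commute: assumes "x \<in> G f" shows "ext ** kron x (mat 1) = \<beta> x ** ext"
proof (rule ext_eqI)
  fix y assume y: "y \<in> G f"
  have "ext ** kron x (mat 1) ** kron (y ** ph g) (mat 1) = ext ** kron ((x ** y) ** ph g) (mat 1)"
    by (simp add: kron_mult flip: matrix_mul_assoc)
  also have "\<dots> = \<beta> x ** (\<beta> y ** kron (ph g) (mat 1))"
    by (simp add: ext_G0 G_mult psub_f assms y \<beta>_mult matrix_mul_assoc)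
  also have "\<dots> = \<beta> x ** ext ** kron (y ** ph g) (mat 1)"
    by (simp add: ext_G0[OF y, symmetric] matrix_mul_assoc)
  finally show "ext ** kron x (mat 1) ** kron (y ** ph g) (mat 1) = \<beta> x ** ext ** kron (y ** ph g) (mat 1)" .
qed

lemma ext_ph: "ext ** kron (ph g) (mat 1) = kron (ph g) (mat 1)"
  using ext_G0[OF one_G[OF psub_f]] by (simp add: \<beta>_one)

lemma ext_\<Gamma>: assumes "c \<in> Dset" shows "ext ** kron (mat 1) c = \<Gamma> c ** ext"
proof (rule ext_eqI)
  fix x assume x: "x \<in> G f"
  have "ext ** kron (mat 1) c ** kron (x ** ph g) (mat 1) = ext ** kron (x ** ph g) (mat 1) ** kron (mat 1) c"
    by (simp add: kron_mult flip: matrix_mul_assoc)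
  also have "\<dots> = \<beta> x ** kron (ph g) c"
    by (simp add: ext_G0[OF x] kron_mult flip: matrix_mul_assoc)
  also have "\<dots> = \<Gamma> c ** (\<beta> x ** kron (ph g) (mat 1))"
    by (simp add: \<Gamma>_ph[OF assms, symmetric] matrix_mul_assoc \<Gamma>_commute)
  also have "\<dots> = \<Gamma> c ** ext ** kron (x ** ph g) (mat 1)"
    by (simp add: ext_G0[OF x, symmetric] matrix_mul_assoc)
  finally show "ext ** kron (mat 1) c ** kron (x ** ph g) (mat 1) = \<Gamma> c ** ext ** kron (x ** ph g) (mat 1)" .
qed

lemma ext_R: "ext ** kron (mat 1) R = kron (mat 1) R"
proof -
  have "ext ** kron (mat 1) R = (\<Sum>k\<in>UNIV. \<beta> (xk k) ** kron (mat 1) R ** kron (ph g ** cadj (xk k)) (mat 1))"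
    by (simp add: ext_def matrix_sum_mult kron_mult flip: matrix_mul_assoc)
  then show ?thesis by (simp add: \<beta>_R xk_G kron_mult ores_kron)
qed

lemma ext_blk1:
  assumes "csub T" "\<And>x i j. x \<in> G f \<Longrightarrow> blk1 (\<beta> x) i j \<in> T"
  shows "blk1 ext i j \<in> T"
  by (simp add: ext_def blk_sum blk_mult blk_kron cmscale_mult_right)
     (intro csub_sum csub_scale assms xk_G)

lemma ext_\<Gamma>R: "c \<in> Dset \<Longrightarrow> ext *v tens a (c *v (R *v w)) = \<Gamma> c *v tens a (R *v w)"
proof -
  assume c: "c \<in> Dset"
  have R: "ext *v tens a (R *v w) = tens a (R *v w)"
    using arg_cong[OF ext_R, of "\<lambda>A. A *v tens a w"] by (simp add: kron_tens flip: matrix_vector_mul_assoc)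
  show ?thesis
    using arg_cong[OF ext_\<Gamma>[OF c], of "\<lambda>A. A *v tens a (R *v w)"]
    by (simp add: kron_tens R flip: matrix_vector_mul_assoc)
qed

text \<open>The vectors c R w span H, and \<open>ext\<close> acts on a \<otimes> c R w as
  \<Gamma>(c) does on a \<otimes> R w. So the first leg is read from \<Gamma>, as
  \<open>ext_blk1\<close> reads the second from \<beta>.\<close>

lemma ext_blk2:
  assumes "csub T" "\<And>c i j. c \<in> Dset \<Longrightarrow> blk2 (\<Gamma> c) i j \<in> T"
  shows "blk2 ext k l \<in> T"
proof -
  obtain d w where d: "\<And>k. d k \<in> Dset" and ax: "ax l = (\<Sum>k\<in>(UNIV::'n set). d k *v (R *v w k))"
    using span[of "ax l"] by blast
  have "blk2 ext k l = (\<Sum>m\<in>(UNIV::'n set). \<Sum>r\<in>UNIV. cmscale ((R *v w m) $ r) (blk2 (\<Gamma> (d m)) k r))"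
  proof (rule mat_ext_mv)
    fix a
    have t: "(T *v tens a \<xi>) $ (i, k) = (\<Sum>r\<in>UNIV. \<xi> $ r * (blk2 T k r *v a) $ i)" for T :: "complex^('n \<times> 'n)^('n \<times> 'n)" and \<xi> i
    proof -
      have "(T *v tens a (\<Sum>r\<in>UNIV. \<xi> $ r *s ax r)) $ (i, k) = (\<Sum>r\<in>UNIV. \<xi> $ r * (blk2 T k r *v a) $ i)"
        by (simp add: tens_sum tens_scale mv_sum mv_scale blk2_mv)
      then show ?thesis using vec_expand[of \<xi>] by simp
    qed
    have "(blk2 ext k l *v a) $ i = (\<Sum>m\<in>(UNIV::'n set). (\<Gamma> (d m) *v tens a (R *v w m)) $ (i, k))" for i
      unfolding blk2_mv[symmetric] ax by (simp add: tens_sum mv_sum ext_\<Gamma>R d)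
    then show "blk2 ext k l *v a = (\<Sum>m\<in>(UNIV::'n set). \<Sum>r\<in>UNIV. cmscale ((R *v w m) $ r) (blk2 (\<Gamma> (d m)) k r)) *v a"
      by (simp add: vec_eq_iff sum_mv cmscale_mv t)
  qed
  then show ?thesis by (simp add: csub_sum csub_scale assms d)
qed

text \<open>The adjoint is computed on \<Gamma>(c)(a \<otimes> R w), the image of the spanning
  vector a \<otimes> c R w, and returns that vector. Finite dimension gives the other
  identity.\<close>

lemma ext_unitary: "cadj ext ** ext = mat 1" "ext ** cadj ext = mat 1"
proof -
  have 1: "kron (ph g ** cadj x) (mat 1) ** cadj ext = kron (ph g) (mat 1) ** \<beta> (cadj x)" if "x \<in> G f" for x
    using arg_cong[OF ext_G0[OF that], of cadj]
    by (simp add: cadj_mult cadj_kron ph_selfadjoint psub_g \<beta>_cadj)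
  have 2: "kron (ph g) (mat 1) ** \<Gamma> c = kron (ph g) c" if "c \<in> Dset" for c
    using arg_cong[OF \<Gamma>_ph[OF Dset_cadj[OF that]], of cadj]
    by (simp add: cadj_mult cadj_kron ph_selfadjoint psub_g \<Gamma>_cadj)
  have 3: "cadj ext ** \<Gamma> c ** kron (mat 1) R = kron (mat 1) (c ** R)" if c: "c \<in> Dset" for c
  proof -
    have "cadj ext = (\<Sum>k\<in>UNIV. kron (xk k ** (ph g ** cadj (xk k))) (mat 1)) ** cadj ext"
      by (simp add: ores_kron kron_one)
    also have "\<dots> = (\<Sum>k\<in>UNIV. kron (xk k) (mat 1) ** (kron (ph g ** cadj (xk k)) (mat 1) ** cadj ext))"
      by (simp add: matrix_sum_mult matrix_mul_assoc kron_mult)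
    finally have e: "cadj ext = (\<Sum>k\<in>UNIV. kron (xk k) (mat 1) ** (kron (ph g) (mat 1) ** \<beta> (cadj (xk k))))"
      by (simp add: 1 xk_G)
    have "kron (ph g) (mat 1) ** \<beta> (cadj (xk k)) ** \<Gamma> c ** kron (mat 1) R = kron (ph g ** cadj (xk k)) (c ** R)" for k
    proof -
      have "kron (ph g) (mat 1) ** \<beta> (cadj (xk k)) ** \<Gamma> c ** kron (mat 1) R =
        (kron (ph g) (mat 1) ** \<Gamma> c) ** (\<beta> (cadj (xk k)) ** kron (mat 1) R)"
        by (simp only: \<Gamma>_commute flip: matrix_mul_assoc)
      then show ?thesis by (simp add: 2[OF c] \<beta>_R G_cadj psub_f xk_G kron_mult)
    qed
    then have "cadj ext ** \<Gamma> c ** kron (mat 1) R = (\<Sum>k\<in>UNIV. kron (xk k) (mat 1) ** kron (ph g ** cadj (xk k)) (c ** R))"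
      unfolding e by (simp add: matrix_sum_mult flip: matrix_mul_assoc)
    then show ?thesis by (simp add: kron_mult ores_kron)
  qed
  show "cadj ext ** ext = mat 1"
  proof (rule mat_ext_tens)
    fix a \<xi>
    obtain d w where d: "\<And>k. d k \<in> Dset" and \<xi>: "\<xi> = (\<Sum>k\<in>(UNIV::'n set). d k *v (R *v w k))"
      using span[of \<xi>] by blast
    have "cadj ext *v (\<Gamma> (d k) *v tens a (R *v w k)) = tens a (d k *v (R *v w k))" for k
      using arg_cong[OF 3[OF d], of "\<lambda>A. A *v tens a (w k)" k] by (simp add: kron_tens flip: matrix_vector_mul_assoc)
    then show "(cadj ext ** ext) *v tens a \<xi> = mat 1 *v tens a \<xi>"
      unfolding \<xi> by (simp add: tens_sum mv_sum ext_\<Gamma>R d flip: matrix_vector_mul_assoc)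
  qed
  then show "ext ** cadj ext = mat 1" by (simp add: matrix_left_right_inverse)
qed

end

subsection \<open>Operators on three legs\<close>

text \<open>\<open>tblk1\<close> and \<open>tblk3\<close> take coefficients in the first or last of
  three legs, so that identities between legs become identities of operators on H \<otimes>
  H.\<close>

definition tblk1 :: "complex^('n::finite \<times> 'n \<times> 'n)^('n \<times> 'n \<times> 'n) \<Rightarrow> 'n \<Rightarrow> 'n \<Rightarrow> complex^('n \<times> 'n)^('n \<times> 'n)" where
  "tblk1 M i j = (\<chi> p q. M $ (i, p) $ (j, q))"

definition tblk3 :: "complex^('n::finite \<times> 'n \<times> 'n)^('n \<times> 'n \<times> 'n) \<Rightarrow> 'n \<Rightarrow> 'n \<Rightarrow> complex^('n \<times> 'n)^('n \<times> 'n)" where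
  "tblk3 M k l = (\<chi> p q. M $ (fst p, snd p, k) $ (fst q, snd q, l))"

lemma tblk1_ext: "(\<And>i j. tblk1 A i j = tblk1 B i j) \<Longrightarrow> A = B"
  by (simp add: tblk1_def vec_eq_iff)

lemma tblk3_ext: "(\<And>i j. tblk3 A i j = tblk3 B i j) \<Longrightarrow> A = B"
  by (simp add: tblk3_def vec_eq_iff)

lemma tblk1_mult: "tblk1 (A ** B) i j = (\<Sum>m\<in>UNIV. tblk1 A i m ** tblk1 B m j)"
  by (simp add: vec_eq_iff tblk1_def matrix_matrix_mult_def sum_UNIV_Times[where 'a='a])

lemma tblk3_mult: "tblk3 (A ** B) i j = (\<Sum>m\<in>UNIV. tblk3 A i m ** tblk3 B m j)"
proof -
  have "(\<Sum>a\<in>UNIV. \<Sum>b\<in>UNIV. \<Sum>c\<in>UNIV. h a b c) = (\<Sum>c\<in>UNIV. \<Sum>a\<in>UNIV. \<Sum>b\<in>UNIV. h a b c)"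
    for h :: "'a \<Rightarrow> 'a \<Rightarrow> 'a \<Rightarrow> complex"
  proof -
    have "(\<Sum>a\<in>UNIV. \<Sum>b\<in>UNIV. \<Sum>c\<in>UNIV. h a b c) = (\<Sum>a\<in>UNIV. \<Sum>c\<in>UNIV. \<Sum>b\<in>UNIV. h a b c)"
      by (rule sum.cong[OF refl], rule sum.swap)
    also have "\<dots> = (\<Sum>c\<in>UNIV. \<Sum>a\<in>UNIV. \<Sum>b\<in>UNIV. h a b c)" by (rule sum.swap)
    finally show ?thesis .
  qed
  then show ?thesis
    by (simp add: vec_eq_iff tblk3_def matrix_matrix_mult_def sum_UNIV_Times)
qed

lemma tblk1_leg:
  "tblk1 (leg12 T) i j = kron (blk1 T i j) (mat 1)" "tblk1 (leg13 T) i j = kron (mat 1) (blk1 T i j)"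
  "tblk1 (leg23 T) i j = cmscale ((mat 1 :: complex^'n^'n) $ i $ j) T" for T :: "complex^('n::finite \<times> 'n)^('n \<times> 'n)"
  by (auto simp add: vec_eq_iff tblk1_def leg12_def leg13_def leg23_def kron_def blk1_def mat_def cmscale_def)

lemma tblk3_leg:
  "tblk3 (leg12 T) i j = cmscale ((mat 1 :: complex^'n^'n) $ i $ j) T" "tblk3 (leg13 T) i j = kron (blk2 T i j) (mat 1)"
  "tblk3 (leg23 T) i j = kron (mat 1) (blk2 T i j)" for T :: "complex^('n::finite \<times> 'n)^('n \<times> 'n)"
  by (auto simp add: vec_eq_iff tblk3_def leg12_def leg13_def leg23_def kron_def blk2_def mat_def cmscale_def)

lemma leg_hom:
  "leg12 (A ** B) = leg12 A ** leg12 B" "leg13 (A ** B) = leg13 A ** leg13 B" "leg23 (A ** B) = leg23 A ** leg23 B"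
proof -
  show "leg12 (A ** B) = leg12 A ** leg12 B"
    by (rule tblk3_ext) (simp add: tblk3_mult tblk3_leg cmscale_mult_left cmscale_mult_right sum_cmscale_mat)
  show "leg13 (A ** B) = leg13 A ** leg13 B"
    by (rule tblk1_ext) (simp add: tblk1_mult tblk1_leg blk_mult kron_sum kron_mult)
  show "leg23 (A ** B) = leg23 A ** leg23 B"
    by (rule tblk1_ext) (simp add: tblk1_mult tblk1_leg cmscale_mult_left cmscale_mult_right sum_cmscale_mat)
qed

lemma leg12_one: "leg12 (mat 1) = mat 1" and leg13_one: "leg13 (mat 1) = mat 1"
  by (auto simp add: vec_eq_iff leg12_def leg13_def leg23_def mat_def)

lemma leg1: "leg13 (kron a (mat 1)) = leg12 (kron a (mat 1))"
  by (rule tblk1_ext) (simp add: tblk1_leg blk_kron kron_cmscale kron_one)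

lemma leg23_leg12_commute:
  assumes "\<And>i j. N ** kron (blk1 T i j) (mat 1) = kron (blk1 T i j) (mat 1) ** N"
  shows "leg23 N ** leg12 T = leg12 T ** leg23 N"
  by (rule tblk1_ext) (simp add: tblk1_mult tblk1_leg cmscale_mult_left cmscale_mult_right sum_cmscale_mat assms)

lemma leg23_leg1_commute: "leg23 N ** leg12 (kron a (mat 1)) = leg12 (kron a (mat 1)) ** leg23 N"
  by (rule leg23_leg12_commute) (simp add: blk_kron kron_cmscale kron_one cmscale_mult_left cmscale_mult_right)

lemma leg12_leg13_commute:
  assumes "\<And>i j. N ** kron (blk2 T i j) (mat 1) = kron (blk2 T i j) (mat 1) ** N"
  shows "leg12 N ** leg13 T = leg13 T ** leg12 N"
  by (rule tblk3_ext) (simp add: tblk3_mult tblk3_leg cmscale_mult_left cmscale_mult_right sum_cmscale_mat assms)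

lemma leg23_leg12_leg13:
  assumes "\<And>i j. kron (mat 1) (blk2 T i j) ** M = M ** kron (blk2 T i j) (mat 1)"
  shows "leg23 T ** leg12 M = leg12 M ** leg13 T"
  by (rule tblk3_ext) (simp add: tblk3_mult tblk3_leg cmscale_mult_left cmscale_mult_right sum_cmscale_mat assms)

definition tens1 :: "complex^'n::finite \<Rightarrow> complex^('n \<times> 'n) \<Rightarrow> complex^('n \<times> 'n \<times> 'n)" where
  "tens1 a t = (\<chi> p. a $ fst p * t $ snd p)"

lemma tens1_mv: "(M *v tens1 a t) $ (i, p) = ((\<Sum>j\<in>UNIV. cmscale (a $ j) (tblk1 M i j)) *v t) $ p"
  by (simp add: tens1_def tblk1_def matrix_vector_mult_def sum_UNIV_Times[where 'b="'a \<times> 'a"] cmscale_def sum_distrib_right sum_distrib_left mult_ac)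
    (rule sum.swap)

lemma tens1_leg23: "leg23 Z *v tens1 a t = tens1 a (Z *v t)"
proof -
  have "(leg23 Z *v tens1 a t) $ (i, p) = a $ i * (Z *v t) $ p" for i p
  proof -
    have "(\<Sum>j\<in>UNIV. cmscale (a $ j) (tblk1 (leg23 Z) i j)) = cmscale (a $ i) Z"
      using sum_cmscale_mat(1)[of i "\<lambda>j. cmscale (a $ j) Z"] by (simp add: tblk1_leg cmscale_cmscale mult.commute)
    then show ?thesis by (simp add: tens1_mv cmscale_mv)
  qed
  then show ?thesis by (simp add: vec_eq_iff tens1_def)
qed

lemma tens1_leg1: "leg12 (kron a (mat 1)) *v tens1 x t = tens1 (a *v x) t"
proof -
  have "(leg12 (kron a (mat 1)) *v tens1 x t) $ (i, p) = (a *v x) $ i * t $ p" for i p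
    by (simp add: tens1_mv tblk1_leg blk_kron kron_cmscale kron_one cmscale_cmscale sum_mv cmscale_mv)
       (simp add: matrix_vector_mult_def sum_distrib_right sum_distrib_left mult_ac)
  then show ?thesis by (simp add: vec_eq_iff tens1_def)
qed

lemma tens1_fixed:
  assumes "\<And>\<eta>. Z *v tens x \<eta> = tens x \<eta>"
  shows "leg12 Z *v tens1 x t = tens1 x t" "leg13 Z *v tens1 x t = tens1 x t"
proof -
  have b: "(\<Sum>j\<in>UNIV. cmscale (x $ j) (blk1 Z i j)) = cmscale (x $ i) (mat 1)" for i
    by (rule mat_ext_cinner) (simp add: cinner_Lsl assms cinner_tens cmscale_mv cinner_scale_right flip: Lsl_ax_expand(2))
  have "(\<Sum>j\<in>UNIV. cmscale (x $ j) (tblk1 (leg12 Z) i j)) = kron (\<Sum>j\<in>UNIV. cmscale (x $ j) (blk1 Z i j)) (mat 1)" for i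
    by (simp add: tblk1_leg kron_sum kron_cmscale)
  then have "(leg12 Z *v tens1 x t) $ (i, p) = x $ i * t $ p" for i p
    unfolding tens1_mv by (simp add: b kron_cmscale kron_one cmscale_mv)
  then show "leg12 Z *v tens1 x t = tens1 x t" by (simp add: vec_eq_iff tens1_def)
  have "(\<Sum>j\<in>UNIV. cmscale (x $ j) (tblk1 (leg13 Z) i j)) = kron (mat 1) (\<Sum>j\<in>UNIV. cmscale (x $ j) (blk1 Z i j))" for i
    by (simp add: tblk1_leg kron_sum kron_cmscale)
  then have "(leg13 Z *v tens1 x t) $ (i, p) = x $ i * t $ p" for i p
    unfolding tens1_mv by (simp add: b kron_cmscale kron_one cmscale_mv)
  then show "leg13 Z *v tens1 x t = tens1 x t" by (simp add: vec_eq_iff tens1_def)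
qed

lemma tens1_sum: "tens1 (\<Sum>i\<in>I. h i) t = (\<Sum>i\<in>I. tens1 (h i) t)"
proof -
  have "tens1 (a + b) t = tens1 a t + tens1 b t" "tens1 0 t = 0" for a b
    by (simp_all add: tens1_def vec_eq_iff algebra_simps)
  then show ?thesis by (induction I rule: infinite_finite_induct) simp_all
qed

lemma mat_ext_tens1: "(\<And>x t. A *v tens1 x t = B *v tens1 x t) \<Longrightarrow> A = B"
  for A B :: "complex^('n::finite \<times> 'n \<times> 'n)^('n \<times> 'n \<times> 'n)"
proof -
  assume a: "\<And>x t. A *v tens1 x t = B *v tens1 x t"
  have "tblk1 A i j = tblk1 B i j" for i j
  proof (rule mat_ext_mv)
    fix t
    have "(\<Sum>m\<in>UNIV. cmscale (ax j $ m) (tblk1 M i m)) = tblk1 M i j" for M :: "complex^('n \<times> 'n \<times> 'n)^('n \<times> 'n \<times> 'n)"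
    proof -
      have "cmscale (ax j $ m) (tblk1 M i m) = (if j = m then tblk1 M i m else 0)" for m
        by (simp add: ax_nth cmscale_one)
      then show ?thesis by simp
    qed
    then have "(M *v tens1 (ax j) t) $ (i, p) = (tblk1 M i j *v t) $ p" for M :: "complex^('n \<times> 'n \<times> 'n)^('n \<times> 'n \<times> 'n)" and p
      by (simp add: tens1_mv)
    then show "tblk1 A i j *v t = tblk1 B i j *v t" using a by (metis vec_eq_iff)
  qed
  then show ?thesis by (rule tblk1_ext)
qed

subsection \<open>Spans of operators\<close>

lemma cspan_op_superset: "X \<subseteq> cspan_op X"
proof
  fix x assume "x \<in> X"
  then show "x \<in> cspan_op X" unfolding cspan_op_def
    by (intro CollectI exI[of _ "{x}"] exI[of _ "\<lambda>_. 1"]) (simp add: cmscale_one)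
qed

lemma cspan_op_minimal: "csub T \<Longrightarrow> X \<subseteq> T \<Longrightarrow> cspan_op X \<subseteq> T"
  unfolding cspan_op_def by (auto intro!: csub_sum csub_scale)

lemma csub_cspan_op: "csub (cspan_op X)"
  unfolding csub_def
proof (intro conjI ballI allI)
  show "0 \<in> cspan_op X" unfolding cspan_op_def by (intro CollectI exI[of _ "{}"]) simp
next
  fix a b assume "a \<in> cspan_op X" "b \<in> cspan_op X"
  then obtain F c G d where F: "finite F" "F \<subseteq> X" "a = (\<Sum>x\<in>F. cmscale (c x) x)"
    and G: "finite G" "G \<subseteq> X" "b = (\<Sum>x\<in>G. cmscale (d x) x)"
    unfolding cspan_op_def by blast
  let ?c = "\<lambda>x. if x \<in> F then c x else 0" and ?d = "\<lambda>x. if x \<in> G then d x else 0"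
  have "a = (\<Sum>x\<in>F \<union> G. cmscale (?c x) x)" "b = (\<Sum>x\<in>F \<union> G. cmscale (?d x) x)"
    unfolding F G using F G by (auto intro!: sum.mono_neutral_cong_left)
  moreover have "cmscale (s + t) x = cmscale s x + cmscale t x" for s t and x :: "complex^'a^'a"
    by (simp add: vec_eq_iff cmscale_def algebra_simps)
  ultimately have "a + b = (\<Sum>x\<in>F \<union> G. cmscale (?c x + ?d x) x)"
    by (simp add: sum.distrib)
  then show "a + b \<in> cspan_op X" unfolding cspan_op_def
    using F G by (intro CollectI exI[of _ "F \<union> G"] exI[of _ "\<lambda>x. ?c x + ?d x"]) auto
next
  fix s a assume "a \<in> cspan_op X"
  then obtain F c where F: "finite F" "F \<subseteq> X" "a = (\<Sum>x\<in>F. cmscale (c x) x)"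
    unfolding cspan_op_def by blast
  then show "cmscale s a \<in> cspan_op X" unfolding cspan_op_def
    by (intro CollectI exI[of _ F] exI[of _ "\<lambda>x. s * c x"]) (simp add: cmscale_sum cmscale_cmscale)
qed

lemma cspan_op_commute:
  assumes "T \<in> cspan_op X" "\<And>x. x \<in> X \<Longrightarrow> x ** c = c ** x" shows "T ** c = c ** T"
proof -
  have "cspan_op X \<subseteq> {x. x ** c = c ** x}"
    by (rule cspan_op_minimal) (auto simp: csub_def assms matrix_add_rdistrib matrix_add_ldistrib cmscale_mult_left cmscale_mult_right)
  then show ?thesis using assms(1) by auto
qed

subsection \<open>Slices\<close>

text \<open>A functional is a combination of matrix coefficients, so its slice is a combination of
  the \<open>blk1\<close>.\<close>

lemma slice_left_in: assumes "clin_functional \<omega>" "csub T" "\<And>i j. blk1 V i j \<in> T" shows "slice_left V \<omega> \<in> T"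
proof -
  let ?E = "\<lambda>i j. ketbra (ax i) (ax j)"
  have add: "\<omega> (A + B) = \<omega> A + \<omega> B" and sc: "\<omega> (cmscale a A) = a * \<omega> A" for A B a
  proof -
    have l: "\<omega> (cmscale a A + B) = a * \<omega> A + \<omega> B" for a A B using assms(1) by (simp add: clin_functional_def)
    from l[of 1 A B] show "\<omega> (A + B) = \<omega> A + \<omega> B" by (simp add: cmscale_one)
    from l[of 1 0 0] have "\<omega> 0 = 0" by simp
    with l[of a A 0] show "\<omega> (cmscale a A) = a * \<omega> A" by simp
  qed
  have zero: "\<omega> 0 = 0" using sc[of 0 0] by simp
  have s: "\<omega> (\<Sum>i\<in>I. h i) = (\<Sum>i\<in>I. \<omega> (h i))" for I :: "'a set" and h
    by (induction I rule: infinite_finite_induct) (simp_all add: add zero)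
  have e: "A = (\<Sum>i\<in>UNIV. \<Sum>j\<in>UNIV. cmscale (A $ i $ j) (?E i j))" for A :: "complex^'a^'a"
  proof -
    have Aax: "(A *v ax j) $ i = A $ i $ j" for i j
      by (simp add: matrix_vector_mult_def ax_nth if_distrib cong: if_cong)
    have "ketbra (A *v ax j) (ax j) = (\<Sum>i\<in>UNIV. cmscale (A $ i $ j) (?E i j))" for j
    proof (rule mat_ext_mv)
      fix x
      have "(\<Sum>i\<in>UNIV. cmscale (A $ i $ j) (?E i j)) *v x = (\<Sum>i\<in>UNIV. x $ j *s ((A *v ax j) $ i *s ax i))"
        by (simp add: sum_mv cmscale_mv ketbra_mv Aax vector_smult_assoc mult.commute)
      also have "\<dots> = x $ j *s (\<Sum>i\<in>UNIV. (A *v ax j) $ i *s ax i)"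
        by (simp add: vec_eq_iff sum_distrib_left mult.assoc)
      finally show "ketbra (A *v ax j) (ax j) *v x = (\<Sum>i\<in>UNIV. cmscale (A $ i $ j) (?E i j)) *v x"
        by (simp add: ketbra_mv flip: vec_expand)
    qed
    then have "A ** (\<Sum>j\<in>UNIV. ?E j j) = (\<Sum>j\<in>UNIV. \<Sum>i\<in>UNIV. cmscale (A $ i $ j) (?E i j))"
      by (simp add: matrix_mult_sum mult_ketbra)
    also have "\<dots> = (\<Sum>i\<in>UNIV. \<Sum>j\<in>UNIV. cmscale (A $ i $ j) (?E i j))" by (rule sum.swap)
    finally show ?thesis unfolding sum_ketbra_ax by (simp only: matrix_mul_rid)
  qed
  have w: "\<omega> A = (\<Sum>i\<in>UNIV. \<Sum>j\<in>UNIV. A $ i $ j * \<omega> (?E i j))" for A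
    using arg_cong[OF e[of A], of \<omega>] by (simp only: s sc)
  have "slice_left V \<omega> = (\<Sum>i\<in>UNIV. \<Sum>j\<in>UNIV. cmscale (\<omega> (?E i j)) (blk1 V i j))"
    by (simp add: slice_left_def w[of "\<chi> i j. V $ (i, _) $ (j, _)"] vec_eq_iff cmscale_def blk1_def mult.commute)
  then show ?thesis by (simp add: csub_sum csub_scale assms)
qed

lemma slice_right_in: assumes "clin_functional \<omega>" "csub T" "\<And>i j. blk2 V i j \<in> T" shows "slice_right V \<omega> \<in> T"
proof -
  have b: "blk1 (swapm V) i j = blk2 V i j" for i j by (rule blk_swapm)
  have "slice_right V \<omega> = slice_left (swapm V) \<omega>"
    by (simp add: slice_right_def slice_left_def swapm_def)
  then show ?thesis using slice_left_in[OF assms(1,2), of "swapm V"] assms(3) by (simp add: b)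
qed

lemma clin_functional_vec: "clin_functional (\<lambda>M. cinner \<zeta> (M *v \<eta>))"
  by (simp add: clin_functional_def matrix_vector_mult_add_rdistrib cmscale_mv cinner_add_right cinner_scale_right)

lemma slice_left_vec: "slice_left V (\<lambda>M. cinner \<zeta> (M *v \<eta>)) = Lsl V \<zeta> \<eta>"
proof -
  have "slice_left V (\<lambda>M. cinner \<zeta> (M *v \<eta>)) $ k $ l = cinner (ax k) (Lsl V \<zeta> \<eta> *v ax l)" for k l
    unfolding Lsl_Rsl Rsl_ax by (simp add: slice_left_def blk2_def)
  then show ?thesis
    by (simp add: vec_eq_iff matrix_vector_mult_def ax_nth if_distrib cong: if_cong)
qed

lemma slice_right_vec: "slice_right V (\<lambda>M. cinner \<zeta> (M *v \<eta>)) = Rsl V \<zeta> \<eta>"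
proof -
  have "slice_right V (\<lambda>M. cinner \<zeta> (M *v \<eta>)) $ k $ l = cinner (ax k) (Rsl V \<zeta> \<eta> *v ax l)" for k l
    unfolding Lsl_Rsl[symmetric] Lsl_ax by (simp add: slice_right_def blk1_def)
  then show ?thesis
    by (simp add: vec_eq_iff matrix_vector_mult_def ax_nth if_distrib cong: if_cong)
qed

lemma Lsl_leftS: "Lsl V \<zeta> \<eta> \<in> leftS V"
  unfolding leftS_def using slice_left_vec clin_functional_vec by (metis (mono_tags, lifting) mem_Collect_eq)

lemma Rsl_rightS: "Rsl V \<zeta> \<eta> \<in> rightS V"
  unfolding rightS_def using slice_right_vec clin_functional_vec by (metis (mono_tags, lifting) mem_Collect_eq)

context munitary_one begin

lemma leftS_eq: "leftS V = S"
proof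
  show "leftS V \<subseteq> S" by (auto simp: leftS_def intro!: slice_left_in csub_S)
  show "S \<subseteq> leftS V"
  proof
    fix x assume "x \<in> S"
    then obtain v where "x = cmscale sN (Lsl V e' v)" by (auto simp: S_def lam_def)
    then show "x \<in> leftS V" by (simp add: Lsl_leftS flip: Lsl_scale(1))
  qed
qed

lemma rightS_eq: "rightS V = munitary_one.S (dualV V) e' e"
proof -
  interpret d: munitary_one "dualV V" e' e by (rule dual_munitary_one)
  show ?thesis
  proof
    show "rightS V \<subseteq> d.S" by (auto simp: rightS_def intro!: slice_right_in d.csub_S blk2_dual_S)
    show "d.S \<subseteq> rightS V"
    proof
      fix x assume "x \<in> d.S"
      then have "cadj x = d.lam (cadj x *v e')" using d.S_cadj d.S_iff by blast
      then have "cadj (cadj x) = cadj (cmscale sN (cadj (Rsl V (cadj x *v e') e)))" by (metis dual_lam)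
      then have "x = Rsl V (cadj x *v e') (sN *s e)" by (simp add: cadj_cmscale Rsl_scale)
      then show "x \<in> rightS V" by (metis Rsl_rightS)
    qed
  qed
qed

lemma unital_star_subalg_S: "unital_star_subalg S"
  using csub_S by (simp add: unital_star_subalg_def csub_def S_mult S_cadj)

lemma S_0: "0 \<in> S" using csub_S by (simp add: csub_def)

end

context pair_representation begin

text \<open>The state of v turns \<beta> into the tracial state of e. Expanding the coefficient of
  \<open>ext\<close> at \<eta> \<otimes> v and recombining the frame, whose sum weighted by e is the
  identity, produces \<open>ph g\<close>. This serves to find the fixed vectors of W.\<close>

lemma ext_state:
  assumes s: "\<And>x a b. x \<in> G f \<Longrightarrow> cinner (tens a v) (\<beta> x *v tens b v) = cinner e (x *v e) * cinner a b"
    and v: "cinner v v = 1" "ext *v tens \<eta> v = tens \<eta> v"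
  shows "ph g *v \<eta> = \<eta>"
proof (rule vec_ext_cinner)
  fix a
  let ?y = "\<lambda>k. ph g *v (cadj (xk k) *v \<eta>)"
  have "lam (\<Sum>k\<in>I. h k) = (\<Sum>k\<in>I. lam (h k))" for I :: "'n set" and h
    by (induction I rule: infinite_finite_induct) (simp_all add: lam_add)
  then have "(\<Sum>k\<in>UNIV. cmscale (e $ k) (xk k)) = lam (ph f *v (\<Sum>k\<in>UNIV. e $ k *s ax k))"
    by (simp add: mv_sum mv_scale lam_scale)
  also have "\<dots> = mat 1" by (simp add: ph_e psub_f lam_e flip: vec_expand)
  finally have "cadj (\<Sum>k\<in>UNIV. cmscale (e $ k) (xk k)) = cadj (mat 1)" by simp
  then have 1: "(\<Sum>k\<in>UNIV. cmscale (cnj (e $ k)) (cadj (xk k))) = mat 1"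
    by (simp add: cadj_sum cadj_cmscale)
  have 2: "cinner e (xk k *v e) = cnj (e $ k)" for k
    by (simp add: cinner_adj[of e] ph_selfadjoint psub_f ph_e)
  have "cinner a \<eta> = cinner (tens a v) (ext *v tens \<eta> v)"
    by (simp add: v cinner_tens)
  also have "\<dots> = (\<Sum>k\<in>UNIV. cinner (tens a v) (\<beta> (xk k) *v tens (?y k) v))"
    by (simp add: ext_def sum_mv cinner_sum_right kron_tens flip: matrix_vector_mul_assoc)
  also have "\<dots> = (\<Sum>k\<in>UNIV. cnj (e $ k) * cinner a (?y k))"
    by (simp add: s xk_G 2 del: lam_mv_e)
  also have "\<dots> = cinner a (ph g *v ((\<Sum>k\<in>UNIV. cmscale (cnj (e $ k)) (cadj (xk k))) *v \<eta>))"
    by (simp add: sum_mv mv_sum cmscale_mv mv_scale cinner_sum_right cinner_scale_right)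
  finally show "cinner a (ph g *v \<eta>) = cinner a \<eta>" by (simp add: 1)
qed

end

context munitary_one begin

lemma mult_one: "mult_one V"
proof -
  have "e \<noteq> 0" using norm_e by auto
  moreover have "fixedv V (c *s e)" for c
    by (simp add: fixedv_def tens_scale mv_scale V_e)
  then have "{\<eta>. fixedv V \<eta>} = range (\<lambda>c. c *s e)"
    using fixed_line by blast
  ultimately show ?thesis by (auto simp: mult_one_def)
qed

text \<open>\<open>lam\<close> inverts evaluation at e, so the left algebra alone determines the
  slices by e'. The remaining difference of coefficients lies in the dual algebra, and its adjoint
  kills the separating vector e'; here the second algebra enters.\<close>

lemma determined_by_slices:
  assumes "munitary_one V' e e'" "munitary_one.S V' e e' = S" "munitary_one.S (dualV V') e' e = munitary_one.S (dualV V) e' e"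
  shows "V' = V"
proof -
  interpret w: munitary_one V' e e' by (rule assms(1))
  interpret d: munitary_one "dualV V" e' e by (rule dual_munitary_one)
  interpret dw: munitary_one "dualV V'" e' e by (rule w.dual_munitary_one)
  have "w.lam v = lam v" for v
    by (rule S_eqI) (use w.lam_S[of v] in \<open>simp_all add: assms(2)\<close>)
  then have "cmscale sN (Lsl V' e' v) = cmscale sN (Lsl V e' v)" for v
    using w.lam_def[of v] lam_def[of v] w.sN_def sN_def by simp
  then have L: "Lsl V' e' v = Lsl V e' v" for v by (simp add: cmscale_eq_iff)
  show ?thesis
  proof (rule blk_ext2)
    fix k l
    let ?D = "blk2 V' k l - blk2 V k l"
    have "?D \<in> d.S"
      using w.blk2_dual_S blk2_dual_S by (intro csub_diff d.csub_S) (simp_all add: assms(3))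
    then have D: "cadj ?D \<in> d.S" by (rule d.S_cadj)
    have "cinner (cadj ?D *v e') \<eta> = 0" for \<eta>
    proof -
      have "cinner (cadj ?D *v e') \<eta> = cinner e' (blk2 V' k l *v \<eta>) - cinner e' (blk2 V k l *v \<eta>)"
        by (simp add: cinner_adj' matrix_vector_mult_diff_rdistrib cinner_diff_right)
      also have "\<dots> = 0"
        using Lsl_Rsl[of "ax k" V' e' \<eta> "ax l"] Lsl_Rsl[of "ax k" V e' \<eta> "ax l"] by (simp add: L)
      finally show ?thesis .
    qed
    then have "cadj ?D *v e' = 0" using cinner_self_eq_0 by blast
    then have "cadj ?D = 0" by (intro d.S_eqI D d.S_0) simp
    then have "cadj (cadj ?D) = 0" by (simp del: cadj_cadj)
    then show "blk2 V' k l = blk2 V k l" by simp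
  qed
qed

end

context munitary_U begin

text \<open>By \<open>bet_ph\<close>, \<open>gam\<close> of U y U acts as U y U on the second leg
  over H_g. So slices of V by a vector of H_g on the left commute with U y U, and \<open>D g\<close>
  consists of adjoints of such slices.\<close>

lemma D_dual_commute:
  assumes "psub g" "x \<in> D g" "y \<in> munitary_U.D (dualV V) e' e U g"
  shows "x ** (U ** y ** U) = (U ** y ** U) ** x"
proof -
  interpret d: munitary_U "dualV V" e' e U by (rule dual_munitary_U)
  have dg: "d.psub g" using assms(1) by (simp add: psub_dual)
  have *: "Lsl V \<zeta> \<theta> ** (U ** y ** U) = (U ** y ** U) ** Lsl V \<zeta> \<theta>" if y: "y \<in> d.D g" and z: "ph g *v \<zeta> = \<zeta>" for y \<zeta> \<theta>
  proof (rule mat_ext_cinner)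
    fix a b
    let ?c = "U ** y ** U"
    have "bet (cadj y) *v tens \<zeta> a = tens \<zeta> ((U ** cadj y ** U) *v a)"
      using arg_cong[OF bet_ph[OF assms(1) d.D_cadj[OF dg y]], of "\<lambda>A. A *v tens \<zeta> a"]
      by (simp add: kron_tens z flip: matrix_vector_mul_assoc)
    then have 1: "cadj (gam ?c) *v tens \<zeta> a = tens \<zeta> (cadj ?c *v a)"
      by (simp add: bet_gam cadj_mult U_selfadjoint matrix_mul_assoc flip: gam_cadj)
    have "cinner a ((Lsl V \<zeta> \<theta> ** ?c) *v b) = cinner (tens \<zeta> a) (V *v tens \<theta> (?c *v b))"
      by (simp only: cinner_Lsl flip: matrix_vector_mul_assoc)
    also have "V *v tens \<theta> (?c *v b) = gam ?c *v (V *v tens \<theta> b)"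
      by (simp add: gam_def kron_tens flip: matrix_vector_mul_assoc)
    also have "cinner (tens \<zeta> a) (gam ?c *v (V *v tens \<theta> b)) = cinner (tens \<zeta> (cadj ?c *v a)) (V *v tens \<theta> b)"
      by (subst cinner_adj) (simp only: 1)
    also have "\<dots> = cinner (cadj ?c *v a) (Lsl V \<zeta> \<theta> *v b)" by (simp only: cinner_Lsl)
    also have "\<dots> = cinner a ((?c ** Lsl V \<zeta> \<theta>) *v b)"
      by (simp only: cinner_adj[of a ?c] matrix_vector_mul_assoc[of ?c, symmetric])
    finally show "cinner a ((Lsl V \<zeta> \<theta> ** ?c) *v b) = cinner a ((?c ** Lsl V \<zeta> \<theta>) *v b)" .
  qed
  have k: "antipode x \<in> G g" "x \<in> S" using assms by (simp_all add: D_iff)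
  define \<eta> where "\<eta> = antipode x *v e"
  have \<eta>: "ph g *v \<eta> = \<eta>" using k by (simp add: \<eta>_def G_def)
  have "antipode x = lam \<eta>" using k(1) by (simp add: \<eta>_def G_S flip: S_iff)
  then have "x = antipode (lam \<eta>)" using k by (metis antipode_antipode)
  then have x: "x = cmscale sN (cadj (Lsl V \<eta> e'))"
    by (simp add: lam_def antipode_scale antipode_Lsl)
  have "cadj (Lsl V \<eta> e' ** (U ** cadj y ** U)) = cadj ((U ** cadj y ** U) ** Lsl V \<eta> e')"
    using *[OF d.D_cadj[OF dg assms(3)] \<eta>] by simp
  then show ?thesis
    by (simp add: x cadj_mult U_selfadjoint matrix_mul_assoc cmscale_mult_left cmscale_mult_right)
qed

end

section \<open>The unitaries X and Y, their product W and its fixed vectors\<close>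

context complementary_pair begin

interpretation d: complementary_pair "dualV V" e' e U f g by (rule dual_complementary_pair)

lemmas dual_p = ph_dual[OF psub_f] ph_dual[OF psub_g] p_dual[OF psub_f] p_dual[OF psub_g]

lemma d_psub: "d.psub f" "d.psub g" by (simp_all add: psub_dual psub_f psub_g)

lemma X_representation: "pair_representation V e e' U f g delta gam {U ** y ** U | y. y \<in> d.D g} (p f)"
proof (unfold_locales)
  fix c assume "c \<in> {U ** y ** U | y. y \<in> d.D g}"
  then obtain y where c: "c = U ** y ** U" "y \<in> d.D g" by auto
  show "gam c ** kron (ph g) (mat 1) = kron (ph g) c"
    using bet_ph[OF psub_g c(2)] by (simp add: c(1) bet_gam)
  have "cadj c = U ** cadj y ** U" by (simp add: c cadj_mult U_selfadjoint matrix_mul_assoc)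
  then show "cadj c \<in> {U ** y ** U | y. y \<in> d.D g}"
    using d.D_cadj[OF d_psub(2) c(2)] by auto
next
  fix \<xi> :: "complex^'n"
  obtain d where d: "\<And>k. d k \<in> d.D g" "U *v \<xi> = (\<Sum>k\<in>UNIV. d k *v (U *v (p f *v ax k)))"
    using d.span_D[of "U *v \<xi>"] unfolding dual_p by blast
  have "\<xi> = U *v (U *v \<xi>)" by simp
  also have "\<dots> = (\<Sum>k\<in>UNIV. (U ** d k ** U) *v (p f *v ax k))"
    unfolding d(2) by (simp add: mv_sum flip: matrix_vector_mul_assoc)
  finally show "\<exists>d w. (\<forall>k. d k \<in> {U ** y ** U | y. y \<in> d.D g}) \<and> \<xi> = (\<Sum>k\<in>(UNIV::'n set). d k *v (p f *v w k))"
    using d(1) by (intro exI[of _ "\<lambda>k. U ** d k ** U"] exI[of _ ax] conjI allI CollectI exI) auto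
qed (simp_all add: delta_add delta_scale delta_mult delta_cadj delta_one delta_gam gam_cadj delta_p psub_f)

text \<open>For the dual, \<open>d.ph g\<close> is \<open>p g\<close>, so the vectors \<zeta> now
  range over H^g. The second family is \<open>delta\<close> on \<open>D g\<close>, which takes the
  part that \<open>gam\<close> has for X.\<close>

lemma Y_representation: "pair_representation (dualV V) e' e U f g bet delta (D g) (U ** ph f ** U)"
proof (unfold_locales)
  fix \<xi> :: "complex^'n"
  obtain d where d: "\<And>k. d k \<in> D g" "\<xi> = (\<Sum>k\<in>UNIV. d k *v (U *v (ph f *v ax k)))"
    using span_D[of \<xi>] by blast
  then have "\<xi> = (\<Sum>k\<in>UNIV. d k *v ((U ** ph f ** U) *v (U *v ax k)))"
    by (simp flip: matrix_vector_mul_assoc)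
  then show "\<exists>d w. (\<forall>k. d k \<in> D g) \<and> \<xi> = (\<Sum>k\<in>(UNIV::'n set). d k *v ((U ** ph f ** U) *v w k))"
    using d(1) by (intro exI[of _ d] exI[of _ "\<lambda>k. U *v ax k"]) auto
next
  fix c assume "c \<in> D g"
  then show "delta c ** kron (d.ph g) (mat 1) = kron (d.ph g) c"
    by (simp add: dual_p delta_D psub_g)
next
  fix x assume "x \<in> d.G f"
  then show "bet x ** kron (mat 1) (U ** ph f ** U) = kron x (U ** ph f ** U)"
    by (rule bet_Uph[OF psub_f])
qed (simp_all add: bet_add bet_scale bet_mult bet_cadj bet_one delta_bet delta_cadj D_cadj psub_g)

interpretation X: pair_representation V e e' U f g delta gam "{U ** y ** U | y. y \<in> d.D g}" "p f" by (rule X_representation)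
interpretation Y: pair_representation "dualV V" e' e U f g bet delta "D g" "U ** ph f ** U" by (rule Y_representation)

definition X where "X = X.ext"
definition Y where "Y = cadj Y.ext"
definition W where "W = Y ** X"

definition Tf where "Tf = {U ** z ** U | z. z \<in> d.G f}"
definition A where "A = cspan_op {x ** y | x y. x \<in> Tf \<and> y \<in> G f}"
definition B where "B = cspan_op {x ** y | x y. x \<in> D g \<and> y \<in> d.D g}"

lemma csub_A: "csub A" and csub_B: "csub B"
  by (simp_all add: A_def B_def csub_cspan_op)

lemma A_I: "t \<in> Tf \<Longrightarrow> x \<in> G f \<Longrightarrow> t ** x \<in> A" and B_I: "x' \<in> D g \<Longrightarrow> y \<in> d.D g \<Longrightarrow> x' ** y \<in> B"
  unfolding A_def B_def by (rule subsetD[OF cspan_op_superset], blast)+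

lemma csub_Tf: "csub Tf"
  unfolding csub_def Tf_def
proof (intro conjI ballI allI)
  show "0 \<in> {U ** z ** U | z. z \<in> d.G f}"
    using d.csub_G[of f] by (intro CollectI exI[of _ 0]) (simp add: csub_def)
next
  fix s t assume "s \<in> {U ** z ** U | z. z \<in> d.G f}" "t \<in> {U ** z ** U | z. z \<in> d.G f}"
  then obtain y z where "s = U ** y ** U" "t = U ** z ** U" "y \<in> d.G f" "z \<in> d.G f" by auto
  then show "s + t \<in> {U ** z ** U | z. z \<in> d.G f}"
    by (intro CollectI exI[of _ "y + z"]) (simp add: matrix_add_ldistrib matrix_add_rdistrib csub_add d.csub_G)
next
  fix c t assume "t \<in> {U ** z ** U | z. z \<in> d.G f}"
  then obtain z where "t = U ** z ** U" "z \<in> d.G f" by auto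
  then show "cmscale c t \<in> {U ** z ** U | z. z \<in> d.G f}"
    by (intro CollectI exI[of _ "cmscale c z"]) (simp add: cmscale_mult_left cmscale_mult_right csub_scale d.csub_G)
qed

lemma Tf_cadj: "t \<in> Tf \<Longrightarrow> cadj t \<in> Tf"
  unfolding Tf_def using d.G_cadj[OF d_psub(1)] by (fastforce simp: cadj_mult U_selfadjoint matrix_mul_assoc)

lemma X_unitary [simp]: "cadj X ** X = mat 1" "X ** cadj X = mat 1"
  and Y_unitary [simp]: "cadj Y ** Y = mat 1" "Y ** cadj Y = mat 1"
  by (simp_all add: X_def Y_def X.ext_unitary Y.ext_unitary)

lemma Y_mult [simp]: "Y ** (cadj Y ** Z) = Z" "cadj Y ** (Y ** Z) = Z"
  by (simp_all add: matrix_mul_assoc)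

lemma X_mult [simp]: "X ** (cadj X ** Z) = Z"
  by (simp add: matrix_mul_assoc)

lemma W_unitary: "W ** cadj W = mat 1" "cadj W ** W = mat 1"
  by (simp_all add: W_def cadj_mult flip: matrix_mul_assoc)

lemma blk1_X: "blk1 X i j \<in> G f"
  unfolding X_def by (rule X.ext_blk1[OF csub_G delta_blk1_G[OF psub_f]])

lemma blk2_X: "blk2 X i j \<in> d.D g"
  unfolding X_def by (rule X.ext_blk2[OF d.csub_D]) (auto simp: bet_blk2_D psub_g simp flip: bet_gam)

lemma blk1_Y: "blk1 Y i j \<in> Tf"
proof -
  have "blk1 Y.ext j i \<in> Tf"
    by (rule Y.ext_blk1[OF csub_Tf]) (unfold Tf_def, use bet_blk1_G[OF psub_f] in blast)
  then show ?thesis unfolding Y_def blk_cadj by (rule Tf_cadj)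
qed

lemma blk2_Y: "blk2 Y i j \<in> D g"
proof -
  have "blk2 Y.ext j i \<in> D g"
    by (rule Y.ext_blk2[OF csub_D]) (rule delta_blk2_D[OF psub_g])
  then show ?thesis unfolding Y_def blk_cadj by (rule D_cadj[OF psub_g])
qed

lemma X_G: "x \<in> G f \<Longrightarrow> X ** kron x (mat 1) = delta x ** X"
  unfolding X_def by (rule X.ext_commute)

lemma Y_dual_G: assumes "y \<in> d.G f" shows "kron y (mat 1) ** Y = Y ** bet y"
proof -
  have "cadj Y ** kron y (mat 1) = bet y ** cadj Y"
    using Y.ext_commute[OF assms] by (simp add: Y_def)
  then have "Y ** (cadj Y ** kron y (mat 1)) ** Y = Y ** (bet y ** cadj Y) ** Y" by simp
  then show ?thesis by (simp flip: matrix_mul_assoc) 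
qed

lemma Y_D: assumes "x \<in> D g" shows "kron (mat 1) x ** Y = Y ** delta x"
proof -
  have "cadj Y ** kron (mat 1) x = delta x ** cadj Y"
    using Y.ext_\<Gamma>[OF assms] by (simp add: Y_def)
  then have "Y ** (cadj Y ** kron (mat 1) x) ** Y = Y ** (delta x ** cadj Y) ** Y" by simp
  then show ?thesis by (simp flip: matrix_mul_assoc)
qed

lemma X_tens: "ph g *v \<zeta> = \<zeta> \<Longrightarrow> X *v tens \<zeta> \<eta> = tens \<zeta> \<eta>" "p f *v \<eta> = \<eta> \<Longrightarrow> X *v tens \<zeta> \<eta> = tens \<zeta> \<eta>"
  using arg_cong[OF X.ext_ph, of "\<lambda>A. A *v tens \<zeta> \<eta>"] arg_cong[OF X.ext_R, of "\<lambda>A. A *v tens \<zeta> \<eta>"]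
  by (simp_all add: X_def kron_tens flip: matrix_vector_mul_assoc)

lemma Ys_tens: "p g *v \<zeta> = \<zeta> \<Longrightarrow> cadj Y *v tens \<zeta> \<eta> = tens \<zeta> \<eta>" "ph f *v (U *v \<eta>) = U *v \<eta> \<Longrightarrow> cadj Y *v tens \<zeta> \<eta> = tens \<zeta> \<eta>"
  using arg_cong[OF Y.ext_ph, of "\<lambda>A. A *v tens \<zeta> \<eta>"] arg_cong[OF Y.ext_R, of "\<lambda>A. A *v tens \<zeta> \<eta>"]
  by (simp_all add: Y_def kron_tens dual_p flip: matrix_vector_mul_assoc)

lemma Y_tens: assumes "cadj Y *v t = t" shows "Y *v t = t"
proof -
  have "Y *v (cadj Y *v t) = t" by (simp add: matrix_vector_mul_assoc)
  then show ?thesis by (simp only: assms)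
qed

lemma psub_fix: "psub h \<Longrightarrow> ph h *v h = h" "psub h \<Longrightarrow> p h *v h = h"
  by (simp_all add: ph_fix_iff p_fixI psub_def)

lemma W_fixed: "W *v tens g \<eta> = tens g \<eta>"
  by (simp add: W_def X_tens Ys_tens Y_tens psub_fix psub_g flip: matrix_vector_mul_assoc)

lemma W_cofixed: "W *v tens \<eta> f = tens \<eta> f"
  by (simp add: W_def X_tens Ys_tens Y_tens psub_fix psub_f U_f flip: matrix_vector_mul_assoc)

text \<open>A fixed vector makes X and the adjoint of Y agree on \<eta> \<otimes> \<xi>. At \<xi> =
  e the latter acts trivially and at \<xi> = e' the former does, so \<open>ext_state\<close> puts
  \<eta> into both H_g and H^g.\<close>

lemma W_fixed_line: assumes "fixedv W \<eta>" shows "\<eta> = cinner g \<eta> *s g"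
proof -
  have XY: "X *v tens \<eta> \<xi> = cadj Y *v tens \<eta> \<xi>" for \<xi>
  proof -
    have "Y *v (X *v tens \<eta> \<xi>) = tens \<eta> \<xi>"
      using assms by (simp add: fixedv_def W_def matrix_vector_mul_assoc)
    then have "cadj Y *v (Y *v (X *v tens \<eta> \<xi>)) = cadj Y *v tens \<eta> \<xi>" by simp
    then show ?thesis by (simp add: matrix_vector_mul_assoc)
  qed
  have "ph g *v \<eta> = \<eta>"
  proof (rule X.ext_state[where v = e])
    show "cinner e e = 1" by (rule e_e)
    show "X.ext *v tens \<eta> e = tens \<eta> e"
      using XY[of e] Ys_tens(2)[of e \<eta>] by (simp add: X_def U_e ph_e psub_f)
    fix x a b assume x: "x \<in> G f"
    show "cinner (tens a e) (delta x *v tens b e) = cinner e (x *v e) * cinner a b"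
      by (simp add: cinner_delta_ph G_S[OF x] Ree ketbra_mv lam_scale lam_e cmscale_mv cinner_scale_right)
  qed
  moreover have "p g *v \<eta> = \<eta>"
  proof -
    have "d.ph g *v \<eta> = \<eta>"
    proof (rule Y.ext_state[where v = e'])
      show "cinner e' e' = 1" by (rule e_e)
      show "Y.ext *v tens \<eta> e' = tens \<eta> e'"
        using XY[of e'] X_tens(2)[of e' \<eta>] by (simp add: Y_def p_e' psub_f)
      fix x a b assume "x \<in> d.G f"
      have "cinner (tens a e') (bet x *v tens b e') = cinner (cadj V *v tens a e') (tens b (U *v (x *v e')))"
        unfolding bet_mv_e' by (rule cinner_adj)
      also have "\<dots> = cinner a b * cinner (U *v e') (x *v e')"
        by (simp add: V_e' cinner_tens cinner_adj U_selfadjoint)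
      finally show "cinner (tens a e') (bet x *v tens b e') = cinner e' (x *v e') * cinner a b"
        by (simp add: U_e')
    qed
    then show ?thesis by (simp add: dual_p)
  qed
  \<comment> \<open>H_g and H^g meet in the line of g: \<open>lam \<eta>\<close> lies in
    \<open>G g\<close>, where \<open>p g\<close> absorbs it up to the counit, and
    \<open>p g *v e\<close> is a multiple of g.\<close>
  ultimately obtain s where s: "\<eta> = s *s g"
  proof -
    assume a: "ph g *v \<eta> = \<eta>" "p g *v \<eta> = \<eta>" and that: "\<And>s. \<eta> = s *s g \<Longrightarrow> thesis"
    have x: "lam \<eta> \<in> G g" using a by (simp add: G_def)
    have "\<eta> = (p g ** lam \<eta>) *v e" using a by (simp flip: matrix_vector_mul_assoc)
    also have "\<dots> = (counit (lam \<eta>) * cinner g e) *s g"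
      by (simp add: G_p(2)[OF psub_g x] cmscale_mv p_e psub_g vector_smult_assoc)
    finally show thesis by (rule that)
  qed
  show ?thesis by (simp add: s cinner_scale_right psub_cinner psub_g)
qed

end

lemma commute_mult:
  fixes a b c :: "complex^'n::finite^'n"
  assumes "a ** c = c ** a" "b ** c = c ** b" shows "(a ** b) ** c = c ** (a ** b)"
proof -
  have "(a ** b) ** c = (a ** c) ** b" by (simp add: assms(2) flip: matrix_mul_assoc)
  then show ?thesis by (simp add: assms(1) matrix_mul_assoc)
qed

section \<open>Cyclicity of g, the commutant description of A and the pentagon equation for
  W\<close>

context complementary_pair begin

interpretation d: complementary_pair "dualV V" e' e U f g by (rule dual_complementary_pair)

text \<open>The dual form of \<open>ores\<close> reaches H from H^g by the dual D_f. It remains to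
  reach U H^g from the single vector g by \<open>G f\<close>.\<close>

lemma A_cyclic: "\<exists>t x. (\<forall>k. t k \<in> Tf \<and> x k \<in> G f) \<and> \<xi> = (\<Sum>k\<in>(UNIV::'n set). (t k ** x k) *v g)"
proof -
  have UHg: "\<exists>x\<in>G f. U *v v = x *v g" if v: "p g *v v = v" for v
  proof -
    define z where "z = antipode (lam v)"
    define w where "w k = lam (ph g *v (cadj (xk k) *v (z *v e)))" for k
    have w: "w k \<in> G g" for k by (simp add: w_def lam_G psub_g)
    have "z *v e = (\<Sum>k\<in>UNIV. xk k *v (w k *v e))"
      using arg_cong[OF ores, of "\<lambda>A. A *v (z *v e)"] by (simp add: sum_mv w_def flip: matrix_vector_mul_assoc)
    then have "z *v e = (\<Sum>k\<in>UNIV. xk k ** w k) *v e"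
      by (simp only: sum_mv matrix_vector_mul_assoc)
    then have z: "z = (\<Sum>k\<in>UNIV. xk k ** w k)"
      by (intro S_eqI csub_sum csub_S S_mult lam_S G_S[OF w]) (simp_all add: z_def)
    have "(p g ** lam v) *v e = v" using v by (simp flip: matrix_vector_mul_assoc)
    \<comment> \<open>The antipode moves \<open>p g\<close> from the left to the right, next to e,
      where it produces a multiple of g. The factors of z from \<open>G g\<close> then act on g as
      scalars.\<close>
    then have "U *v v = antipode (p g ** lam v) *v e" by (simp add: antipode_mv_e)
    also have "\<dots> = z *v (p g *v e)"
      by (simp add: antipode_mult antipode_p psub_g z_def flip: matrix_vector_mul_assoc)
    also have "\<dots> = (\<Sum>k\<in>UNIV. cmscale (cinner g e * counit (w k)) (xk k)) *v g"
      by (simp add: z p_e psub_g mv_scale sum_mv cmscale_mv G_mv_f[OF psub_g w] vector_smult_assoc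
         flip: matrix_vector_mul_assoc) (simp add: vec_eq_iff sum_distrib_left mult.assoc)
    finally show ?thesis
      by (intro bexI[of _ "\<Sum>k\<in>UNIV. cmscale (cinner g e * counit (w k)) (xk k)"] csub_sum csub_scale csub_G xk_G) auto
  qed
  define y where "y k = d.xk k" for k
  define v where "v k = p g *v (cadj (y k) *v (U *v \<xi>))" for k
  have y: "y k \<in> d.G f" for k unfolding y_def by (rule d.xk_G)
  have "\<forall>k. \<exists>x\<in>G f. U *v v k = x *v g" using UHg by (simp add: v_def p_idem_mv psub_g)
  then obtain x where x: "\<And>k. x k \<in> G f" "\<And>k. U *v v k = x k *v g" by metis
  have "U *v \<xi> = (\<Sum>k\<in>UNIV. y k *v v k)"
    using arg_cong[OF d.ores, of "\<lambda>A. A *v (U *v \<xi>)"]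
    by (simp add: sum_mv v_def dual_p y_def flip: matrix_vector_mul_assoc)
  then have "U *v (U *v \<xi>) = (\<Sum>k\<in>UNIV. U *v (y k *v (U *v (U *v v k))))" by (simp add: mv_sum)
  then have "\<xi> = (\<Sum>k\<in>UNIV. ((U ** y k ** U) ** x k) *v g)"
    by (simp only: x(2) UU_mv flip: matrix_vector_mul_assoc)
  then show ?thesis using x(1) y by (intro exI[of _ "\<lambda>k. U ** y k ** U"] exI[of _ x]) (unfold Tf_def, blast)
qed

lemma A_cyclic': "\<exists>a\<in>A. \<xi> = a *v g"
proof -
  obtain t x where tx: "\<forall>k. t k \<in> Tf \<and> x k \<in> G f" and \<xi>: "\<xi> = (\<Sum>k\<in>(UNIV::'n set). (t k ** x k) *v g)"
    using A_cyclic[of \<xi>] by (elim exE conjE)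
  have "(\<Sum>k\<in>(UNIV::'n set). t k ** x k) \<in> A"
    by (rule csub_sum[OF csub_A], rule A_I) (use tx in \<open>simp_all only:\<close>)
  moreover have "\<xi> = (\<Sum>k\<in>(UNIV::'n set). t k ** x k) *v g" unfolding \<xi> by (simp only: sum_mv)
  ultimately show ?thesis by (rule bexI[rotated])
qed

lemma Tf_commute: assumes "t \<in> Tf" "y \<in> d.S" shows "t ** y = y ** t"
proof -
  obtain w where w: "t = U ** w ** U" "w \<in> d.G f" using assms(1) unfolding Tf_def by blast
  show ?thesis unfolding w(1) by (rule d.U_commute[OF d.G_S[OF w(2)] assms(2)])
qed

lemma Tf_UG: assumes "t \<in> Tf" "z \<in> G f" shows "t ** (U ** z ** U) = (U ** z ** U) ** t"
proof -
  obtain w where w: "t = U ** w ** U" "w \<in> d.G f" using assms(1) unfolding Tf_def by blast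
  have "z ** w = w ** z" by (rule G_dual_commute[OF psub_f assms(2) w(2)])
  then have "U ** (w ** z) ** U = U ** (z ** w) ** U" by simp
  then show ?thesis unfolding w(1) by (simp flip: matrix_mul_assoc)
qed

lemma A_dual_commute: assumes "a \<in> A" "y \<in> d.G f" shows "a ** y = y ** a"
  using assms(1) unfolding A_def
proof (rule cspan_op_commute)
  fix b assume "b \<in> {x ** y |x y. x \<in> Tf \<and> y \<in> G f}"
  then obtain t x where b: "b = t ** x" "t \<in> Tf" "x \<in> G f" by blast
  have "t ** y = y ** t" "x ** y = y ** x"
    by (rule Tf_commute[OF b(2) d.G_S[OF assms(2)]], rule G_dual_commute[OF psub_f b(3) assms(2)])
  then show "b ** y = y ** b" unfolding b(1) by (rule commute_mult)
qed

lemma A_UG_commute: assumes "a \<in> A" "z \<in> G f" shows "a ** (U ** z ** U) = (U ** z ** U) ** a"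
  using assms(1) unfolding A_def
proof (rule cspan_op_commute)
  fix b assume "b \<in> {x ** y |x y. x \<in> Tf \<and> y \<in> G f}"
  then obtain t x where b: "b = t ** x" "t \<in> Tf" "x \<in> G f" by blast
  have "t ** (U ** z ** U) = (U ** z ** U) ** t" "x ** (U ** z ** U) = (U ** z ** U) ** x"
    using Tf_UG[OF b(2) assms(2)] U_commute[OF G_S[OF assms(2)] G_S[OF b(3)]] by simp_all
  then show "b ** (U ** z ** U) = (U ** z ** U) ** b" unfolding b(1) by (rule commute_mult)
qed

text \<open>With the two preceding lemmas, A is the commutant of \<open>d.G f\<close> and U G_f U.
  Applying U to \<open>A_cyclic\<close> shows that products from these two families move g to a
  spanning set, so T is determined by T g, and A contains an element with the same value at
  g.\<close>

lemma A_commutant: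
  assumes "\<And>y. y \<in> d.G f \<Longrightarrow> T ** y = y ** T" "\<And>z. z \<in> G f \<Longrightarrow> T ** (U ** z ** U) = (U ** z ** U) ** T"
  shows "T \<in> A"
proof -
  obtain a where a: "a \<in> A" "T *v g = a *v g" using A_cyclic'[of "T *v g"] by (elim bexE)
  have *: "M *v \<xi> = N *v \<xi>" if M: "\<And>y. y \<in> d.G f \<Longrightarrow> M ** y = y ** M" "\<And>z. z \<in> G f \<Longrightarrow> M ** (U ** z ** U) = (U ** z ** U) ** M"
    and N: "\<And>y. y \<in> d.G f \<Longrightarrow> N ** y = y ** N" "\<And>z. z \<in> G f \<Longrightarrow> N ** (U ** z ** U) = (U ** z ** U) ** N"
    and MN: "M *v g = N *v g" for M N \<xi>
  proof -
    obtain t x where tx: "\<forall>k. t k \<in> Tf \<and> x k \<in> G f" and \<xi>: "U *v \<xi> = (\<Sum>k\<in>(UNIV::'n set). (t k ** x k) *v g)"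
      using A_cyclic[of "U *v \<xi>"] by (elim exE conjE)
    have x: "x k \<in> G f" for k using tx by (elim allE[of _ k] conjE)
    have "\<exists>w\<in>d.G f. t k = U ** w ** U" for k using spec[OF tx, of k] unfolding Tf_def by blast
    then have "\<forall>k. \<exists>w\<in>d.G f. t k = U ** w ** U" by (rule allI)
    then obtain w where w: "\<And>k. w k \<in> d.G f" "\<And>k. t k = U ** w k ** U" by metis
    have "\<xi> = U *v (U *v \<xi>)" by simp
    also have "\<dots> = (\<Sum>k\<in>(UNIV::'n set). (w k ** (U ** x k ** U)) *v g)"
      unfolding \<xi> by (simp add: w(2) mv_sum U_f psub_g flip: matrix_vector_mul_assoc)
    finally have \<xi>': "\<xi> = (\<Sum>k\<in>(UNIV::'n set). (w k ** (U ** x k ** U)) *v g)" .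
    have "L *v \<xi> = (\<Sum>k\<in>(UNIV::'n set). (w k ** (U ** x k ** U)) *v (L *v g))"
      if L: "\<And>y. y \<in> d.G f \<Longrightarrow> L ** y = y ** L" "\<And>z. z \<in> G f \<Longrightarrow> L ** (U ** z ** U) = (U ** z ** U) ** L" for L
    proof -
      have "L ** (w k ** (U ** x k ** U)) = (w k ** (U ** x k ** U)) ** L" for k
        using commute_mult[OF L(1)[OF w(1)[of k], symmetric] L(2)[OF x(1)[of k], symmetric]] by simp
      then show ?thesis by (subst \<xi>') (simp only: mv_sum matrix_vector_mul_assoc)
    qed
    from this[OF M] this[OF N] show ?thesis by (simp only: MN)
  qed
  have "T = a"
    by (rule mat_ext_mv, rule *[OF assms A_dual_commute[OF a(1)] A_UG_commute[OF a(1)] a(2)])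
  then show ?thesis using a by simp
qed

text \<open>The part of X that V does not account for; W = (Y V) N splits off a factor commuting
  with A \<otimes> 1.\<close>

definition N where "N = cadj V ** X"

lemma kron_Tf: assumes "t \<in> Tf" "\<And>k l. blk2 Z k l \<in> d.S" shows "Z ** kron t (mat 1) = kron t (mat 1) ** Z"
  unfolding kron_commute1 using Tf_commute[OF assms(1)] assms(2) by simp

lemma blk2_cadj_V: "blk2 (cadj V) k l \<in> d.S"
  using d.S_cadj[OF blk2_dual_S] by (simp add: blk_cadj)

lemma N_A: assumes "a \<in> A" shows "N ** kron a (mat 1) = kron a (mat 1) ** N"
proof -
  have "A \<subseteq> {a. N ** kron a (mat 1) = kron a (mat 1) ** N}"
    unfolding A_def
  proof (rule cspan_op_minimal)
    show "csub {a. N ** kron a (mat 1) = kron a (mat 1) ** N}"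
      by (auto simp: csub_def kron_add kron_cmscale matrix_add_ldistrib matrix_add_rdistrib cmscale_mult_left cmscale_mult_right)
    show "{x ** y |x y. x \<in> Tf \<and> y \<in> G f} \<subseteq> {a. N ** kron a (mat 1) = kron a (mat 1) ** N}"
    proof
      fix b assume "b \<in> {x ** y |x y. x \<in> Tf \<and> y \<in> G f}"
      then obtain t x where b: "b = t ** x" "t \<in> Tf" "x \<in> G f" by blast
      have 1: "cadj V ** kron t (mat 1) = kron t (mat 1) ** cadj V"
        by (rule kron_Tf[OF b(2)]) (rule blk2_cadj_V)
      have 2: "X ** kron t (mat 1) = kron t (mat 1) ** X"
        by (rule kron_Tf[OF b(2)]) (rule d.D_S[OF blk2_X])
      have 3: "N ** kron t (mat 1) = kron t (mat 1) ** N"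
        unfolding N_def by (rule commute_mult[OF 1 2])
      have "N ** kron x (mat 1) = cadj V ** (delta x ** X)"
        by (simp add: N_def X_G[OF b(3)] flip: matrix_mul_assoc)
      also have "\<dots> = kron x (mat 1) ** N"
        by (simp add: N_def delta_def flip: matrix_mul_assoc)
      finally have 4: "N ** kron x (mat 1) = kron x (mat 1) ** N" .
      have "N ** (kron t (mat 1) ** kron x (mat 1)) = (kron t (mat 1) ** kron x (mat 1)) ** N"
        by (rule commute_mult[OF 3[symmetric] 4[symmetric], symmetric])
      then show "b \<in> {a. N ** kron a (mat 1) = kron a (mat 1) ** N}"
        by (simp add: b(1) kron_mult)
    qed
  qed
  then show ?thesis using assms by blast
qed

lemma one_d_G: "mat 1 \<in> d.G f" by (rule d.one_G[OF d_psub(1)])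

lemma one_Tf: "mat 1 \<in> Tf"
  unfolding Tf_def using one_d_G by (intro CollectI exI[of _ "mat 1"]) simp

lemma G_A: "x \<in> G f \<Longrightarrow> x \<in> A"
  using A_I[OF one_Tf, of x] by simp

lemma X_A: assumes "a \<in> A" shows "X ** kron a (mat 1) = delta a ** X"
proof -
  have "V ** (N ** kron a (mat 1)) = V ** (kron a (mat 1) ** N)" by (simp add: N_A assms)
  then show ?thesis by (simp add: N_def delta_def matrix_mul_assoc)
qed

lemma pentagon_W: "leg12 W ** leg13 W ** leg23 W = leg23 W ** leg12 W"
proof -
  define M where "M = Y ** V"
  have M: "cadj M ** M = mat 1" "M ** cadj M = mat 1"
    by (simp_all add: M_def cadj_mult flip: matrix_mul_assoc)
  have WM: "W = M ** N" by (simp add: W_def M_def N_def flip: matrix_mul_assoc)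
  have legM [simp]: "leg12 (cadj M) ** (leg12 M ** Z) = Z" for Z
    by (simp add: matrix_mul_assoc leg12_one M flip: leg_hom)
  have legV [simp]: "leg12 V ** (leg12 (cadj V) ** Z) = Z" "leg12 (cadj V) ** (leg12 V ** Z) = Z"
    "leg13 V ** (leg13 (cadj V) ** Z) = Z" "leg13 (cadj V) ** (leg13 V ** Z) = Z" for Z
    by (simp_all add: matrix_mul_assoc leg12_one leg13_one flip: leg_hom)
  \<comment> \<open>The first leg of Y lies in \<open>D g\<close>, and Y V carries x \<otimes> 1 to
    1 \<otimes> x for such x.\<close>
  have K: "leg23 Y ** leg12 M = leg12 M ** leg13 Y"
  proof (rule leg23_leg12_leg13)
    fix i j
    show "kron (mat 1) (blk2 Y i j) ** M = M ** kron (blk2 Y i j) (mat 1)"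
      using Y_D[OF blk2_Y[of i j]] by (simp add: M_def matrix_mul_assoc) (simp add: delta_def flip: matrix_mul_assoc)
  qed
  \<comment> \<open>The first leg of X lies in the dual algebra, the second leg of Y in its
    commutant.\<close>
  have XY: "leg23 X ** leg12 Y = leg12 Y ** leg23 X"
    by (rule leg23_leg12_commute, rule kron_Tf[OF blk1_Y]) (rule d.D_S[OF blk2_X])
  have Q1_eq: "leg23 W ** leg12 W = leg12 M ** (leg13 Y ** (leg12 (cadj V) ** (leg23 X ** leg12 X)))"
  proof -
    have "leg23 W ** leg12 W = leg23 Y ** (leg23 X ** leg12 Y) ** leg12 X"
      by (simp add: W_def leg_hom matrix_mul_assoc)
    also have "\<dots> = (leg23 Y ** leg12 M) ** leg12 (cadj V) ** leg23 X ** leg12 X"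
      unfolding XY by (simp add: M_def leg_hom flip: matrix_mul_assoc)
    finally show ?thesis unfolding K by (simp flip: matrix_mul_assoc)
  qed
  \<comment> \<open>\<open>\<Theta>\<close> is \<open>a \<otimes> 1 \<otimes> 1\<close> conjugated by \<open>Y\<^sub>1\<^sub>2V\<^sub>1\<^sub>2Y\<^sub>1\<^sub>3V\<^sub>1\<^sub>3\<close>.\<close>
  have main: "\<exists>\<Theta>. leg23 W ** leg12 W ** leg12 (kron a (mat 1)) = \<Theta> ** (leg23 W ** leg12 W) \<and>
      leg12 W ** leg13 W ** leg23 W ** leg12 (kron a (mat 1)) = \<Theta> ** (leg12 W ** leg13 W ** leg23 W)"
    if ta: "a = t ** x" "t \<in> Tf" "x \<in> G f" for a t x
  proof -
    let ?a = "leg12 (kron a (mat 1))"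
    have aA: "a \<in> A" using ta by (simp add: A_I)
    have tV: "V ** kron t (mat 1) = kron t (mat 1) ** V"
      by (rule kron_Tf[OF ta(2)]) (rule blk2_dual_S)
    have da: "delta a = kron t (mat 1) ** delta x"
      using tV by (simp add: ta(1) delta_def matrix_mul_assoc kron_mult[of t "mat 1" x "mat 1", simplified, symmetric])
    have da1: "blk1 (delta a) i j \<in> G f" for i j
      unfolding da blk_mult blk_kron cmscale_mult_left by (intro csub_sum csub_scale csub_G) (simp add: delta_blk1_G psub_f ta(3))
    \<comment> \<open>This is a \<otimes> 1 conjugated by W. Its first leg must lie in A for N to
      pass it, and the commutant description makes that checkable.\<close>
    define \<Delta> where "\<Delta> = Y ** delta a ** cadj Y"
    have \<Delta>A: "blk2 \<Delta> k l \<in> A" for k l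
    proof (rule A_commutant)
      fix y assume y: "y \<in> d.G f"
      have 1: "kron y (mat 1) ** Y = Y ** bet y" by (rule Y_dual_G[OF y])
      have "cadj (kron (cadj y) (mat 1) ** Y) = cadj (Y ** bet (cadj y))"
        using Y_dual_G[OF d.G_cadj[OF d_psub(1) y]] by simp
      then have 2: "cadj Y ** kron y (mat 1) = bet y ** cadj Y"
        by (simp add: cadj_mult cadj_kron bet_cadj)
      have "\<Delta> ** kron y (mat 1) = Y ** (delta a ** bet y) ** cadj Y"
        by (simp add: \<Delta>_def 2 flip: matrix_mul_assoc)
      also have "\<dots> = kron y (mat 1) ** \<Delta>"
        by (simp only: delta_bet) (simp add: \<Delta>_def 1 matrix_mul_assoc)
      finally have "\<forall>k l. blk2 \<Delta> k l ** y = y ** blk2 \<Delta> k l" unfolding kron_commute1 .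
      then show "blk2 \<Delta> k l ** y = y ** blk2 \<Delta> k l" by blast
    next
      fix z assume z: "z \<in> G f"
      let ?z = "kron (U ** z ** U) (mat 1)"
      have s: "Z ** ?z = ?z ** Z" if "\<And>k l. blk2 Z k l \<in> S" for Z
        unfolding kron_commute1 using U_commute[OF G_S[OF z] that] by simp
      have 1: "Y ** ?z = ?z ** Y" by (rule s) (rule D_S[OF blk2_Y])
      have 2: "cadj Y ** ?z = ?z ** cadj Y" by (rule s) (simp add: blk_cadj S_cadj D_S[OF blk2_Y])
      have 3: "delta x ** ?z = ?z ** delta x" by (rule s) (rule delta_blk(2)[OF G_S[OF ta(3)]])
      have 4: "kron t (mat 1) ** ?z = ?z ** kron t (mat 1)" by (simp add: kron_mult Tf_UG ta(2) z)
      have "\<Delta> ** ?z = ?z ** \<Delta>"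
        unfolding \<Delta>_def da by (intro commute_mult 1 2 3 4)
      then have "\<forall>k l. blk2 \<Delta> k l ** (U ** z ** U) = (U ** z ** U) ** blk2 \<Delta> k l" unfolding kron_commute1 .
      then show "blk2 \<Delta> k l ** (U ** z ** U) = (U ** z ** U) ** blk2 \<Delta> k l" by blast
    qed
    have \<Delta>Y: "\<Delta> ** Y = Y ** delta a" by (simp add: \<Delta>_def flip: matrix_mul_assoc)
    have Wa0: "W ** kron a (mat 1) = Y ** delta a ** X"
      by (simp add: W_def X_A[OF aA] flip: matrix_mul_assoc)
    then have Wa: "W ** kron a (mat 1) = \<Delta> ** W"
      by (simp add: W_def matrix_mul_assoc flip: \<Delta>Y)
    define \<Theta> where "\<Theta> = leg12 M ** leg13 \<Delta> ** leg12 (cadj M)"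
    have N\<Delta>: "leg12 N ** leg13 \<Delta> = leg13 \<Delta> ** leg12 N"
      by (rule leg12_leg13_commute) (rule N_A[OF \<Delta>A])
    have W\<Delta>: "leg12 W ** leg13 \<Delta> = \<Theta> ** leg12 W"
    proof -
      have "leg12 W ** leg13 \<Delta> = leg12 M ** (leg12 N ** leg13 \<Delta>)"
        by (simp add: WM leg_hom flip: matrix_mul_assoc)
      also have "\<dots> = \<Theta> ** leg12 W"
        unfolding N\<Delta> by (simp add: \<Theta>_def WM leg_hom flip: matrix_mul_assoc)
      finally show ?thesis .
    qed
    have "leg12 W ** leg13 W ** leg23 W ** ?a = leg12 W ** (leg13 W ** ?a) ** leg23 W"
      by (simp add: leg23_leg1_commute flip: matrix_mul_assoc)
    also have "leg13 W ** ?a = leg13 \<Delta> ** leg13 W"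
      by (simp add: Wa flip: leg1 leg_hom)
    also have "leg12 W ** (leg13 \<Delta> ** leg13 W) ** leg23 W = (leg12 W ** leg13 \<Delta>) ** leg13 W ** leg23 W"
      by (simp add: matrix_mul_assoc)
    finally have Q2: "leg12 W ** leg13 W ** leg23 W ** ?a = \<Theta> ** (leg12 W ** leg13 W ** leg23 W)"
      unfolding W\<Delta> by (simp add: matrix_mul_assoc)
    \<comment> \<open>The second leg of \<delta>(a) lies in \<open>G f\<close>, hence in A, so N on
      the last two legs passes it.\<close>
    have Nd: "leg23 N ** leg12 (delta a) = leg12 (delta a) ** leg23 N"
      by (rule leg23_leg12_commute) (rule N_A[OF G_A[OF da1]])
    have XN: "X = V ** N" by (simp add: N_def)
    \<comment> \<open>Here the pentagon equation for V enters: it carries the coproduct of a from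
      legs 12 to legs 13.\<close>
    have Va: "leg23 V ** leg12 (delta a) ** leg23 N = leg12 V ** leg13 (delta a) ** leg12 (cadj V) ** leg23 X"
    proof -
      have p: "leg13 V ** leg23 V ** leg12 (cadj V) = leg12 (cadj V) ** leg23 V"
      proof -
        have "leg12 (cadj V) ** (leg12 V ** leg13 V ** leg23 V) ** leg12 (cadj V) = leg12 (cadj V) ** (leg23 V ** leg12 V) ** leg12 (cadj V)"
          by (simp add: pentagon)
        moreover have "leg12 V ** leg12 (cadj V) = mat 1" by (simp add: leg12_one flip: leg_hom)
        ultimately show ?thesis by (simp flip: matrix_mul_assoc)
      qed
      have "leg23 V ** leg12 (delta a) ** leg23 N = (leg23 V ** leg12 V) ** ?a ** leg12 (cadj V) ** leg23 N"
        by (simp add: delta_def leg_hom matrix_mul_assoc)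
      also have "\<dots> = leg12 V ** leg13 V ** (leg23 V ** ?a) ** leg12 (cadj V) ** leg23 N"
        unfolding pentagon[symmetric] by (simp add: matrix_mul_assoc)
      also have "\<dots> = leg12 V ** (leg13 V ** ?a) ** (leg23 V ** leg12 (cadj V)) ** leg23 N"
        unfolding leg23_leg1_commute by (simp add: matrix_mul_assoc)
      also have "leg13 V ** ?a = leg13 (delta a) ** leg13 V"
      proof -
        have "leg13 (cadj V) ** leg13 V = mat 1" by (simp add: leg13_one flip: leg_hom)
        then show ?thesis by (simp add: delta_def leg_hom leg1 flip: matrix_mul_assoc)
      qed
      also have "leg12 V ** (leg13 (delta a) ** leg13 V) ** (leg23 V ** leg12 (cadj V)) ** leg23 N =
         leg12 V ** leg13 (delta a) ** (leg13 V ** leg23 V ** leg12 (cadj V)) ** leg23 N"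
        by (simp add: matrix_mul_assoc)
      also have "\<dots> = leg12 V ** leg13 (delta a) ** leg12 (cadj V) ** leg23 X"
        unfolding p by (simp add: XN leg_hom matrix_mul_assoc)
      finally show ?thesis .
    qed
    have "leg23 W ** leg12 W ** ?a = leg23 W ** leg12 Y ** leg12 (delta a) ** leg12 X"
    proof -
      have "leg12 W ** ?a = leg12 Y ** leg12 (delta a) ** leg12 X"
        using arg_cong[OF Wa0, of leg12] by (simp only: leg_hom)
      then show ?thesis by (simp flip: matrix_mul_assoc)
    qed
    also have "\<dots> = leg23 Y ** (leg23 X ** leg12 Y) ** leg12 (delta a) ** leg12 X"
      by (simp add: W_def leg_hom matrix_mul_assoc)
    also have "\<dots> = leg23 Y ** leg12 Y ** (leg23 V ** (leg23 N ** leg12 (delta a))) ** leg12 X"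
      unfolding XY by (simp add: XN leg_hom matrix_mul_assoc)
    also have "\<dots> = leg23 Y ** leg12 Y ** (leg23 V ** leg12 (delta a) ** leg23 N) ** leg12 X"
      unfolding Nd by (simp add: matrix_mul_assoc)
    also have "\<dots> = (leg23 Y ** leg12 M) ** leg13 (delta a) ** leg12 (cadj V) ** leg23 X ** leg12 X"
      unfolding Va by (simp add: M_def leg_hom matrix_mul_assoc)
    also have "\<dots> = leg12 M ** leg13 (Y ** delta a) ** leg12 (cadj V) ** leg23 X ** leg12 X"
      unfolding K by (simp add: leg_hom matrix_mul_assoc)
    also have "\<dots> = \<Theta> ** (leg23 W ** leg12 W)"
      unfolding Q1_eq \<Delta>Y[symmetric] by (simp add: \<Theta>_def leg_hom flip: matrix_mul_assoc)
    finally show ?thesis using Q2 by blast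
  qed
  have f: "(leg12 W ** leg13 W ** leg23 W) *v tens1 g s = (leg23 W ** leg12 W) *v tens1 g s" for s
    by (simp add: tens1_leg23 tens1_fixed W_fixed flip: matrix_vector_mul_assoc)
  show ?thesis
  proof (rule mat_ext_tens1)
    fix \<xi> s
    obtain t x where tx0: "\<forall>k. t k \<in> Tf \<and> x k \<in> G f" and \<xi>: "\<xi> = (\<Sum>k\<in>(UNIV::'n set). (t k ** x k) *v g)"
      using A_cyclic[of \<xi>] by (elim exE conjE)
    have tx: "t k \<in> Tf" "x k \<in> G f" for k using tx0 by simp_all
    have "(leg12 W ** leg13 W ** leg23 W) *v tens1 ((t k ** x k) *v g) s = (leg23 W ** leg12 W) *v tens1 ((t k ** x k) *v g) s" for k
    proof -
      let ?a = "leg12 (kron (t k ** x k) (mat 1))"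
      obtain \<Theta> where \<Theta>: "leg23 W ** leg12 W ** ?a = \<Theta> ** (leg23 W ** leg12 W)"
        "leg12 W ** leg13 W ** leg23 W ** ?a = \<Theta> ** (leg12 W ** leg13 W ** leg23 W)"
        using main[OF refl tx(1,2)] by blast
      have "(leg12 W ** leg13 W ** leg23 W ** ?a) *v tens1 g s = (leg23 W ** leg12 W ** ?a) *v tens1 g s"
        unfolding \<Theta> using f by (simp add: matrix_vector_mul_assoc[symmetric, of \<Theta>])
      then show ?thesis
        by (simp add: tens1_leg1 matrix_vector_mul_assoc[symmetric, of _ ?a])
    qed
    then show "(leg12 W ** leg13 W ** leg23 W) *v tens1 \<xi> s = (leg23 W ** leg12 W) *v tens1 \<xi> s"
      unfolding \<xi> tens1_sum mv_sum by simp
  qed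
qed

lemma W_munitary_one:
  assumes "cinner f g = complex_of_real (1 / sqrt (real CARD('n)))"
  shows "munitary_one W g f"
proof (unfold_locales)
  show "mult_unitary W" using W_unitary pentagon_W by (simp add: mult_unitary_def unitary_op_def)
  show "norm g = 1" "norm f = 1" using psub_f psub_g by (simp_all add: psub_def)
  show "fixedv W g" "cofixedv W f" by (simp_all add: fixedv_def cofixedv_def W_fixed W_cofixed)
  show "cinner g f = complex_of_real (1 / sqrt (real CARD('n)))"
    using assms cinner_commute[of g f] by simp
qed (rule W_fixed_line)

end

text \<open>Since U fixes v, the vector v is cyclic for U A U as well, and this set commutes with A.
  A vector cyclic for commuting operators is separating.\<close>

lemma separating:
  fixes A :: "(complex^'n::finite^'n) set"
  assumes c: "\<And>a b. a \<in> A \<Longrightarrow> b \<in> A \<Longrightarrow> a ** (U ** b ** U) = (U ** b ** U) ** a"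
    and cyc: "\<And>\<xi>. \<exists>a\<in>A. \<xi> = a *v v" and U: "U ** U = mat 1" "U *v v = v"
    and ab: "a \<in> A" "b \<in> A" "a *v v = b *v v"
  shows "a = b"
proof (rule mat_ext_mv)
  fix \<xi>
  obtain z where z: "z \<in> A" "U *v \<xi> = z *v v" using cyc by blast
  have "\<xi> = U *v (U *v \<xi>)" by (simp add: matrix_vector_mul_assoc U)
  then have \<xi>: "\<xi> = (U ** z ** U) *v v" by (simp add: z U flip: matrix_vector_mul_assoc)
  have "w *v \<xi> = (U ** z ** U) *v (w *v v)" if "w \<in> A" for w
    unfolding \<xi> by (simp add: matrix_vector_mul_assoc c[OF that z(1)])
  then show "a *v \<xi> = b *v \<xi>" using ab by simp
qed

section \<open>The slice algebras of W\<close>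

context complementary_pair begin

interpretation d: complementary_pair "dualV V" e' e U f g by (rule dual_complementary_pair)

text \<open>The coefficients of X and Y put the slices inside A and B. Conversely, a and the slice
  with value a g at g coincide because g separates A; likewise f separates B, its cyclicity coming
  from the inclusion already shown.\<close>

lemma W_algebras:
  assumes fg: "cinner f g = complex_of_real (1 / sqrt (real CARD('n)))"
  shows "leftS W = A" "rightS W = B"
proof -
  interpret w: munitary_one W g f by (rule W_munitary_one[OF fg])
  interpret dw: munitary_one "dualV W" f g by (rule w.dual_munitary_one)
  have 1: "leftS W \<subseteq> A"
  proof -
    have "blk1 W i j \<in> A" for i j
      unfolding W_def blk_mult by (intro csub_sum csub_A A_I blk1_Y blk1_X)
    then show ?thesis by (auto simp: leftS_def intro!: slice_left_in csub_A)
  qed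
  have 2: "rightS W \<subseteq> B"
  proof -
    have "blk2 W i j \<in> B" for i j
      unfolding W_def blk_mult by (intro csub_sum csub_B B_I blk2_Y blk2_X)
    then show ?thesis by (auto simp: rightS_def intro!: slice_right_in csub_B)
  qed
  have UU': "U ** (a ** b) ** U = (U ** a ** U) ** (U ** b ** U)" for a b
    by (simp flip: matrix_mul_assoc)
  have comm: "a ** (U ** b ** U) = (U ** b ** U) ** a"
    if a: "a \<in> cspan_op Q" and b: "b \<in> cspan_op Q"
    and Q: "\<And>x y. x \<in> Q \<Longrightarrow> y \<in> Q \<Longrightarrow> x ** (U ** y ** U) = (U ** y ** U) ** x" for a b Q
  proof -
    have "x ** (U ** b ** U) = (U ** b ** U) ** x" if "x \<in> Q" for x
    proof -
      have "b ** (U ** x ** U) = (U ** x ** U) ** b"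
      proof (rule cspan_op_commute[OF b])
        fix y assume "y \<in> Q"
        then show "y ** (U ** x ** U) = (U ** x ** U) ** y" using Q that by blast
      qed
      then have "U ** (b ** (U ** x ** U)) ** U = U ** ((U ** x ** U) ** b) ** U" by simp
      then show ?thesis by (simp flip: matrix_mul_assoc)
    qed
    then show ?thesis by (rule cspan_op_commute[OF a])
  qed
  show "leftS W = A"
  proof
    show "A \<subseteq> leftS W"
    proof
      fix a assume a: "a \<in> A"
      let ?b = "w.lam (a *v g)"
      have b: "?b \<in> leftS W" by (simp add: w.leftS_eq)
      have "a = ?b"
      proof (rule separating[of A U g])
        fix x y assume "x \<in> A" "y \<in> A"
        then show "x ** (U ** y ** U) = (U ** y ** U) ** x"
          unfolding A_def
        proof (rule comm)
          fix x y assume "x \<in> {x ** y |x y. x \<in> Tf \<and> y \<in> G f}" "y \<in> {x ** y |x y. x \<in> Tf \<and> y \<in> G f}"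
          then obtain t z where y: "y = t ** z" "t \<in> Tf" "z \<in> G f" and x: "x \<in> A"
            using A_I by blast
          obtain u where u: "t = U ** u ** U" "u \<in> d.G f" using y(2) unfolding Tf_def by blast
          have "x ** u = u ** x" "x ** (U ** z ** U) = (U ** z ** U) ** x"
            using A_dual_commute[OF x u(2)] A_UG_commute[OF x y(3)] by blast+
          moreover have "U ** y ** U = u ** (U ** z ** U)"
            by (simp add: y(1) u(1) flip: matrix_mul_assoc)
          ultimately show "x ** (U ** y ** U) = (U ** y ** U) ** x"
            using commute_mult[of u x "U ** z ** U"] by simp
        qed
      qed (use A_cyclic' a b 1 U_f[OF psub_g] in auto)
      then show "a \<in> leftS W" using b by simp
    qed
  qed (rule 1)
  show "rightS W = B"
  proof
    show "B \<subseteq> rightS W"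
    proof
      fix a assume a: "a \<in> B"
      have r: "dw.lam \<xi> \<in> rightS W" for \<xi> by (simp add: w.rightS_eq)
      have "a = dw.lam (a *v f)"
      proof (rule separating[of B U f])
        show "\<exists>b\<in>B. \<xi> = b *v f" for \<xi>
          using r[of \<xi>] 2 by (intro bexI[of _ "dw.lam \<xi>"]) auto
        fix x y assume "x \<in> B" "y \<in> B"
        then show "x ** (U ** y ** U) = (U ** y ** U) ** x"
          unfolding B_def
        proof (rule comm)
          fix x y assume "x \<in> {x ** y |x y. x \<in> D g \<and> y \<in> d.D g}" "y \<in> {x ** y |x y. x \<in> D g \<and> y \<in> d.D g}"
          then obtain s t s' t' where x: "x = s ** t" "s \<in> D g" "t \<in> d.D g" and y: "y = s' ** t'" "s' \<in> D g" "t' \<in> d.D g"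
            by blast
          have 1: "s ** (U ** s' ** U) = (U ** s' ** U) ** s" using U_commute D_S x y by metis
          have 2: "t ** (U ** t' ** U) = (U ** t' ** U) ** t" using d.U_commute d.D_S x y by metis
          have 3: "s ** (U ** t' ** U) = (U ** t' ** U) ** s" using D_dual_commute[OF psub_g x(2) y(3)] .
          have "s' ** (U ** t ** U) = (U ** t ** U) ** s'" using D_dual_commute[OF psub_g y(2) x(3)] .
          then have "U ** (s' ** (U ** t ** U)) ** U = U ** ((U ** t ** U) ** s') ** U" by simp
          then have 4: "t ** (U ** s' ** U) = (U ** s' ** U) ** t" by (simp flip: matrix_mul_assoc)
          show "x ** (U ** y ** U) = (U ** y ** U) ** x"
            unfolding x(1) y(1) UU'
            by (rule commute_mult[OF commute_mult[OF 1[symmetric] 3[symmetric], symmetric] commute_mult[OF 4[symmetric] 2[symmetric], symmetric]])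
        qed
      qed (use a r 2 U_f[OF psub_f] in auto)
      then show "a \<in> rightS W" using r by metis
    qed
  qed (rule 2)
qed

end

section \<open>From the hypotheses of the theorem to a complementary pair\<close>

lemma mult_one_line:
  assumes "mult_one V" "fixedv V e" "norm e = 1" "fixedv V \<eta>" shows "\<eta> = cinner e \<eta> *s e"
proof -
  obtain \<xi> where \<xi>: "{\<eta>. fixedv V \<eta>} = range (\<lambda>c. c *s \<xi>)" using assms(1) by (auto simp: mult_one_def)
  obtain s t where s: "e = s *s \<xi>" and t: "\<eta> = t *s \<xi>" using \<xi> assms(2,4) by blast
  have e: "cinner e e = 1" using assms(3) by (simp add: cinner_self)
  then have "s \<noteq> 0" unfolding s by (auto simp: cinner_scale_left)
  then have "\<eta> = (t / s) *s e" by (simp add: s t vector_smult_assoc)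
  then show ?thesis using e by (simp add: cinner_scale_right)
qed

context munitary_U begin

text \<open>The orthogonality \<open>\<langle>f,g\<rangle> = n\<^sup>-\<^sup>1\<^sup>/\<^sup>2\<close> is the extremal value: the traces of \<open>p f p g\<close> and of
  \<open>ph f ph g\<close> are inverse to each other, and both are at least one.\<close>
lemma complementary_pairI:
  assumes f: "psub f" and g: "psub g"
    and a: "cinner f e = complex_of_real a" "a > 0" and b: "cinner g e = complex_of_real b" "b > 0"
    and fg: "cinner f g = complex_of_real (1 / sqrt (real CARD('n)))"
  shows "complementary_pair V e e' U f g"
proof -
  interpret d: munitary_U "dualV V" e' e U by (rule dual_munitary_U)
  define r where "r = sqrt (real CARD('n))"
  have r: "r > 0" "r * r = real CARD('n)" "sN = complex_of_real r" by (simp_all add: r_def sN_eq)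
  have df: "d.psub f" "d.psub g" using f g by (simp_all add: psub_dual)
  have ef: "cinner e f = complex_of_real a" "cinner e g = complex_of_real b"
    using a b by (simp_all add: cinner_commute[of e])
  have e'f: "cinner e' f = complex_of_real (1 / (a * r))"
    using psub_product[OF f] a(2) r(1) by (simp add: a(1) r(3) field_simps)
  have e'g: "cinner e' g = complex_of_real (1 / (b * r))"
    using psub_product[OF g] b(2) r(1) by (simp add: b(1) r(3) field_simps)
  have fe': "cinner f e' = complex_of_real (1 / (a * r))" "cinner g e' = complex_of_real (1 / (b * r))"
    using e'f e'g by (simp_all add: cinner_commute[of _ e'])
  have n: "of_nat CARD('n) = complex_of_real (r * r)" by (simp add: r(2))
  have tp: "trace (p f) = complex_of_real (r * r * (a * a))" "trace (p g) = complex_of_real (r * r * (b * b))"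
    using trace_S[OF p_S[of f]] trace_S[OF p_S[of g]] by (simp_all add: p_e f g cinner_scale_right a b ef n)
  have tph: "trace (ph f) = complex_of_real (1 / (a * a))" "trace (ph g) = complex_of_real (1 / (b * b))"
    using d.trace_S[OF d.p_S[of f]] d.trace_S[OF d.p_S[of g]] r(1) a(2) b(2)
    by (simp_all add: ph_dual f g ph_e' cinner_scale_right e'f e'g fe' n field_simps)
  \<comment> \<open>\<open>p f\<close> sends e to \<langle>f,e\<rangle> f and \<open>p g\<close>
    sends it to \<langle>g,e\<rangle> g, so the trace is n a b \<langle>f,g\<rangle> and the
    hypothesis on \<langle>f,g\<rangle> enters.\<close>
  have t1: "trace (p f ** p g) = complex_of_real (a * b * r)"
  proof -
    have "trace (p f ** p g) = of_nat CARD('n) * cinner (p f *v e) (p g *v e)"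
      by (simp add: trace_S S_mult cinner_adj' p_selfadjoint f flip: matrix_vector_mul_assoc)
    then show ?thesis
      using r(1) by (simp add: p_e f g a b cinner_scale_left cinner_scale_right fg n field_simps flip: r_def)
  qed
  have t2: "trace (ph f ** ph g) = complex_of_real (1 / (a * b * r))"
  proof -
    have "trace (ph f ** ph g) = of_nat CARD('n) * cinner (ph f *v e') (ph g *v e')"
      using d.trace_S[OF d.S_mult[OF d.p_S[of f] d.p_S[of g]]]
      by (simp add: ph_dual f g cinner_adj' ph_selfadjoint flip: matrix_vector_mul_assoc)
    then show ?thesis
      using r(1) a(2) b(2) by (simp add: ph_e' f g fe' cinner_scale_left cinner_scale_right fg n field_simps flip: r_def)
  qed
  have i: "p f ** p f = p f" "cadj (p f) = p f" "p f *v e' = e'" "p g ** p g = p g" "cadj (p g) = p g" "p g *v e' = e'"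
    "ph f ** ph f = ph f" "cadj (ph f) = ph f" "ph f *v e = e" "ph g ** ph g = ph g" "cadj (ph g) = ph g" "ph g *v e = e"
    by (simp_all add: f g p_idem p_selfadjoint p_e' ph_idem ph_selfadjoint ph_e)
  have "a * b * r \<ge> 1" using projection_pair(1)[OF i(1-6) e_e(2)] by (simp add: t1)
  moreover have "1 / (a * b * r) \<ge> 1" using projection_pair(1)[OF i(7-12) e_e(1)] by (simp add: t2)
  ultimately have abr: "a * b * r = 1" using a(2) b(2) r(1) by (simp add: field_simps)
  have rr: "r * r * (a * a) * (r * r * (b * b)) = r * r" "1 / (a * a) * (1 / (b * b)) = r * r"
  proof -
    have "r * r * (a * a) * (r * r * (b * b)) = (a * b * r) * (a * b * r) * (r * r)" by (simp add: mult_ac)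
    then show "r * r * (a * a) * (r * r * (b * b)) = r * r" by (simp add: abr)
    have "r * r * ((a * a) * (b * b)) = (a * b * r) * (a * b * r)" by (simp add: mult_ac)
    then have "r * r * ((a * a) * (b * b)) = 1" by (simp add: abr)
    then show "1 / (a * a) * (1 / (b * b)) = r * r" using a(2) b(2) by (simp add: field_simps)
  qed
  show ?thesis
  proof (unfold_locales)
    show "p f ** p g = ketbra e' e'" by (rule projection_pair(2)[OF i(1-6) e_e(2)]) (simp add: t1 abr)
    show "ph f ** ph g = ketbra e e" by (rule projection_pair(2)[OF i(7-12) e_e(1)]) (simp add: t2 abr)
    show "trace (p f) * trace (p g) = of_nat CARD('n)" unfolding tp n of_real_mult[symmetric] rr ..
    show "trace (ph f) * trace (ph g) = of_nat CARD('n)" unfolding tph n of_real_mult[symmetric] rr ..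
  qed (rule f g)+
qed

end

theorem theorem6p2:
  fixes V :: "complex^('n::finite \<times> 'n)^('n \<times> 'n)"
    and e ehat f g :: "complex^'n"
    and U :: "complex^'n^'n"
  assumes "mult_unitary V" and "mult_one V"
    and "norm e = 1" and "fixedv V e"
    and "norm ehat = 1" and "cofixedv V ehat"
    and "cinner e ehat = complex_of_real (1 / sqrt (real CARD('n)))"
    and "unitary_op U"
    and "\<forall>\<omega>. clin_functional \<omega> \<longrightarrow>
           U *v (slice_left V \<omega> *v e) = slice_left (cadj V) \<omega> *v e"
    and "presubgroup V e f" and "presubgroup V e g"
    and "cinner f g = complex_of_real (1 / sqrt (real CARD('n)))"
  shows "unital_star_subalg (Aff V e ehat U f) \<and> unital_star_subalg (Bgg V e ehat U g) \<and>
    (\<exists>!W. mult_unitary W \<and> mult_one W \<and> fixedv W g \<and> cofixedv W f \<and>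
          leftS W = Aff V e ehat U f \<and> rightS W = Bgg V e ehat U g)"
proof -
  interpret munitary_U V e ehat U
  proof (unfold_locales)
    fix \<zeta> \<eta>
    show "U *v (Lsl V \<zeta> \<eta> *v e) = cadj (Lsl V \<eta> \<zeta>) *v e"
      using assms(9)[rule_format, OF clin_functional_vec[of \<zeta> \<eta>]] by (simp add: slice_left_vec Lsl_cadj)
  qed (use assms mult_one_line in auto)
  have ps: "psub f" "psub g" using assms(10,11) by (simp_all add: presubgroup_def psub_def)
  have re: "z = complex_of_real (Re z)" if "z \<in> \<real>" for z using that by (simp add: complex_is_Real_iff complex_eq_iff)
  interpret complementary_pair V e ehat U f g
    by (rule complementary_pairI[OF ps, of "Re (cinner f e)" "Re (cinner g e)"])
       (use assms(10-12) re in \<open>auto simp: presubgroup_def\<close>)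
  interpret d: complementary_pair "dualV V" ehat e U f g by (rule dual_complementary_pair)
  have im: "v \<in> (\<lambda>v. U *v v) ` H \<longleftrightarrow> U *v v \<in> H" for v H
    by (metis (no_types, lifting) UU_mv image_iff)
  \<comment> \<open>The hatted sets are those of the dual unitary, with e and ehat
    exchanged.\<close>
  have sets: "Gsub V e f = G f" "Dsub V e U g = D g" "hatDsub V ehat f = d.G f" "hatGsub V ehat U g = d.D g"
    unfolding Gsub_def Dsub_def hatDsub_def hatGsub_def im leftS_eq rightS_eq Hup_def Hdown_def mem_Collect_eq
    by (auto simp: G_iff d.G_iff D_def d.D_def ps psub_dual dual_fix_iff ph_fix_iff d.ph_fix_iff)
  have AB: "Aff V e ehat U f = A" "Bgg V e ehat U g = B"
    by (simp_all add: Aff_def Bgg_def A_def B_def Tf_def sets)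
  interpret w: munitary_one W g f by (rule W_munitary_one[OF assms(12)])
  interpret dw: munitary_one "dualV W" f g by (rule w.dual_munitary_one)
  have W: "leftS W = A" "rightS W = B" by (rule W_algebras[OF assms(12)])+
  show ?thesis unfolding AB
  proof (intro conjI ex1I[of _ W])
    \<comment> \<open>Closure under products and adjoints is inherited from the slice algebras of a
      multiplicative unitary of multiplicity one.\<close>
    show "unital_star_subalg A" using w.unital_star_subalg_S by (simp add: w.leftS_eq flip: W)
    show "unital_star_subalg B" using dw.unital_star_subalg_S by (simp add: w.rightS_eq flip: W)
    show "mult_unitary W" "mult_one W" "fixedv W g" "cofixedv W f" "leftS W = A" "rightS W = B"
      by (rule w.mult_unitary w.mult_one w.fixed_e w.cofixed_e' W)+
    fix W' assume W': "mult_unitary W' \<and> mult_one W' \<and> fixedv W' g \<and> cofixedv W' f \<and> leftS W' = A \<and> rightS W' = B"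
    interpret w': munitary_one W' g f
      by unfold_locales (use W' w.norm_e w.norm_e' w.ee' mult_one_line in auto)
    show "W' = W"
      by (rule w.determined_by_slices[OF w'.munitary_one_axioms]) (use W W' w.leftS_eq w'.leftS_eq w.rightS_eq w'.rightS_eq in auto)
  qed
qed

end
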